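(* Let $\mathfrak P$ be a Laurent differentially essential and super essential system of sparse generic Laurent differential polynomials, let $l\in\{1,\dots,L\}$ with $D_l(\mathfrak P)\ne 0$, and let $\mathcal Q$ be the associated set of irreducible factors of $D_l(\mathfrak P)$. Suppose that there exists $Q\in\mathcal Q$ such that $(\mathcal S_{\tau^Q})\cap\mathbb Q[\mathcal C_{\tau^Q}]$ has codimension one. If $\Xi(D_l(\mathfrak P))\neq 0$, then $\Xi(D_l(\mathfrak P))=\mathfrak E\,\partial\mathrm{Res}(\mathfrak P)$ with $\mathfrak E\in\mathfrak D$.
   Context: Generic system. Let $n\ge2$, $U=\{u_1,\dots,u_{n-1}\}$ differential indeterminates with derivation $\partial$, $u_{j,k}=\partial^ku_j$, $u_{j,0}=u_j$, $0\in\mathbb N$. For each $i=1,\dots,n$ let $M_i,M_{i,1},\dots,M_{i,l_i}$ be distinct Laurent monomials in the $u_{j,k}$, let $A_i=\{\mathfrak a_i,\mathfrak a_{i,1},\dots,\mathfrak a_{i,l_i}\}$ be differential indeterminates over $\mathbb Q$, $A=\bigcup_iA_i$, $\mathfrak D=\mathbb Q\{A\}$, $\mathbb F_i=\mathfrak a_iM_i+\sum_{k=1}^{l_i}\mathfrak a_{i,k}M_{i,k}$ and $\mathfrak P=\{\mathbb F_1,\dots,\mathbb F_n\}\subset\mathfrak D\{U^{\pm}\}=\mathfrak D[u_{j,k}^{\pm1}: 1\le j\le n-1,k\in\mathbb N]$. Each $\mathbb F_i$ involves some $u_{j,k}$, and for each $j$ some $u_{j,k}$ occurs in some $\mathbb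 F_i$. $[\mathfrak P]$ is the differential ideal generated by $\mathfrak P$ in $\mathfrak D\{U^\pm\}$. Differential resultant. $\mathfrak P$ is Laurent differentially essential if for each $i$ there is $k_i\in\{1,\dots,l_i\}$ such that the set $\{M_{i,k_i}M_i^{-1}: 1\le i\le n\}$ has differential transcendence degree $n-1$ over $\mathbb Q$. Then $[\mathfrak P]\cap\mathfrak D$ is a prime differential ideal of codimension one equal to $\mathrm{sat}(R)$ for an irreducible $R=\partial\mathrm{Res}(\mathfrak P)\in\mathfrak D$, the sparse differential resultant; $\mathrm{sat}(R)$ is the set of differential polynomials in $\mathfrak D$ with zero differential remainder w.r.t. $R$ under any elimination ranking. Orders. $\mathfrak S_j(f)$ is the set of $k$ such that $u_{j,k}$ occurs in $f$; $o_{i,j}=\max\mathfrak S_j(\mathbb F_i)$ ($-\infty$ if empty). $J_i=\max_\mu\sum_{h\ne i}o_{h,\mu(h)}$ over bijections $\mu:\{1,\dots,n\}\setminus\{i\}\to\{1,\dots,n-1\}$. $\mathfrak P$ is super essential if $J_i\ge0$ for all $i$. $\gamma_j=\min\bigcup_i\mathfrak S_j(\mathbb F_i)$, $\gamma=\sum_j\gamma_j$, $M'_j=\max_i\{o_{i,j}+J_i\}-\gamma$. Put $\mathrm{ps}(\mathfrak P)=\{\partial^k\mathbb F_i: 1\le i\le n,\ 0\le k\le J_i-\gamma\}$, $L=\sum_i(J_i-\gamma+1)=|\mathrm{ps}(\mathfrak P)|$, $\mathcal V(\mathfrak P)=\{u_{j,k}:\gamma_j\le k\le M'_j\}$, of cardinality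 $L-1$. Algebraic generic system. Fix bijections $\lambda:\mathrm{ps}(\mathfrak P)\to\{1,\dots,L\}$, $\rho=\lambda^{-1}$, and $\upsilon:\mathcal Y=\{y_1,\dots,y_{L-1}\}\to\mathcal V(\mathfrak P)$ ($y_h$ algebraic indeterminates), extended to Laurent monomials. $\mathcal A(f)\subset\mathbb Z^{L-1}$ is the set of $\alpha$ such that $\upsilon(y^\alpha)$ has nonzero coefficient in $f$. With algebraic indeterminates $c^h_\alpha$ over $\mathbb Q$, put $P_h=\sum_{\alpha\in\mathcal A(\rho(h))}c^h_\alpha y^\alpha$, $\mathcal S=\mathrm{ags}(\mathfrak P)=\{P_1,\dots,P_L\}$, $\mathcal C_h=\{c_\alpha^h\}_\alpha$, $\mathcal C=\bigcup_h\mathcal C_h$. The specialization $\Xi:\mathbb Q[\mathcal C][\mathcal Y^\pm]\to\mathfrak D\{U^\pm\}$ is the ring homomorphism sending $c^h_\alpha$ to the coefficient of $\upsilon(y^\alpha)$ in $\rho(h)$ and $y_h$ to $\upsilon(y_h)$; so $\Xi(P_h)=\rho(h)$. Write $P_h=c_hT_h+\sum_sc_{h,s}T_{h,s}$ with Laurent monomials $T$, where it is assumed that the distinguished monomials are such that $\Xi(c_h)=\partial^k\mathfrak a_i$ when $\rho(h)=\partial^k\mathbb F_i$. Put $\epsilon_h=-\sum_sc_{h,s}T_{h,s}/T_h$ and $\epsilon=(\mathcal C\setminus\{c_1,\dots,c_L\};\epsilon_1,\dots,\epsilon_L)$; $G(\epsilon)$ denotes replacing each $c_h$ by $\epsilon_h$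 in $G\in\mathbb Q[\mathcal C]$. Sylvester determinants (Canny–Emiris construction). Let $Q_h$ be the convex hull of $\mathcal A(\rho(h))$, $N=Q_1+\dots+Q_L$, and $\mathcal L$ the affine lattice generated by the Minkowski sum $\sum_h\mathcal A(\rho(h))$. Sufficiently generic linear liftings of $Q_1,\dots,Q_L$ define, by projecting the lower envelope of the Minkowski sum of the lifted polytopes, a mixed subdivision of $N$ whose maximal cells are written $F_1+\dots+F_L$, $F_h$ a face of $Q_h$, $\sum_h\dim F_h=\dim N$. Choose a small generic vector $\delta$ parallel to the affine span of $N$ with $\mathcal E=\mathcal L\cap(N+\delta)\ne\emptyset$. For $p\in\mathcal E$ let $F_1+\dots+F_L$ be the maximal cell with $p-\delta$ in its relative interior; let $h(p)$ be the largest index $h$ with $F_h=\{a(p)\}$ a vertex, for a total order of the indices in which $l$ is the smallest. $S_l(\mathfrak P)$ is the square matrix indexed by $\mathcal E\times\mathcal E$ whose row $p$ lists the coefficients of $y^{p-a(p)}P_{h(p)}$ in the monomials $y^q$, $q\in\mathcal E$; $D_l(\mathfrak P)=\det S_l(\mathfrak P)\in\mathbb Q[\mathcal C]$. $\mathcal Q$ is the set of irreducible factors $Q$ of $D_l(\mathfrak P)$ in $\mathbb Q[\mathcal C]$ with $Q(\epsilon)=0$. Subsystems. For $\tau\in(\mathbb N\cup\{-\infty\})^n$ with $\tau_i\le J_i-\gamma$, let $\mathrm{PS}(\tau)=\{\partial^k\mathbb F_i:0\le k\le\tau_i\}$ (no $k$ if $\tau_i=-\infty$), $\mathcal S_\tau=\{P_{\lambda(f)}:f\in\mathrm{PS}(\tau)\}$,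 $\mathcal C_\tau=\bigcup_{f\in\mathrm{PS}(\tau)}\mathcal C_{\lambda(f)}$, $\mathcal V(\tau)=\{u_{j,k}:\gamma_j\le k\le\kappa_j\}$ with $\kappa_j=\max_i\{o_{i,j}+\tau_i\}$, $\mathcal Y(\mathcal S_\tau)=\upsilon^{-1}(\mathcal V(\tau))$, and $(\mathcal S_\tau)$ the ideal generated by $\mathcal S_\tau$ in $\mathbb Q[\mathcal C_\tau][\mathcal Y(\mathcal S_\tau)^\pm]$. For $Q\in\mathcal Q$, $\tau^Q$ is the (unique) componentwise smallest such $\tau$ with $Q\in\mathbb Q[\mathcal C_\tau]$. Codimension refers to ideals of the polynomial ring $\mathbb Q[\mathcal C_\tau]$. *)

theory Defs
  imports
    "HOL-Analysis.Polytope"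
    "HOL-Algebra.Ring_Divisibility"
    "HOL-Combinatorics.Permutations"
    "HOL-Library.Poly_Mapping"
    "HOL-Library.Extended"
    "HOL-Library.Extended_Nat"
begin

alias lookup = Poly_Mapping.lookup
alias keys = Poly_Mapping.keys
alias single = Poly_Mapping.single


section \<open>Polynomials and Laurent polynomials\<close>

text \<open>
  A monomial is a finitely supported exponent vector, written additively.  The variables are the
  elements of a type; the ring in a given set of variables is cut out by \<open>poly_over\<close>
  and \<open>laurent_over\<close>, the latter also with a prescribed set of coefficients.
\<close>

type_synonym 'x qpoly = "('x \<Rightarrow>\<^sub>0 nat) \<Rightarrow>\<^sub>0 rat"
type_synonym ('v, 'r) lpoly = "('v \<Rightarrow>\<^sub>0 int) \<Rightarrow>\<^sub>0 'r"

definition cst :: "'r \<Rightarrow> ('m::zero \<Rightarrow>\<^sub>0 'r::zero)"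
  where "cst c = single 0 c"

definition var :: "'x \<Rightarrow> 'x qpoly"
  where "var x = single (single x 1) 1"

definition vars :: "'x qpoly \<Rightarrow> 'x set"
  where "vars p = (\<Union>m\<in>keys p. keys m)"

definition lvars :: "('v, 'r::zero) lpoly \<Rightarrow> 'v set"
  where "lvars f = (\<Union>m\<in>keys f. keys m)"

definition poly_over :: "'x set \<Rightarrow> 'x qpoly set"
  where "poly_over X = {p. vars p \<subseteq> X}"

definition laurent_over :: "'r::zero set \<Rightarrow> 'v set \<Rightarrow> ('v, 'r) lpoly set"
  where "laurent_over A V = {f. (\<forall>m\<in>keys f. lookup f m \<in> A) \<and> lvars f \<subseteq> V}"

text \<open>A subset of a type-class ring, viewed as a ring of HOL-Algebra.\<close>

definition ring_on :: "'a::comm_ring_1 set \<Rightarrow> 'a ring"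
  where "ring_on A = \<lparr>carrier = A, mult = (*), one = 1, zero = 0, add = (+)\<rparr>"

text \<open>Substitution of \<open>g x\<close> for each variable \<open>x\<close>; \<open>\<phi>\<close> embeds the rationals.\<close>

definition peval :: "(rat \<Rightarrow> 'r::comm_ring_1) \<Rightarrow> ('x \<Rightarrow> 'r) \<Rightarrow> 'x qpoly \<Rightarrow> 'r"
  where "peval \<phi> g p = (\<Sum>m\<in>keys p. \<phi> (lookup p m) * (\<Prod>x\<in>keys m. g x ^ lookup m x))"

text \<open>Degree in \<open>x\<close>, coefficient of \<open>x ^ d\<close>, and partial derivative with respect to \<open>x\<close>.\<close>

definition pdeg :: "'x \<Rightarrow> 'x qpoly \<Rightarrow> nat"
  where "pdeg x p = Max (insert 0 ((\<lambda>m. lookup m x) ` keys p))"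

definition pcoeff :: "'x \<Rightarrow> nat \<Rightarrow> 'x qpoly \<Rightarrow> 'x qpoly"
  where "pcoeff x d p = (\<Sum>m\<in>{m\<in>keys p. lookup m x = d}. single (m - single x d) (lookup p m))"

definition pdiff :: "'x \<Rightarrow> 'x qpoly \<Rightarrow> 'x qpoly"
  where "pdiff x p = (\<Sum>m\<in>keys p. single (m - single x 1) (of_nat (lookup m x) * lookup p m))"

definition lpdiff :: "'v \<Rightarrow> ('v, 'r::comm_ring_1) lpoly \<Rightarrow> ('v, 'r) lpoly"
  where "lpdiff v f = (\<Sum>m\<in>keys f. single (m - single v 1) (of_int (lookup m v) * lookup f m))"


section \<open>Codimension of an ideal\<close>

definition prime_height :: "'a ring \<Rightarrow> 'a set \<Rightarrow> enat"
  where "prime_height R \<pp> = Sup {enat k | k. \<exists>c. (\<forall>i\<le>k. primeideal (c i) R)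
                                        \<and> (\<forall>i<k. c i \<subset> c (Suc i)) \<and> c k = \<pp>}"

definition ideal_codim :: "'a ring \<Rightarrow> 'a set \<Rightarrow> enat"
  where "ideal_codim R I = Inf {prime_height R \<pp> | \<pp>. primeideal \<pp> R \<and> I \<subseteq> \<pp>}"


section \<open>Differential polynomials\<close>

text \<open>The variable \<open>(b, k)\<close> is the \<open>k\<close>-th derivative of the differential indeterminate \<open>b\<close>.\<close>

fun dnext :: "'b \<times> nat \<Rightarrow> 'b \<times> nat"
  where "dnext (b, k) = (b, Suc k)"

definition deriv_poly :: "('b \<times> nat) qpoly \<Rightarrow> ('b \<times> nat) qpoly"
  where "deriv_poly p = (\<Sum>x\<in>vars p. pdiff x p * var (dnext x))"

type_synonym ('b, 'a) dlpoly = "('b \<times> nat, ('a \<times> nat) qpoly) lpoly"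

definition deriv_laurent :: "('b, 'a) dlpoly \<Rightarrow> ('b, 'a) dlpoly"
  where "deriv_laurent f =
    (\<Sum>m\<in>keys f. single m (deriv_poly (lookup f m)))
    + (\<Sum>v\<in>lvars f. lpdiff v f * single (single (dnext v) 1) 1)"

definition diff_ideal :: "('a::comm_ring_1 \<Rightarrow> 'a) \<Rightarrow> 'a set \<Rightarrow> 'a set \<Rightarrow> 'a set"
  where "diff_ideal d A S = \<Inter>{I. ideal I (ring_on A) \<and> (\<forall>f\<in>I. d f \<in> I) \<and> S \<subseteq> I}"

text \<open>Differential (in)dependence and transcendence degree over the rationals, for finite sets.
  In the test polynomial the variable \<open>(f, k)\<close> stands for the \<open>k\<close>-th derivative of \<open>f\<close>.\<close>

definition diff_independent :: "('b, 'a) dlpoly set \<Rightarrow> bool"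
  where "diff_independent T \<longleftrightarrow>
    (\<forall>p\<in>poly_over (T \<times> UNIV).
       peval (\<lambda>c. cst (cst c)) (\<lambda>(f, k). (deriv_laurent ^^ k) f) p = 0 \<longrightarrow> p = 0)"

definition diff_trdeg :: "('b, 'a) dlpoly set \<Rightarrow> nat"
  where "diff_trdeg S = Max {card T | T. T \<subseteq> S \<and> diff_independent T}"


subsection \<open>Rankings, differential remainders, saturation\<close>

definition ranking :: "'b set \<Rightarrow> (('b \<times> nat) \<times> ('b \<times> nat)) set \<Rightarrow> bool"
  where "ranking B rk \<longleftrightarrow> strict_linear_order_on (B \<times> UNIV) rk
    \<and> (\<forall>x\<in>B \<times> UNIV. (x, dnext x) \<in> rk)
    \<and> (\<forall>x\<in>B \<times> UNIV. \<forall>y\<in>B \<times> UNIV. (x, y) \<in> rk \<longrightarrow> (dnext x, dnext y) \<in> rk)"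

definition elimination_ranking :: "'b set \<Rightarrow> (('b \<times> nat) \<times> ('b \<times> nat)) set \<Rightarrow> bool"
  where "elimination_ranking B rk \<longleftrightarrow> ranking B rk
    \<and> (\<forall>a\<in>B. \<forall>b\<in>B. a \<noteq> b \<longrightarrow>
         (\<forall>k m. ((a, k), (b, m)) \<in> rk) \<or> (\<forall>k m. ((b, m), (a, k)) \<in> rk))"

definition leader :: "(('b \<times> nat) \<times> ('b \<times> nat)) set \<Rightarrow> ('b \<times> nat) qpoly \<Rightarrow> 'b \<times> nat"
  where "leader rk p = (THE x. x \<in> vars p \<and> (\<forall>y\<in>vars p. y \<noteq> x \<longrightarrow> (y, x) \<in> rk))"

text \<open>
  \<open>f\<close> is not reduced with respect to \<open>\<partial>\<^sup>k R\<close>: its degree in the \<open>k\<close>-th derivative of the leader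
  of \<open>R\<close> is at least that of \<open>\<partial>\<^sup>k R\<close> (which is 1 when \<open>k > 0\<close>).
\<close>

definition reducible_at ::
  "(('b \<times> nat) \<times> ('b \<times> nat)) set \<Rightarrow> ('b \<times> nat) qpoly \<Rightarrow> ('b \<times> nat) qpoly \<Rightarrow> nat \<Rightarrow> bool"
  where "reducible_at rk R f k \<longleftrightarrow>
    (let x = (dnext ^^ k) (leader rk R)
     in pdeg x ((deriv_poly ^^ k) R) \<le> pdeg x f)"

text \<open>
  One elementary pseudo-division step of Ritt's reduction: the highest derivative of the leader at
  which \<open>f\<close> is not reduced has its degree lowered.  The multiplier is the initial of \<open>\<partial>\<^sup>k R\<close>, that
  is, the initial of \<open>R\<close> if \<open>k = 0\<close> and the separant of \<open>R\<close> if \<open>k > 0\<close>.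
\<close>

inductive ritt_step ::
  "(('b \<times> nat) \<times> ('b \<times> nat)) set \<Rightarrow> ('b \<times> nat) qpoly \<Rightarrow> ('b \<times> nat) qpoly \<Rightarrow> ('b \<times> nat) qpoly \<Rightarrow> bool"
  for rk R where
  "\<lbrakk>reducible_at rk R f k; \<forall>j>k. \<not> reducible_at rk R f j;
    g = (deriv_poly ^^ k) R; x = (dnext ^^ k) (leader rk R)\<rbrakk>
   \<Longrightarrow> ritt_step rk R f
         (pcoeff x (pdeg x g) g * f - pcoeff x (pdeg x f) f * var x ^ (pdeg x f - pdeg x g) * g)"

definition diff_remainder ::
  "(('b \<times> nat) \<times> ('b \<times> nat)) set \<Rightarrow> ('b \<times> nat) qpoly \<Rightarrow> ('b \<times> nat) qpoly \<Rightarrow> ('b \<times> nat) qpoly \<Rightarrow> bool"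
  where "diff_remainder rk R f r \<longleftrightarrow> (ritt_step rk R)\<^sup>*\<^sup>* f r \<and> (\<forall>k. \<not> reducible_at rk R r k)"

definition sat :: "'b set \<Rightarrow> ('b \<times> nat) qpoly \<Rightarrow> ('b \<times> nat) qpoly set"
  where "sat B R = {f\<in>poly_over (B \<times> UNIV).
    \<forall>rk. elimination_ranking B rk \<longrightarrow> diff_remainder rk R f 0}"


section \<open>Sparse generic systems\<close>

text \<open>
  \<open>dim_n\<close> is \<open>n\<close>, \<open>num_terms i\<close> is \<open>l\<^sub>i\<close>, and \<open>monom_at i s\<close> is \<open>M\<^sub>i\<close> for \<open>s = 0\<close> and \<open>M\<^sub>i\<^sub>,\<^sub>s\<close> for
  \<open>1 \<le> s \<le> l\<^sub>i\<close>.  The variable \<open>(j, k)\<close> is \<open>u\<^sub>j\<^sub>,\<^sub>k\<close>; the differential indeterminate \<open>(i, s)\<close> is the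
  coefficient of \<open>monom_at i s\<close> in the \<open>i\<close>-th polynomial, so \<open>((i, 0), k)\<close> is \<open>\<partial>\<^sup>k \<aa>\<^sub>i\<close>.
\<close>

record gsystem =
  dim_n :: nat
  num_terms :: "nat \<Rightarrow> nat"
  monom_at :: "nat \<Rightarrow> nat \<Rightarrow> (nat \<times> nat \<Rightarrow>\<^sub>0 int)"

type_synonym coeff_poly = "((nat \<times> nat) \<times> nat) qpoly"
type_synonym sys_poly = "(nat, nat \<times> nat) dlpoly"

definition gpoly :: "gsystem \<Rightarrow> nat \<Rightarrow> sys_poly"
  where "gpoly P i = (\<Sum>s\<le>num_terms P i. single (monom_at P i s) (var ((i, s), 0)))"

definition indets_A :: "gsystem \<Rightarrow> (nat \<times> nat) set"
  where "indets_A P = {(i, s). i \<in> {1..dim_n P} \<and> s \<le> num_terms P i}"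

definition ring_D :: "gsystem \<Rightarrow> coeff_poly set"
  where "ring_D P = poly_over (indets_A P \<times> UNIV)"

definition ring_DU :: "gsystem \<Rightarrow> sys_poly set"
  where "ring_DU P = laurent_over (ring_D P) ({1..dim_n P - 1} \<times> UNIV)"

definition occ :: "nat \<Rightarrow> sys_poly \<Rightarrow> nat set"
  where "occ j f = {k. (j, k) \<in> lvars f}"

definition generic_system :: "gsystem \<Rightarrow> bool"
  where "generic_system P \<longleftrightarrow> 2 \<le> dim_n P
    \<and> (\<forall>i\<in>{1..dim_n P}. inj_on (monom_at P i) {0..num_terms P i}
         \<and> (\<forall>s\<le>num_terms P i. keys (monom_at P i s) \<subseteq> {1..dim_n P - 1} \<times> UNIV)
         \<and> lvars (gpoly P i) \<noteq> {})
    \<and> (\<forall>j\<in>{1..dim_n P - 1}. \<exists>i\<in>{1..dim_n P}. occ j (gpoly P i) \<noteq> {})"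

definition diff_essential :: "gsystem \<Rightarrow> bool"
  where "diff_essential P \<longleftrightarrow>
    (\<exists>k. (\<forall>i\<in>{1..dim_n P}. k i \<in> {1..num_terms P i})
       \<and> diff_trdeg ((\<lambda>i. single (monom_at P i (k i) - monom_at P i 0) 1 :: sys_poly) ` {1..dim_n P})
           = dim_n P - 1)"

text \<open>The sparse differential resultant is determined up to a nonzero rational factor only.\<close>

definition is_diff_resultant :: "gsystem \<Rightarrow> coeff_poly \<Rightarrow> bool"
  where "is_diff_resultant P R \<longleftrightarrow> R \<in> ring_D P
    \<and> ring_irreducible\<^bsub>ring_on (ring_D P)\<^esub> R
    \<and> {p\<in>ring_D P. cst p \<in> diff_ideal deriv_laurent (ring_DU P) (gpoly P ` {1..dim_n P})}
        = sat (indets_A P) R"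


subsection \<open>Orders\<close>

definition ord_u :: "gsystem \<Rightarrow> nat \<Rightarrow> nat \<Rightarrow> int extended"
  where "ord_u P i j =
    (if occ j (gpoly P i) = {} then Minf else Fin (int (Max (occ j (gpoly P i)))))"

definition Jac :: "gsystem \<Rightarrow> nat \<Rightarrow> int extended"
  where "Jac P i = Max {\<Sum>h\<in>{1..dim_n P} - {i}. ord_u P h (\<mu> h) | \<mu>.
    bij_betw \<mu> ({1..dim_n P} - {i}) {1..dim_n P - 1}}"

definition super_essential :: "gsystem \<Rightarrow> bool"
  where "super_essential P \<longleftrightarrow> (\<forall>i\<in>{1..dim_n P}. 0 \<le> Jac P i)"

definition gam :: "gsystem \<Rightarrow> nat \<Rightarrow> nat"
  where "gam P j = Min (\<Union>i\<in>{1..dim_n P}. occ j (gpoly P i))"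

definition gam_sum :: "gsystem \<Rightarrow> nat"
  where "gam_sum P = (\<Sum>j\<in>{1..dim_n P - 1}. gam P j)"

text \<open>The sets \<open>PS(\<tau>)\<close> and \<open>\<V>(\<tau>)\<close>; \<open>\<partial>\<^sup>k\<close> is iteration of the derivation.\<close>

definition PS :: "gsystem \<Rightarrow> (nat \<Rightarrow> int extended) \<Rightarrow> sys_poly set"
  where "PS P \<tau> = {(deriv_laurent ^^ k) (gpoly P i) | i k. i \<in> {1..dim_n P} \<and> Fin (int k) \<le> \<tau> i}"

definition vars_upto :: "gsystem \<Rightarrow> (nat \<Rightarrow> int extended) \<Rightarrow> (nat \<times> nat) set"
  where "vars_upto P \<tau> = {(j, k). j \<in> {1..dim_n P - 1} \<and> gam P j \<le> k
    \<and> Fin (int k) \<le> Max ((\<lambda>i. ord_u P i j + \<tau> i) ` {1..dim_n P})}"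

definition ps :: "gsystem \<Rightarrow> sys_poly set"
  where "ps P = {(deriv_laurent ^^ k) (gpoly P i) | i k.
    i \<in> {1..dim_n P} \<and> Fin (int k) \<le> Jac P i - Fin (int (gam_sum P))}"

definition ps_vars :: "gsystem \<Rightarrow> (nat \<times> nat) set"
  where "ps_vars P = {(j, k). j \<in> {1..dim_n P - 1} \<and> gam P j \<le> k
    \<and> Fin (int k) \<le> Max ((\<lambda>i. ord_u P i j + Jac P i) ` {1..dim_n P}) - Fin (int (gam_sum P))}"

definition size_L :: "gsystem \<Rightarrow> nat"
  where "size_L P = card (ps P)"


section \<open>The associated algebraic generic system\<close>

text \<open>
  The indeterminates \<open>y\<^sub>1, \<dots>, y\<^sub>L\<^sub>-\<^sub>1\<close> are indexed by an arbitrary finite type \<open>'d\<close> with \<open>L - 1\<close>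
  elements, so that the polytopes live in \<open>real ^ 'd\<close>.  The variable \<open>(h, \<alpha>)\<close> is the generic
  coefficient \<open>c\<^sup>h\<^sub>\<alpha>\<close>.
\<close>

type_synonym 'd expo = "'d \<Rightarrow>\<^sub>0 int"
type_synonym 'd cpoly = "(nat \<times> 'd expo) qpoly"

record 'd labelling =
  lam :: "sys_poly \<Rightarrow> nat"
  ups :: "'d \<Rightarrow> nat \<times> nat"

definition valid_labelling :: "gsystem \<Rightarrow> 'd::finite labelling \<Rightarrow> bool"
  where "valid_labelling P B \<longleftrightarrow> CARD('d) = size_L P - 1
    \<and> bij_betw (lam B) (ps P) {1..size_L P} \<and> bij_betw (ups B) UNIV (ps_vars P)"

definition rho :: "gsystem \<Rightarrow> 'd labelling \<Rightarrow> nat \<Rightarrow> sys_poly"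
  where "rho P B = inv_into (ps P) (lam B)"

definition ups_mono :: "'d labelling \<Rightarrow> 'd expo \<Rightarrow> (nat \<times> nat \<Rightarrow>\<^sub>0 int)"
  where "ups_mono B \<alpha> = (\<Sum>y\<in>keys \<alpha>. single (ups B y) (lookup \<alpha> y))"

definition supp :: "gsystem \<Rightarrow> 'd labelling \<Rightarrow> nat \<Rightarrow> 'd expo set"
  where "supp P B h = {\<alpha>. lookup (rho P B h) (ups_mono B \<alpha>) \<noteq> 0}"

definition ags_poly :: "gsystem \<Rightarrow> 'd labelling \<Rightarrow> nat \<Rightarrow> ('d, 'd cpoly) lpoly"
  where "ags_poly P B h = (\<Sum>\<alpha>\<in>supp P B h. single \<alpha> (var (h, \<alpha>)))"

definition ags_coeffs :: "gsystem \<Rightarrow> 'd labelling \<Rightarrow> (nat \<times> 'd expo) set"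
  where "ags_coeffs P B = (SIGMA h : {1..size_L P}. supp P B h)"

text \<open>The restriction of the specialization \<open>\<Xi>\<close> to the coefficient ring \<open>\<rat>[\<C>]\<close>.\<close>

definition Xi :: "gsystem \<Rightarrow> 'd labelling \<Rightarrow> 'd cpoly \<Rightarrow> coeff_poly"
  where "Xi P B = peval cst (\<lambda>(h, \<alpha>). lookup (rho P B h) (ups_mono B \<alpha>))"

text \<open>\<open>T h\<close> is the exponent of the distinguished monomial of the \<open>h\<close>-th polynomial.\<close>

definition distinguished :: "gsystem \<Rightarrow> 'd labelling \<Rightarrow> (nat \<Rightarrow> 'd expo) \<Rightarrow> bool"
  where "distinguished P B T \<longleftrightarrow> (\<forall>h\<in>{1..size_L P}. T h \<in> supp P B h
    \<and> (\<forall>i\<in>{1..dim_n P}. \<forall>k. rho P B h = (deriv_laurent ^^ k) (gpoly P i)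
          \<longrightarrow> Xi P B (var (h, T h)) = var ((i, 0), k)))"

definition eps :: "gsystem \<Rightarrow> 'd labelling \<Rightarrow> (nat \<Rightarrow> 'd expo) \<Rightarrow> nat \<Rightarrow> ('d, 'd cpoly) lpoly"
  where "eps P B T h = - (\<Sum>\<alpha>\<in>supp P B h - {T h}. single (\<alpha> - T h) (var (h, \<alpha>)))"

definition subst_eps ::
  "gsystem \<Rightarrow> 'd labelling \<Rightarrow> (nat \<Rightarrow> 'd expo) \<Rightarrow> 'd cpoly \<Rightarrow> ('d, 'd cpoly) lpoly"
  where "subst_eps P B T = peval (\<lambda>c. cst (cst c))
    (\<lambda>(h, \<alpha>). if \<alpha> = T h then eps P B T h else cst (var (h, \<alpha>)))"


section \<open>Sylvester determinants: the Canny-Emiris construction\<close>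

definition emb :: "'d::finite expo \<Rightarrow> real ^ 'd"
  where "emb \<alpha> = (\<chi> y. real_of_int (lookup \<alpha> y))"

definition newton :: "gsystem \<Rightarrow> 'd::finite labelling \<Rightarrow> nat \<Rightarrow> (real ^ 'd) set"
  where "newton P B h = convex hull (emb ` supp P B h)"

definition newton_sum :: "gsystem \<Rightarrow> 'd::finite labelling \<Rightarrow> (real ^ 'd) set"
  where "newton_sum P B = (\<Sum>h\<in>{1..size_L P}. newton P B h)"

definition affine_lattice :: "'d expo set \<Rightarrow> 'd expo set"
  where "affine_lattice S = {\<Sum>\<alpha>\<in>X. frag_cmul (c \<alpha>) \<alpha> | X c. finite X \<and> X \<subseteq> S \<and> (\<Sum>\<alpha>\<in>X. c \<alpha>) = 1}"

definition lattice_L :: "gsystem \<Rightarrow> 'd labelling \<Rightarrow> 'd expo set"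
  where "lattice_L P B = affine_lattice (\<Sum>h\<in>{1..size_L P}. supp P B h)"

record 'd ce_choice =
  lifting :: "nat \<Rightarrow> real ^ 'd \<Rightarrow> real"
  shift :: "real ^ 'd"
  idx_order :: "(nat \<times> nat) set"

definition lifted ::
  "gsystem \<Rightarrow> 'd::finite labelling \<Rightarrow> 'd ce_choice \<Rightarrow> nat \<Rightarrow> ((real ^ 'd) \<times> real) set"
  where "lifted P B X h = (\<lambda>x. (x, lifting X h x)) ` newton P B h"

text \<open>
  The faces of the lower envelope of a polytope are those minimizing a functional \<open>(v, 1)\<close> whose
  last coordinate is positive.  The face of a Minkowski sum in a given direction is the sum of the
  faces of the summands in this direction; hence the family of the \<open>F\<^sub>h\<close> below is the cell
  \<open>F\<^sub>1 + \<dots> + F\<^sub>L\<close> obtained by projecting the lower face of the lifted Minkowski sum.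
\<close>

definition lower_face :: "real ^ 'd \<Rightarrow> ((real ^ 'd::finite) \<times> real) set \<Rightarrow> ((real ^ 'd) \<times> real) set"
  where "lower_face v S = {p\<in>S. \<forall>q\<in>S. v \<bullet> fst p + snd p \<le> v \<bullet> fst q + snd q}"

definition max_cells ::
  "gsystem \<Rightarrow> 'd::finite labelling \<Rightarrow> 'd ce_choice \<Rightarrow> (nat \<Rightarrow> (real ^ 'd) set) set"
  where "max_cells P B X =
    {(\<lambda>h. if h \<in> {1..size_L P} then fst ` lower_face v (lifted P B X h) else {}) | v.
      aff_dim (fst ` lower_face v (\<Sum>h\<in>{1..size_L P}. lifted P B X h)) = aff_dim (newton_sum P B)}"

definition cell_sum :: "gsystem \<Rightarrow> (nat \<Rightarrow> (real ^ 'd::finite) set) \<Rightarrow> (real ^ 'd) set"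
  where "cell_sum P F = (\<Sum>h\<in>{1..size_L P}. F h)"

text \<open>Genericity of the liftings: the induced subdivision is mixed.\<close>

definition generic_lifting :: "gsystem \<Rightarrow> 'd::finite labelling \<Rightarrow> 'd ce_choice \<Rightarrow> bool"
  where "generic_lifting P B X \<longleftrightarrow> (\<forall>h\<in>{1..size_L P}. linear (lifting X h))
    \<and> (\<forall>F\<in>max_cells P B X. (\<Sum>h\<in>{1..size_L P}. aff_dim (F h)) = aff_dim (newton_sum P B))"

definition points_E :: "gsystem \<Rightarrow> 'd::finite labelling \<Rightarrow> 'd ce_choice \<Rightarrow> 'd expo set"
  where "points_E P B X = {p\<in>lattice_L P B. emb p - shift X \<in> newton_sum P B}"

text \<open>
  Genericity and smallness of \<open>\<delta>\<close>: when \<open>\<delta>\<close> is scaled down towards 0, no translated lattice point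
  meets the boundary of a maximal cell.  Thus every \<open>p - \<delta>\<close> in \<open>N\<close> lies in the relative interior of a
  maximal cell, and replacing \<open>\<delta>\<close> by a shorter multiple changes nothing.
\<close>

definition small_generic_shift :: "gsystem \<Rightarrow> 'd::finite labelling \<Rightarrow> 'd ce_choice \<Rightarrow> bool"
  where "small_generic_shift P B X \<longleftrightarrow>
    (\<exists>x\<in>affine hull newton_sum P B. \<exists>y\<in>affine hull newton_sum P B. shift X = x - y)
    \<and> (\<forall>t\<in>{0<..1}. \<forall>p\<in>lattice_L P B. emb p - t *\<^sub>R shift X \<in> newton_sum P B \<longrightarrow>
         (\<exists>F\<in>max_cells P B X. emb p - t *\<^sub>R shift X \<in> rel_interior (cell_sum P F)))"

definition valid_choice :: "gsystem \<Rightarrow> 'd::finite labelling \<Rightarrow> 'd ce_choice \<Rightarrow> nat \<Rightarrow> bool"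
  where "valid_choice P B X l \<longleftrightarrow> generic_lifting P B X \<and> small_generic_shift P B X
    \<and> points_E P B X \<noteq> {}
    \<and> strict_linear_order_on {1..size_L P} (idx_order X)
    \<and> (\<forall>h\<in>{1..size_L P} - {l}. (l, h) \<in> idx_order X)"

definition cell_at ::
  "gsystem \<Rightarrow> 'd::finite labelling \<Rightarrow> 'd ce_choice \<Rightarrow> 'd expo \<Rightarrow> nat \<Rightarrow> (real ^ 'd) set"
  where "cell_at P B X p =
    (THE F. F \<in> max_cells P B X \<and> emb p - shift X \<in> rel_interior (cell_sum P F))"

definition row_index :: "gsystem \<Rightarrow> 'd::finite labelling \<Rightarrow> 'd ce_choice \<Rightarrow> 'd expo \<Rightarrow> nat"
  where "row_index P B X p =
    (let V = {h\<in>{1..size_L P}. \<exists>a. cell_at P B X p h = {emb a}}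
     in THE h. h \<in> V \<and> (\<forall>h'\<in>V. h' \<noteq> h \<longrightarrow> (h', h) \<in> idx_order X))"

definition row_vertex :: "gsystem \<Rightarrow> 'd::finite labelling \<Rightarrow> 'd ce_choice \<Rightarrow> 'd expo \<Rightarrow> 'd expo"
  where "row_vertex P B X p = (THE a. cell_at P B X p (row_index P B X p) = {emb a})"

definition sylv ::
  "gsystem \<Rightarrow> 'd::finite labelling \<Rightarrow> 'd ce_choice \<Rightarrow> 'd expo \<Rightarrow> 'd expo \<Rightarrow> 'd cpoly"
  where "sylv P B X p q =
    lookup (single (p - row_vertex P B X p) 1 * ags_poly P B (row_index P B X p)) q"

definition sylv_det :: "gsystem \<Rightarrow> 'd::finite labelling \<Rightarrow> 'd ce_choice \<Rightarrow> 'd cpoly"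
  where "sylv_det P B X = (\<Sum>\<pi>\<in>{\<pi>. \<pi> permutes points_E P B X}.
    of_int (sign \<pi>) * (\<Prod>p\<in>points_E P B X. sylv P B X p (\<pi> p)))"

definition factors_Q ::
  "gsystem \<Rightarrow> 'd::finite labelling \<Rightarrow> 'd ce_choice \<Rightarrow> (nat \<Rightarrow> 'd expo) \<Rightarrow> 'd cpoly set"
  where "factors_Q P B X T = (let K = ring_on (poly_over (ags_coeffs P B)) in
    {Q\<in>carrier K. ring_irreducible\<^bsub>K\<^esub> Q \<and> Q divides\<^bsub>K\<^esub> sylv_det P B X \<and> subst_eps P B T Q = 0})"


section \<open>Subsystems\<close>

text \<open>Outside \<open>{1..n}\<close> the tuple \<open>\<tau>\<close> is set to \<open>-\<infinity>\<close>, so that admissible tuples form a pointwise ordered set.\<close>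

definition admissible :: "gsystem \<Rightarrow> (nat \<Rightarrow> int extended) \<Rightarrow> bool"
  where "admissible P \<tau> \<longleftrightarrow> (\<forall>i. if i \<in> {1..dim_n P}
      then (\<tau> i = Minf \<or> (\<exists>k. \<tau> i = Fin (int k))) \<and> \<tau> i \<le> Jac P i - Fin (int (gam_sum P))
      else \<tau> i = Minf)"

definition coeffs_tau :: "gsystem \<Rightarrow> 'd labelling \<Rightarrow> (nat \<Rightarrow> int extended) \<Rightarrow> (nat \<times> 'd expo) set"
  where "coeffs_tau P B \<tau> = (SIGMA h : lam B ` PS P \<tau>. supp P B h)"

definition tau_of :: "gsystem \<Rightarrow> 'd labelling \<Rightarrow> 'd cpoly \<Rightarrow> nat \<Rightarrow> int extended"
  where "tau_of P B Q = (LEAST \<tau>. admissible P \<tau> \<and> Q \<in> poly_over (coeffs_tau P B \<tau>))"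

definition ideal_S_tau ::
  "gsystem \<Rightarrow> 'd labelling \<Rightarrow> (nat \<Rightarrow> int extended) \<Rightarrow> ('d, 'd cpoly) lpoly set"
  where "ideal_S_tau P B \<tau> =
    Idl\<^bsub>ring_on (laurent_over (poly_over (coeffs_tau P B \<tau>)) (ups B -` vars_upto P \<tau>))\<^esub>
      (ags_poly P B ` lam B ` PS P \<tau>)"

definition elim_ideal :: "gsystem \<Rightarrow> 'd labelling \<Rightarrow> (nat \<Rightarrow> int extended) \<Rightarrow> 'd cpoly set"
  where "elim_ideal P B \<tau> = {p\<in>poly_over (coeffs_tau P B \<tau>). cst p \<in> ideal_S_tau P B \<tau>}"

end

theory Submission
  imports Defs "HOL-Computational_Algebra.Polynomial" "HOL-Computational_Algebra.Fraction_Field" "HOL-Library.Countable"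
begin

text \<open>
  It suffices to show that \<open>R\<close> divides \<open>\<Xi>(Q)\<close>. Take a field with algebraically independent values for the
  \<open>u\<^sub>j\<^sub>,\<^sub>k\<close>, the derivatives of the \<open>\<aa>\<^sub>i\<^sub>,\<^sub>s\<close> with \<open>s \<noteq> 0\<close>, and the \<open>c\<close>. Solving \<open>\<partial>\<^sup>k\<F>\<^sub>i = 0\<close> for \<open>\<partial>\<^sup>k\<aa>\<^sub>i\<close> gives
  a generic zero of \<open>[\<PP>] \<inter> \<DD> = sat(R)\<close>, and by Ritt reduction a polynomial that vanishes there and whose
  order in some \<open>\<aa>\<^sub>i\<close> is at most that of \<open>R\<close> is divisible by \<open>R\<close>. Give the coefficients of the \<open>\<partial>\<^sup>k\<F>\<^sub>i\<close>
  with \<open>k\<close> at most the order of \<open>R\<close> in \<open>\<aa>\<^sub>i\<close> their values at this point, and the other coefficients \<open>c\<close> generic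
  values subject to \<open>c\<^sub>h = \<epsilon>\<^sub>h\<close>; then \<open>Q\<close> vanishes since \<open>Q(\<epsilon>) = 0\<close>. The main step is that \<open>Q\<close> still vanishes
  when the latter \<open>c\<^sub>h\<close> are replaced by arbitrary values: otherwise a counterexample of least degree
  yields derivations of the field that are excluded, either by the independence of the \<open>\<aa>\<close>-coordinates of
  the generic zero or by the codimension hypothesis. Hence \<open>\<Xi>(Q)\<close> vanishes at a point where all
  coordinates not occurring in \<open>R\<close> up to its order are free, so \<open>R\<close> divides it.
\<close>

section \<open>Evaluation, partial derivatives and derivations\<close>

text \<open>Since \<open>Q\<close> vanishes under the substitution of \<open>eps\<close>,
  \<open>Xi P B Q\<close> lies in \<open>sat(R)\<close> at once. This is not enough, because
  \<open>sat(R)\<close> also contains the derivatives of \<open>R\<close>, which \<open>R\<close>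
  does not divide; hence the need for a point at which every derivative beyond the orders of
  \<open>R\<close> is free. Dimension counts are carried by derivations of a field of characteristic
  zero: independent values have dual derivations, a derivation that moves a single argument turns a
  relation into its partial derivative, and some nontrivial combination of dual derivations
  satisfies any smaller number of linear conditions. Which derivation is excluded depends on the set
  \<open>I\<close> of slots being freed. If some distinguished coefficient in \<open>R\<close> has
  no label in \<open>I\<close>, it is ranked highest, and Ritt reduction gives enough independent
  coordinates. Otherwise each of them has a label in \<open>I\<close>, necessarily of higher order
  than \<open>R\<close>; then the levels of \<open>R\<close> belong to the subsystem of
  \<open>Q\<close>, and the codimension hypothesis bounds the relations among the special
  values.\<close>

definition meval :: "('x \<Rightarrow> 'r::comm_ring_1) \<Rightarrow> ('x \<Rightarrow>\<^sub>0 nat) \<Rightarrow> 'r"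
  where "meval g m = (\<Prod>x\<in>keys m. g x ^ lookup m x)"

lemma meval_superset:
  assumes "finite X" "keys m \<subseteq> X"
  shows "meval g m = (\<Prod>x\<in>X. g x ^ lookup m x)"
  unfolding meval_def
  by (rule prod.mono_neutral_left) (use assms in \<open>auto simp: in_keys_iff\<close>)

lemma meval_add: "meval g (m + n) = meval g m * meval g n"
proof -
  let ?X = "keys m \<union> keys n"
  have "meval g (m + n) = (\<Prod>x\<in>?X. g x ^ lookup (m + n) x)"
    by (rule meval_superset) (use keys_add[of m n] in auto)
  also have "\<dots> = (\<Prod>x\<in>?X. g x ^ lookup m x) * (\<Prod>x\<in>?X. g x ^ lookup n x)"
    by (simp add: lookup_add power_add prod.distrib)
  also have "\<dots> = meval g m * meval g n"
    by (simp add: meval_superset[of ?X])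
  finally show ?thesis .
qed

lemma meval_0 [simp]: "meval g 0 = 1"
  by (simp add: meval_def)

lemma meval_single [simp]: "meval g (single x k) = g x ^ k"
  by (cases "k = 0") (simp_all add: meval_def)

lemma peval_meval: "peval \<phi> g p = (\<Sum>m\<in>keys p. \<phi> (lookup p m) * meval g m)"
  by (simp add: peval_def meval_def)

text \<open>A predicate on plain functions, so that evaluations in fields, univariate polynomials
  and Laurent polynomials share one set of rules.\<close>

definition rhom :: "('a::comm_ring_1 \<Rightarrow> 'b::comm_ring_1) \<Rightarrow> bool"
  where "rhom f \<longleftrightarrow> f 1 = 1 \<and> (\<forall>a b. f (a + b) = f a + f b) \<and> (\<forall>a b. f (a * b) = f a * f b)"

lemma rhomI: "f 1 = 1 \<Longrightarrow> (\<And>a b. f (a + b) = f a + f b) \<Longrightarrow> (\<And>a b. f (a * b) = f a * f b) \<Longrightarrow> rhom f"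
  by (simp add: rhom_def)

lemma rhom_add: "rhom f \<Longrightarrow> f (a + b) = f a + f b"
  and rhom_mult: "rhom f \<Longrightarrow> f (a * b) = f a * f b"
  and rhom_1: "rhom f \<Longrightarrow> f 1 = 1"
  by (auto simp: rhom_def)

lemma rhom_0: "rhom f \<Longrightarrow> f 0 = 0"
  using rhom_add[of f 0 0] by simp

lemma rhom_uminus: "rhom f \<Longrightarrow> f (- a) = - f a"
  using rhom_add[of f a "- a"] rhom_0[of f] by (simp add: add_eq_0_iff)

lemma rhom_power: "rhom f \<Longrightarrow> f (a ^ n) = f a ^ n"
  by (induct n) (simp_all add: rhom_1 rhom_mult)

lemma rhom_sum: "rhom f \<Longrightarrow> f (sum h A) = (\<Sum>x\<in>A. f (h x))"
  by (induct A rule: infinite_finite_induct) (simp_all add: rhom_0 rhom_add)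

lemma rhom_prod: "rhom f \<Longrightarrow> f (prod h A) = (\<Prod>x\<in>A. f (h x))"
  by (induct A rule: infinite_finite_induct) (simp_all add: rhom_1 rhom_mult)

lemma rhom_comp: "rhom f \<Longrightarrow> rhom g \<Longrightarrow> rhom (\<lambda>x. f (g x))"
  by (simp add: rhom_def)

lemma rhom_of_rat: "rhom (of_rat :: rat \<Rightarrow> 'f::field_char_0)"
  by (rule rhomI) (simp_all add: of_rat_add of_rat_mult)

lemma cst_0 [simp]: "cst 0 = 0"
  by (simp add: cst_def)

lemma cst_1 [simp]: "cst 1 = 1"
  by (simp add: cst_def)

lemma cst_add: "cst (a + b) = cst a + cst b"
  by (simp add: cst_def single_add)

lemma cst_mult: "cst (a * b) = (cst a :: ('m::comm_monoid_add \<Rightarrow>\<^sub>0 'r::comm_ring_1)) * cst b"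
  by (simp add: cst_def mult_single)

lemma rhom_cst: "rhom (cst :: 'r::comm_ring_1 \<Rightarrow> ('m::comm_monoid_add \<Rightarrow>\<^sub>0 'r))"
  by (rule rhomI) (simp_all add: cst_add cst_mult)

lemma rhom_const_poly: "rhom (\<lambda>c::'r::comm_ring_1. [:c:])"
  by (rule rhomI) simp_all

lemma rhom_poly: "rhom (\<lambda>p::'r::comm_ring_1 poly. poly p v)"
  by (rule rhomI) simp_all

lemma peval_superset:
  assumes "rhom \<phi>" "finite M" "keys p \<subseteq> M"
  shows "peval \<phi> g p = (\<Sum>m\<in>M. \<phi> (lookup p m) * meval g m)"
  unfolding peval_meval
  by (rule sum.mono_neutral_left) (use assms in \<open>auto simp: in_keys_iff rhom_0\<close>)

lemma peval_0 [simp]: "peval \<phi> g 0 = 0"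
  by (simp add: peval_def)

lemma peval_add:
  assumes "rhom \<phi>"
  shows "peval \<phi> g (p + q) = peval \<phi> g p + peval \<phi> g q"
proof -
  let ?M = "keys p \<union> keys q"
  have "peval \<phi> g (p + q) = (\<Sum>m\<in>?M. \<phi> (lookup (p + q) m) * meval g m)"
    by (rule peval_superset) (use assms keys_add[of p q] in auto)
  also have "\<dots> = (\<Sum>m\<in>?M. \<phi> (lookup p m) * meval g m) + (\<Sum>m\<in>?M. \<phi> (lookup q m) * meval g m)"
    by (simp add: lookup_add rhom_add[OF assms] distrib_right sum.distrib)
  also have "\<dots> = peval \<phi> g p + peval \<phi> g q"
    by (simp add: peval_superset[OF assms, of ?M])
  finally show ?thesis .
qed

lemma peval_single: "rhom \<phi> \<Longrightarrow> peval \<phi> g (single m c) = \<phi> c * meval g m"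
  by (cases "c = 0") (simp_all add: peval_meval rhom_0)

lemma peval_cst: "rhom \<phi> \<Longrightarrow> peval \<phi> g (cst c) = \<phi> c"
  by (simp add: cst_def peval_single)

lemma peval_var: "rhom \<phi> \<Longrightarrow> peval \<phi> g (var x) = g x"
  by (simp add: var_def peval_single rhom_1)

lemma peval_sum: "rhom \<phi> \<Longrightarrow> peval \<phi> g (sum f A) = (\<Sum>x\<in>A. peval \<phi> g (f x))"
  by (induct A rule: infinite_finite_induct) (simp_all add: peval_add)

lemma poly_mapping_sum_single: "p = (\<Sum>m\<in>keys p. single m (lookup p m))"
proof (rule poly_mapping_eqI)
  fix k
  have "lookup (\<Sum>m\<in>keys p. single m (lookup p m)) k = (\<Sum>m\<in>keys p. if m = k then lookup p m else 0)"
    by (simp add: lookup_sum lookup_single when_def)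
  also have "\<dots> = lookup p k"
    by (simp add: in_keys_iff)
  finally show "lookup p k = lookup (\<Sum>m\<in>keys p. single m (lookup p m)) k" ..
qed

lemma peval_mult:
  assumes "rhom \<phi>"
  shows "peval \<phi> g (p * q) = peval \<phi> g p * peval \<phi> g q"
proof -
  have s: "peval \<phi> g (single m c * single n d) = peval \<phi> g (single m c) * peval \<phi> g (single n d)" for m n c d
    by (simp add: mult_single peval_single assms meval_add rhom_mult algebra_simps)
  have "p * q = (\<Sum>m\<in>keys p. \<Sum>n\<in>keys q. single m (lookup p m) * single n (lookup q n))"
    by (subst poly_mapping_sum_single[of p], subst poly_mapping_sum_single[of q]) (simp add: sum_product)
  then have "peval \<phi> g (p * q)
      = (\<Sum>m\<in>keys p. \<Sum>n\<in>keys q. peval \<phi> g (single m (lookup p m)) * peval \<phi> g (single n (lookup q n)))"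
    by (simp add: peval_sum assms s)
  also have "\<dots> = peval \<phi> g (\<Sum>m\<in>keys p. single m (lookup p m)) * peval \<phi> g (\<Sum>n\<in>keys q. single n (lookup q n))"
    by (simp add: peval_sum assms sum_product)
  finally show ?thesis
    by (simp flip: poly_mapping_sum_single)
qed

lemma rhom_peval: "rhom \<phi> \<Longrightarrow> rhom (peval \<phi> g)"
  by (rule rhomI) (simp_all add: peval_add peval_mult peval_cst[of \<phi> g 1, simplified] rhom_1)

text \<open>Merges successive substitutions; values of \<open>Xi\<close>, \<open>subst_eps\<close>
  and \<open>psolve\<close> are reduced in this way to evaluations at a single point.\<close>

lemma peval_hom:
  assumes "rhom f"
  shows "f (peval \<phi> g p) = peval (\<lambda>c. f (\<phi> c)) (\<lambda>x. f (g x)) p"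
  by (simp add: peval_def rhom_sum rhom_mult rhom_prod rhom_power assms)

lemma peval_cong: "(\<And>x. x \<in> vars p \<Longrightarrow> g x = h x) \<Longrightarrow> peval \<phi> g p = peval \<phi> h p"
  unfolding peval_def vars_def
  by (intro sum.cong refl arg_cong2[where f = "(*)"] prod.cong arg_cong[where f = "\<lambda>a. a ^ _"]) blast

lemma var_power: "var x ^ k = single (single x k) 1"
  by (induct k) (simp_all add: var_def mult_single flip: single_add)

lemma cst_times_monomial: "cst c * (\<Prod>x\<in>keys m. var x ^ lookup m x) = single m c"
proof -
  have eq: "(\<Prod>x\<in>A. single (single x (lookup m x)) (1::rat)) = single (\<Sum>x\<in>A. single x (lookup m x)) 1" for A
    by (induct A rule: infinite_finite_induct) (simp_all add: mult_single)
  have "m = (\<Sum>x\<in>keys m. single x (lookup m x))"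
    by (rule poly_mapping_sum_single)
  then show ?thesis
    by (simp add: var_power eq cst_def mult_single)
qed

lemma peval_id: "peval cst var p = p"
  by (simp add: peval_def cst_times_monomial flip: poly_mapping_sum_single)

lemma vars_cst [simp]: "vars (cst c) = {}"
  by (cases "c = 0") (auto simp: vars_def cst_def)

lemma vars_0 [simp]: "vars 0 = {}"
  by (simp add: vars_def)

lemma vars_1 [simp]: "vars 1 = {}"
  by (simp add: vars_def)

lemma vars_var [simp]: "vars (var x) = {x}"
  by (simp add: vars_def var_def)

lemma vars_add: "vars (p + q) \<subseteq> vars p \<union> vars q"
  using keys_add[of p q] by (auto simp: vars_def)

lemma vars_uminus [simp]: "vars (- p) = vars p"
  by (simp add: vars_def)

lemma vars_diff: "vars (p - q) \<subseteq> vars p \<union> vars q"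
  using vars_add[of p "- q"] by simp

lemma vars_mult: "vars (p * q) \<subseteq> vars p \<union> vars q"
proof
  fix x assume "x \<in> vars (p * q)"
  then obtain m where m: "m \<in> keys (p * q)" "x \<in> keys m"
    by (auto simp: vars_def)
  then obtain a b where "m = a + b" "a \<in> keys p" "b \<in> keys q"
    using keys_mult[of p q] by auto
  then show "x \<in> vars p \<union> vars q"
    using m keys_add[of a b] by (auto simp: vars_def)
qed

lemma vars_sum: "vars (sum f A) \<subseteq> (\<Union>x\<in>A. vars (f x))"
  by (induct A rule: infinite_finite_induct) (use vars_add in fastforce)+

lemma finite_vars [simp]: "finite (vars p)"
  by (simp add: vars_def)

lemma poly_over_cst [simp]: "cst c \<in> poly_over X"
  and poly_over_0 [simp]: "0 \<in> poly_over X"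
  and poly_over_1 [simp]: "1 \<in> poly_over X"
  and poly_over_var: "var x \<in> poly_over X \<longleftrightarrow> x \<in> X"
  and poly_over_add: "p \<in> poly_over X \<Longrightarrow> q \<in> poly_over X \<Longrightarrow> p + q \<in> poly_over X"
  and poly_over_diff: "p \<in> poly_over X \<Longrightarrow> q \<in> poly_over X \<Longrightarrow> p - q \<in> poly_over X"
  and poly_over_mult: "p \<in> poly_over X \<Longrightarrow> q \<in> poly_over X \<Longrightarrow> p * q \<in> poly_over X"
  and poly_over_uminus: "p \<in> poly_over X \<Longrightarrow> - p \<in> poly_over X"
  using vars_add[of p q] vars_mult[of p q] vars_diff[of p q] by (auto simp: poly_over_def)

lemma poly_over_prod: "(\<And>x. x \<in> A \<Longrightarrow> f x \<in> poly_over X) \<Longrightarrow> prod f A \<in> poly_over X"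
  by (induct A rule: infinite_finite_induct) (auto intro: poly_over_mult)

lemma poly_over_power: "p \<in> poly_over X \<Longrightarrow> p ^ n \<in> poly_over X"
  by (induct n) (auto intro: poly_over_mult)

lemma poly_over_mono: "X \<subseteq> Y \<Longrightarrow> poly_over X \<subseteq> poly_over Y"
  by (auto simp: poly_over_def)

lemma peval_closed:
  assumes "\<And>c. \<phi> c \<in> A" "\<And>x. x \<in> vars p \<Longrightarrow> g x \<in> A"
    and "0 \<in> A" "1 \<in> A" "\<And>a b. a \<in> A \<Longrightarrow> b \<in> A \<Longrightarrow> a + b \<in> A" "\<And>a b. a \<in> A \<Longrightarrow> b \<in> A \<Longrightarrow> a * b \<in> A"
  shows "peval \<phi> g p \<in> A"
proof -
  have pw: "a ^ n \<in> A" if "a \<in> A" for a n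
    by (induct n) (simp_all add: assms that)
  have pr: "prod f X \<in> A" if "\<And>x. x \<in> X \<Longrightarrow> f x \<in> A" for f :: "'b \<Rightarrow> 'a" and X
    using that by (induct X rule: infinite_finite_induct) (simp_all add: assms)
  have sm: "sum f X \<in> A" if "\<And>x. x \<in> X \<Longrightarrow> f x \<in> A" for f :: "('b \<Rightarrow>\<^sub>0 nat) \<Rightarrow> 'a" and X
    using that by (induct X rule: infinite_finite_induct) (simp_all add: assms)
  show ?thesis
    unfolding peval_def by (intro sm assms(6) pr pw assms(1,2)) (auto simp: vars_def)
qed

text \<open>The step multiplies by a single variable, so that identities such as the product rule
  need checking for one variable factor only.\<close>

lemma qpoly_induct [consumes 1, case_names cst add mult_var]:
  assumes "p \<in> poly_over X"
    and c: "\<And>c. P (cst c)"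
    and a: "\<And>p q. p \<in> poly_over X \<Longrightarrow> q \<in> poly_over X \<Longrightarrow> P p \<Longrightarrow> P q \<Longrightarrow> P (p + q)"
    and v: "\<And>p x. p \<in> poly_over X \<Longrightarrow> x \<in> X \<Longrightarrow> P p \<Longrightarrow> P (p * var x)"
  shows "P p"
proof -
  have vp: "P (q * var x ^ k)" if "x \<in> X" "q \<in> poly_over X" "P q" for q x k
    using that
  proof (induct k)
    case (Suc k)
    then have "P (q * var x ^ k * var x)"
      by (intro v poly_over_mult poly_over_power) (auto simp: poly_over_var)
    then show ?case by (simp add: algebra_simps)
  qed simp
  have m: "P (cst b * (\<Prod>x\<in>A. var x ^ e x))" if "A \<subseteq> X" for b A and e :: "'a \<Rightarrow> nat"
    using that
  proof (induct A rule: infinite_finite_induct)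
    case (insert x A)
    then have "P (cst b * (\<Prod>x\<in>A. var x ^ e x) * var x ^ e x)"
      by (intro vp poly_over_mult poly_over_power poly_over_prod) (auto simp: poly_over_var)
    then show ?case
      using insert by (simp add: algebra_simps)
  qed (auto simp: c)
  have m': "P (single m (lookup p m)) \<and> single m (lookup p m) \<in> poly_over X" if "m \<in> keys p" for m
  proof -
    have "keys m \<subseteq> X"
      using assms(1) that by (auto simp: poly_over_def vars_def)
    then show ?thesis
      using m[of "keys m" "lookup p m" "lookup m"] 
      by (auto simp: cst_times_monomial poly_over_def vars_def split: if_splits)
  qed
  have "P (\<Sum>m\<in>A. single m (lookup p m)) \<and> (\<Sum>m\<in>A. single m (lookup p m)) \<in> poly_over X" if "A \<subseteq> keys p" for A
    using finite_subset[OF that finite_keys] that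
  proof (induct A rule: finite_induct)
    case empty
    then show ?case using c[of 0] by simp
  next
    case (insert m A)
    then show ?case using m'[of m] by (auto intro!: a poly_over_add)
  qed
  from this[of "keys p"] show ?thesis
    by (simp flip: poly_mapping_sum_single)
qed

section \<open>Partial derivatives and total degree\<close>

lemma lookup_pdiff: "lookup (pdiff x p) m = of_nat (lookup m x + 1) * lookup p (m + single x 1)"
proof -
  have "lookup (pdiff x p) m = (\<Sum>n\<in>keys p. if n - single x 1 = m then of_nat (lookup n x) * lookup p n else 0)"
    by (simp add: pdiff_def lookup_sum lookup_single when_def)
  also have "\<dots> = (\<Sum>n\<in>keys p. if n = m + single x 1 then of_nat (lookup n x) * lookup p n else 0)"
  proof (rule sum.cong[OF refl])
    fix n
    show "(if n - single x 1 = m then of_nat (lookup n x) * lookup p n else 0)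
        = (if n = m + single x 1 then of_nat (lookup n x) * lookup p n else 0)"
    \<comment> \<open>Subtraction of exponents is truncated, so a monomial free of \<open>x\<close>
      could be mistaken for another one; its factor \<open>lookup n x\<close> is zero, which makes
      this harmless.\<close>
    proof (cases "lookup n x = 0")
      case False
      have "n = n - single x 1 + single x 1"
        by (rule poly_mapping_eqI) (use False in \<open>auto simp: lookup_add lookup_minus lookup_single when_def\<close>)
      then have "n - single x 1 = m \<longleftrightarrow> n = m + single x 1"
        by (metis add_diff_cancel_right')
      then show ?thesis by simp
    qed (auto simp: lookup_add)
  qed
  also have "\<dots> = of_nat (lookup m x + 1) * lookup p (m + single x 1)"
    by (auto simp: lookup_add in_keys_iff)
  finally show ?thesis .
qed

lemma pdiff_add: "pdiff x (p + q) = pdiff x p + pdiff x q"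
  by (rule poly_mapping_eqI) (simp add: lookup_pdiff lookup_add algebra_simps)

lemma pdiff_cst [simp]: "pdiff x (cst c) = 0"
proof (rule poly_mapping_eqI)
  fix k :: "'a \<Rightarrow>\<^sub>0 nat"
  have "lookup (k + single x 1) x \<noteq> 0"
    by (simp add: lookup_add)
  then have "k + single x 1 \<noteq> 0"
    by auto
  then show "lookup (pdiff x (cst c)) k = lookup 0 k"
    by (simp add: lookup_pdiff cst_def lookup_single when_def)
qed

lemma lookup_single_mult:
  fixes q :: "('m::cancel_comm_monoid_add) \<Rightarrow>\<^sub>0 'r::comm_ring_1"
  shows "lookup (single m c * q) (m + n) = c * lookup q n"
proof -
  have "single m c * q = (\<Sum>k\<in>keys q. single (m + k) (c * lookup q k))"
    by (subst poly_mapping_sum_single[of q]) (simp add: sum_distrib_left mult_single)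
  then have "lookup (single m c * q) (m + n) = (\<Sum>k\<in>keys q. if k = n then c * lookup q k else 0)"
    by (simp add: lookup_sum lookup_single when_def)
  also have "\<dots> = c * lookup q n"
    by (simp add: in_keys_iff)
  finally show ?thesis .
qed

lemma lookup_single_mult_0:
  fixes q :: "('m::cancel_comm_monoid_add) \<Rightarrow>\<^sub>0 'r::comm_ring_1"
  assumes "\<nexists>n. k = m + n"
  shows "lookup (single m c * q) k = 0"
proof -
  have "single m c * q = (\<Sum>k\<in>keys q. single (m + k) (c * lookup q k))"
    by (subst poly_mapping_sum_single[of q]) (simp add: sum_distrib_left mult_single)
  then show ?thesis
    using assms by (auto simp: lookup_sum lookup_single when_def intro!: sum.neutral)
qed

lemma lookup_mult_var: "lookup (p * var y) (m + single y 1) = lookup p m"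
  using lookup_single_mult[of "single y 1" 1 p m] by (simp add: var_def mult.commute add.commute)

lemma lookup_mult_var_0: "lookup m y = 0 \<Longrightarrow> lookup (p * var y) m = 0"
  unfolding var_def mult.commute[of p] by (rule lookup_single_mult_0) (auto simp: lookup_add)

lemma pdiff_mult_var: "pdiff x (p * var y) = pdiff x p * var y + (if x = y then p else 0)"
proof (rule poly_mapping_eqI)
  fix m
  show "lookup (pdiff x (p * var y)) m = lookup (pdiff x p * var y + (if x = y then p else 0)) m"
  proof (cases "lookup m y = 0")
    case True
    then show ?thesis
      by (cases "x = y") (simp_all add: lookup_pdiff lookup_add lookup_mult_var lookup_mult_var_0 lookup_single lookup_mult_var[simplified])
  next
    case False
    define n where "n = m - single y 1"
    have m: "m = n + single y 1"
      by (rule poly_mapping_eqI) (use False in \<open>auto simp: n_def lookup_add lookup_minus lookup_single when_def\<close>)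
    have "lookup (p * var y) (m + single x 1) = lookup p (n + single x 1)"
      using lookup_mult_var[of p y "n + single x 1"] by (simp add: m add_ac)
    moreover have "lookup (pdiff x p * var y) m = lookup (pdiff x p) n"
      using lookup_mult_var by (simp add: m)
    ultimately show ?thesis
      by (cases "x = y") (simp_all add: lookup_pdiff lookup_add lookup_single m algebra_simps)
  qed
qed

lemma pdiff_0 [simp]: "pdiff x 0 = 0"
  using pdiff_cst[of x 0] by simp

lemma pdiff_1 [simp]: "pdiff x 1 = 0"
  using pdiff_cst[of x 1] by simp

lemma pdiff_var: "pdiff x (var y) = (if x = y then 1 else 0)"
  using pdiff_mult_var[of x 1 y] by simp

lemma pdiff_mult: "pdiff x (p * q) = pdiff x p * q + p * pdiff x q"
proof -
  have "q \<in> poly_over UNIV" by (simp add: poly_over_def)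
  then show ?thesis
  proof (induct q rule: qpoly_induct)
    case (cst c)
    have "pdiff x (p * cst c) = pdiff x p * cst c"
    proof (rule poly_mapping_eqI)
      fix k
      have l: "lookup (p * cst c) k = c * lookup p k" for p :: "'a qpoly" and k
        using lookup_single_mult[of 0 c p k] by (simp add: cst_def mult.commute)
      show "lookup (pdiff x (p * cst c)) k = lookup (pdiff x p * cst c) k"
        by (simp add: l lookup_pdiff)
    qed
    then show ?case by simp
  next
    case (add q r)
    then show ?case by (simp add: pdiff_add algebra_simps)
  next
    case (mult_var q y)
    have "pdiff x (p * (q * var y)) = pdiff x (p * q) * var y + (if x = y then p * q else 0)"
      using pdiff_mult_var[of x "p * q" y] by (simp add: mult.assoc)
    then show ?case
      using mult_var by (simp add: pdiff_mult_var algebra_simps)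
  qed
qed

lemma vars_pdiff: "vars (pdiff x p) \<subseteq> vars p"
proof
  fix y assume "y \<in> vars (pdiff x p)"
  then obtain m where "m \<in> keys (pdiff x p)" "y \<in> keys m"
    by (auto simp: vars_def)
  then have "m + single x 1 \<in> keys p" "y \<in> keys (m + single x 1)"
    by (auto simp: in_keys_iff lookup_pdiff lookup_add)
  then show "y \<in> vars p"
    by (auto simp: vars_def)
qed

text \<open>Characteristic zero: differentiation multiplies coefficients by positive exponents, so
  no monomial containing \<open>x\<close> is lost.\<close>

lemma pdiff_eq_0_iff: "pdiff x p = 0 \<longleftrightarrow> x \<notin> vars p"
proof
  assume 0: "pdiff x p = 0"
  show "x \<notin> vars p"
  proof
    assume "x \<in> vars p"
    then obtain m where m: "m \<in> keys p" "x \<in> keys m"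
      by (auto simp: vars_def)
    have "m = (m - single x 1) + single x 1"
      by (rule poly_mapping_eqI) (use m in \<open>auto simp: in_keys_iff lookup_add lookup_minus lookup_single when_def\<close>)
    moreover have "of_nat (k + 1) \<noteq> (0 :: rat)" for k
      by (simp only: of_nat_eq_0_iff)
    ultimately have "lookup (pdiff x p) (m - single x 1) \<noteq> 0"
      using m by (simp only: lookup_pdiff in_keys_iff mult_eq_0_iff not_False_eq_True simp_thms)
    then show False using 0 by simp
  qed
next
  assume "x \<notin> vars p"
  show "pdiff x p = 0"
  proof (rule poly_mapping_eqI)
    fix m :: "'a \<Rightarrow>\<^sub>0 nat"
    have "x \<in> keys (m + single x 1)"
      by (simp add: in_keys_iff lookup_add)
    then have "m + single x 1 \<notin> keys p"
      using \<open>x \<notin> vars p\<close> by (auto simp: vars_def)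
    then show "lookup (pdiff x p) m = lookup 0 m"
      by (simp add: lookup_pdiff in_keys_iff)
  qed
qed

definition tdeg :: "'x qpoly \<Rightarrow> nat"
  where "tdeg p = Max (insert 0 ((\<lambda>m. \<Sum>x\<in>keys m. lookup m x) ` keys p))"

text \<open>The measure for minimal counterexamples: a relation among values is replaced by one of
  its partial derivatives, which is zero or simpler.\<close>

lemma tdeg_pdiff: "pdiff x p = 0 \<or> tdeg (pdiff x p) < tdeg p"
proof (rule disjCI)
  assume "\<not> tdeg (pdiff x p) < tdeg p"
  show "pdiff x p = 0"
  proof (rule ccontr)
    assume nz: "pdiff x p \<noteq> 0"
    let ?s = "\<lambda>m. \<Sum>x\<in>keys m. lookup m x"
    have s1: "?s (m + single x 1) = Suc (?s m)" for m :: "'a \<Rightarrow>\<^sub>0 nat"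
    proof -
      have "?s (m + single x 1) = (\<Sum>y\<in>insert x (keys m). lookup (m + single x 1) y)"
        by (rule sum.mono_neutral_left) (use keys_add[of m "single x 1"] in \<open>auto simp: in_keys_iff\<close>)
      also have "\<dots> = (\<Sum>y\<in>insert x (keys m). lookup m y) + (\<Sum>y\<in>insert x (keys m). lookup (single x 1) y)"
        by (simp add: lookup_add sum.distrib)
      also have "(\<Sum>y\<in>insert x (keys m). lookup m y) = ?s m"
        by (rule sum.mono_neutral_right) (auto simp: in_keys_iff)
      also have "(\<Sum>y\<in>insert x (keys m). lookup (single x (1::nat)) y) = 1"
        by (simp add: lookup_single when_def)
      finally show ?thesis by simp
    qed
    have le: "?s m < tdeg p" if "m \<in> keys (pdiff x p)" for m
    proof -
      have "m + single x 1 \<in> keys p"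
        using that by (auto simp: in_keys_iff lookup_pdiff)
      then have "?s (m + single x 1) \<le> tdeg p"
        unfolding tdeg_def by (intro Max_ge) auto
      then show ?thesis using s1 by simp
    qed
    from nz obtain m where "m \<in> keys (pdiff x p)" by fastforce
    then have "0 < tdeg p" using le by fastforce
    then have "tdeg (pdiff x p) < tdeg p"
      unfolding tdeg_def[of "pdiff x p"] using le by (subst Max_less_iff) auto
    with \<open>\<not> tdeg (pdiff x p) < tdeg p\<close> show False ..
  qed
qed

lemma pdiff_poly_over: "p \<in> poly_over X \<Longrightarrow> pdiff x p \<in> poly_over X"
  using vars_pdiff[of x p] by (auto simp: poly_over_def)

section \<open>Derivations and the chain rule\<close>

definition is_der :: "('f::comm_ring_1 \<Rightarrow> 'f) \<Rightarrow> bool"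
  where "is_der D \<longleftrightarrow> (\<forall>a b. D (a + b) = D a + D b) \<and> (\<forall>a b. D (a * b) = a * D b + D a * b)"

lemma der_add: "is_der D \<Longrightarrow> D (a + b) = D a + D b"
  and der_mult: "is_der D \<Longrightarrow> D (a * b) = a * D b + D a * b"
  by (auto simp: is_der_def)

lemma der_0: "is_der D \<Longrightarrow> D 0 = 0"
  using der_add[of D 0 0] by simp

lemma der_1: "is_der D \<Longrightarrow> D 1 = 0"
  using der_mult[of D 1 1] by simp

lemma der_uminus: "is_der D \<Longrightarrow> D (- a) = - D a"
  using der_add[of D a "- a"] der_0[of D] by (simp add: add_eq_0_iff)

lemma der_sum: "is_der D \<Longrightarrow> D (sum f A) = (\<Sum>x\<in>A. D (f x))"
  by (induct A rule: infinite_finite_induct) (simp_all add: der_0 der_add)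

lemma der_of_nat: "is_der D \<Longrightarrow> D (of_nat n) = 0"
  by (induct n) (simp_all add: der_0 der_1 der_add)

lemma der_of_int:
  assumes "is_der D"
  shows "D (of_int n) = 0"
proof (cases n rule: int_cases2)
  case (nonneg k)
  then show ?thesis by (simp add: der_of_nat assms)
next
  case (nonpos k)
  then show ?thesis by (simp add: der_of_nat der_uminus assms)
qed

text \<open>Clear the denominator: a derivation kills integers, hence their quotients. Rational
  values are constants for every field derivation, which is why slots are temporarily set to
  rationals later.\<close>

lemma der_of_rat: 
  fixes D :: "'f::field_char_0 \<Rightarrow> 'f"
  assumes D: "is_der D"
  shows "D (of_rat r) = 0"
proof -
  obtain a b where r: "r = of_int a / of_int b" "b \<noteq> 0"
    by (cases r) (auto simp: Fract_of_int_quotient)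
  have "of_rat r * of_int b = (of_int a :: 'f)"
    using r by (simp add: of_rat_divide)
  then have "D (of_rat r * of_int b) = 0"
    by (simp add: der_of_int D)
  then show ?thesis
    using r by (simp add: der_mult D der_of_int)
qed

lemma der_peval:
  fixes D :: "'f::field_char_0 \<Rightarrow> 'f"
  assumes D: "is_der D" and X: "finite X" "vars p \<subseteq> X"
  shows "D (peval of_rat g p) = (\<Sum>x\<in>X. peval of_rat g (pdiff x p) * D (g x))"
proof -
  note [simp] = peval_cst[OF rhom_of_rat] peval_add[OF rhom_of_rat] peval_mult[OF rhom_of_rat] peval_var[OF rhom_of_rat]
  have "p \<in> poly_over X" using X by (simp add: poly_over_def)
  then show ?thesis
  proof (induct p rule: qpoly_induct)
    case (cst c)
    then show ?case by (simp add: der_of_rat D)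
  next
    case (add p q)
    then show ?case by (simp add: der_add D pdiff_add distrib_right sum.distrib)
  next
    case (mult_var p y)
    have "(\<Sum>x\<in>X. (if x = y then peval of_rat g p else 0) * D (g x)) = peval of_rat g p * D (g y)"
      using mult_var X by (simp add: if_distrib[of "\<lambda>a. a * _"] cong: if_cong)
    moreover have "peval of_rat g (if x = y then p else 0) = (if x = y then peval of_rat g p else 0)" for x
      by simp
    ultimately show ?case
      using mult_var by (simp add: der_mult D pdiff_mult_var distrib_right sum.distrib sum_distrib_left distrib_left mult_ac)
  qed
qed

lemma der_peval_0:
  fixes D :: "'f::field_char_0 \<Rightarrow> 'f"
  assumes "is_der D" "\<And>x. x \<in> vars p \<Longrightarrow> D (g x) = 0"
  shows "D (peval of_rat g p) = 0"
  using der_peval[OF assms(1) finite_vars subset_refl, of g p] assms(2) by simp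

text \<open>If \<open>p\<close> vanishes at \<open>g\<close> and \<open>D\<close> moves the value at
  \<open>z\<close> only, the partial derivative with respect to \<open>z\<close> vanishes at
  \<open>g\<close> too. Most uses of derivations take this form.\<close>

lemma der_peval_1:
  fixes D :: "'f::field_char_0 \<Rightarrow> 'f"
  assumes "is_der D" "\<And>x. x \<in> vars p \<Longrightarrow> x \<noteq> z \<Longrightarrow> D (g x) = 0"
  shows "D (peval of_rat g p) = peval of_rat g (pdiff z p) * D (g z)"
proof -
  have "D (peval of_rat g p) = (\<Sum>x\<in>insert z (vars p). peval of_rat g (pdiff x p) * D (g x))"
    by (rule der_peval) (use assms in auto)
  also have "\<dots> = (\<Sum>x\<in>{z}. peval of_rat g (pdiff x p) * D (g x))"
    by (rule sum.mono_neutral_right) (use assms(2) in auto)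
  finally show ?thesis by simp
qed

section \<open>Restriction of a polynomial to a coordinate line through \<open>g\<close>\<close>

definition upoly :: "'x \<Rightarrow> ('x \<Rightarrow> 'f::field_char_0) \<Rightarrow> 'x qpoly \<Rightarrow> 'f poly"
  where "upoly x g p = peval (\<lambda>c. [:of_rat c:]) (\<lambda>z. if z = x then [:0, 1:] else [:g z:]) p"

lemma rhom_of_rat_poly: "rhom (\<lambda>c. [:of_rat c :: 'f::field_char_0:])"
  by (rule rhom_comp[OF rhom_const_poly rhom_of_rat])

lemma poly_upoly: "poly (upoly x g p) v = peval of_rat (g(x := v)) p"
  unfolding upoly_def peval_hom[OF rhom_poly] by (auto intro!: arg_cong2[where f = "\<lambda>a b. peval a b p"])

lemma pderiv_upoly: "pderiv (upoly x g p) = upoly x g (pdiff x p)"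
proof -
  note [simp] = peval_cst[OF rhom_of_rat_poly] peval_add[OF rhom_of_rat_poly] peval_mult[OF rhom_of_rat_poly] peval_var[OF rhom_of_rat_poly]
  have "p \<in> poly_over UNIV" by (simp add: poly_over_def)
  then show ?thesis
    unfolding upoly_def
  proof (induct p rule: qpoly_induct)
    case (mult_var p y)
    then show ?case
      by (cases "x = y") (simp_all add: pdiff_mult_var pderiv_mult pderiv_pCons pderiv_smult)
  qed (simp_all add: pderiv_pCons pderiv_add pdiff_add)
qed

text \<open>Taylor expansion at \<open>a\<close> in characteristic zero: by induction on the degree
  the derivative is zero, so \<open>p\<close> is constant with value \<open>0\<close>.\<close>

lemma poly_all_derivs_0:
  fixes p :: "'f::field_char_0 poly"
  assumes "\<And>r. poly ((pderiv ^^ r) p) a = 0"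
  shows "p = 0"
  using assms
proof (induct "degree p" arbitrary: p rule: less_induct)
  case less
  show ?case
  proof (cases "degree p = 0")
    case True
    then obtain c where "p = [:c:]" by (metis degree_eq_zeroE)
    then show ?thesis using less.prems[of 0] by simp
  next
    case False
    have "pderiv p = 0"
      using less.hyps[of "pderiv p"] less.prems[of "Suc r" for r] False
      by (simp add: degree_pderiv funpow_Suc_right del: funpow.simps)
    then show ?thesis using False by (simp add: pderiv_eq_0_iff)
  qed
qed

lemma upoly_iter: "(pderiv ^^ r) (upoly x g p) = upoly x g ((pdiff x ^^ r) p)"
  by (induct r) (simp_all add: pderiv_upoly)

lemma peval_taylor:
  fixes g :: "'x \<Rightarrow> 'f::field_char_0"
  assumes "\<And>r. peval of_rat g ((pdiff x ^^ r) p) = 0"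
  shows "peval of_rat (g(x := v)) p = 0"
proof -
  have "upoly x g p = 0"
    by (rule poly_all_derivs_0[of _ "g x"]) (simp add: upoly_iter poly_upoly assms)
  then show ?thesis using poly_upoly[of x g p v] by simp
qed

text \<open>A nonzero univariate polynomial has finitely many roots, while the field contains all
  rationals. A slot can thus be held at rational values, which derivations kill, and be released
  afterwards.\<close>

lemma peval_all_rat:
  fixes g :: "'x \<Rightarrow> 'f::field_char_0"
  assumes "\<And>r. peval of_rat (g(x := of_rat r)) p = 0"
  shows "peval of_rat (g(x := v)) p = 0"
proof -
  have "range (of_rat :: rat \<Rightarrow> 'f) \<subseteq> {v. poly (upoly x g p) v = 0}"
    using assms by (auto simp: poly_upoly)
  moreover have "infinite (range (of_rat :: rat \<Rightarrow> 'f))"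
    by (metis infinite_UNIV_char_0 inj_on_def of_rat_eq_iff finite_imageD)
  ultimately have "upoly x g p = 0"
    using poly_roots_finite[of "upoly x g p"] finite_subset by blast
  then show ?thesis using poly_upoly[of x g p v] by simp
qed

section \<open>Algebraic independence and extension of derivations\<close>

text \<open>Algebraic independence over the rationals of a family indexed by \<open>S\<close>, not
  of a set of values: a repeated value makes the family dependent.\<close>

definition indep :: "'x set \<Rightarrow> ('x \<Rightarrow> 'f::field_char_0) \<Rightarrow> bool"
  where "indep S x \<longleftrightarrow> (\<forall>p\<in>poly_over S. peval of_rat x p = 0 \<longrightarrow> p = 0)"

lemma indepD: "indep S x \<Longrightarrow> p \<in> poly_over S \<Longrightarrow> peval of_rat x p = 0 \<Longrightarrow> p = 0"
  by (simp add: indep_def)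

text \<open>Pairs \<open>(a, b)\<close> are dual numbers \<open>a + b e\<close> with
  \<open>e^2 = 0\<close>. The first clauses make \<open>G\<close> a subring; the last one makes it
  the graph of a function, and asking this over \<open>0\<close> is enough because \<open>G\<close>
  is additive. Such a \<open>G\<close> is a derivation defined on a subring of the field.\<close>

definition der_graph :: "('f::field_char_0 \<times> 'f) set \<Rightarrow> bool"
  where "der_graph G \<longleftrightarrow> (1, 0) \<in> G
    \<and> (\<forall>a b c d. (a, b) \<in> G \<longrightarrow> (c, d) \<in> G \<longrightarrow> (a + c, b + d) \<in> G)
    \<and> (\<forall>a b. (a, b) \<in> G \<longrightarrow> (- a, - b) \<in> G)
    \<and> (\<forall>a b c d. (a, b) \<in> G \<longrightarrow> (c, d) \<in> G \<longrightarrow> (a * c, a * d + b * c) \<in> G)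
    \<and> (\<forall>b. (0, b) \<in> G \<longrightarrow> b = 0)"

lemma der_graphD:
  assumes "der_graph G"
  shows "(1, 0) \<in> G"
    and "(a, b) \<in> G \<Longrightarrow> (c, d) \<in> G \<Longrightarrow> (a + c, b + d) \<in> G"
    and "(a, b) \<in> G \<Longrightarrow> (- a, - b) \<in> G"
    and "(a, b) \<in> G \<Longrightarrow> (c, d) \<in> G \<Longrightarrow> (a * c, a * d + b * c) \<in> G"
    and "(0, b) \<in> G \<Longrightarrow> b = 0"
  using assms unfolding der_graph_def by blast+

lemma der_graph_0: "der_graph G \<Longrightarrow> (0, 0) \<in> G"
  using der_graphD(2)[of G 1 0 "-1" 0] der_graphD(3)[of G 1 0] der_graphD(1)[of G] by simp

lemma der_graph_diff: "der_graph G \<Longrightarrow> (a, b) \<in> G \<Longrightarrow> (c, d) \<in> G \<Longrightarrow> (a - c, b - d) \<in> G"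
  using der_graphD(2)[of G a b "- c" "- d"] der_graphD(3)[of G c d] by simp

lemma der_graph_of_nat: "der_graph G \<Longrightarrow> (of_nat n, 0) \<in> G"
  using der_graphD(1)[of G] der_graph_0[of G] der_graphD(2)[of G 1 0 _ 0] by (induct n) auto

lemma der_graph_sum:
  "der_graph G \<Longrightarrow> (\<And>i. i \<in> A \<Longrightarrow> (f i, h i) \<in> G) \<Longrightarrow> (sum f A, sum h A) \<in> G"
  by (induct A rule: infinite_finite_induct) (auto intro: der_graph_0 der_graphD(2))

text \<open>The quotient rule, extending a derivation to the fraction field of its domain.\<close>

lemma der_graph_inverse:
  assumes G: "der_graph G"
  shows "der_graph {(c / s, (d * s - c * e) / s\<^sup>2) | c d s e. (c, d) \<in> G \<and> (s, e) \<in> G \<and> s \<noteq> 0}" (is "der_graph ?H")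
  unfolding der_graph_def
proof (intro conjI allI impI)
  note D = der_graphD[OF G]
  have I: "(c / s, (d * s - c * e) / s\<^sup>2) \<in> ?H" if "(c, d) \<in> G" "(s, e) \<in> G" "s \<noteq> 0" for c d s e
    using that by blast
  show "(1, 0) \<in> ?H"
    using I[OF D(1) D(1)] by simp
  show "b = 0" if "(0, b) \<in> ?H" for b
    using that D(5) by auto
  show "(- a, - b) \<in> ?H" if "(a, b) \<in> ?H" for a b
  proof -
    from that obtain c d s e where *: "(c, d) \<in> G" "(s, e) \<in> G" "s \<noteq> 0" "a = c / s" "b = (d * s - c * e) / s\<^sup>2"
      by auto
    have "- b = (- d * s - - c * e) / s\<^sup>2"
      by (simp add: *(5) minus_divide_left)
    then show ?thesis
      using I[OF D(3)[OF *(1)] *(2,3)] *(4) by (simp only: minus_divide_left)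
  qed
  fix a b a' b' assume "(a, b) \<in> ?H" "(a', b') \<in> ?H"
  then obtain c d s e c' d' s' e' where *: "(c, d) \<in> G" "(s, e) \<in> G" "s \<noteq> 0" "a = c / s" "b = (d * s - c * e) / s\<^sup>2"
    and **: "(c', d') \<in> G" "(s', e') \<in> G" "s' \<noteq> 0" "a' = c' / s'" "b' = (d' * s' - c' * e') / s'\<^sup>2"
    by auto
  have ss: "(s * s', s * e' + e * s') \<in> G" "s * s' \<noteq> 0"
    using D(4) * ** by auto
  have "(c * s' + c' * s, (c * e' + d * s') + (c' * e + d' * s)) \<in> G"
    by (intro D(2) D(4) *(1,2) **(1,2))
  from I[OF this ss]
  have "((c * s' + c' * s) / (s * s'), (((c * e' + d * s') + (c' * e + d' * s)) * (s * s') - (c * s' + c' * s) * (s * e' + e * s')) / (s * s')\<^sup>2) \<in> ?H" .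
  moreover have "(c * s' + c' * s) / (s * s') = a + a'"
    using * ** by (simp add: field_simps)
  moreover have "(((c * e' + d * s') + (c' * e + d' * s)) * (s * s') - (c * s' + c' * s) * (s * e' + e * s')) / (s * s')\<^sup>2 = b + b'"
  proof -
    have "((c * e' + d * s') + (c' * e + d' * s)) * (s * s') - (c * s' + c' * s) * (s * e' + e * s')
        = (d * s - c * e) * s'\<^sup>2 + (d' * s' - c' * e') * s\<^sup>2"
      by (simp add: algebra_simps power2_eq_square)
    then show ?thesis
      using *(3) **(3) unfolding *(5) **(5) by (simp only: add_divide_distrib power_mult_distrib) simp
  qed
  ultimately show "(a + a', b + b') \<in> ?H" by simp
  have "(c * c', c * d' + d * c') \<in> G"
    by (intro D(4) *(1) **(1))
  from I[OF this ss]
  have "((c * c') / (s * s'), ((c * d' + d * c') * (s * s') - (c * c') * (s * e' + e * s')) / (s * s')\<^sup>2) \<in> ?H" .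
  moreover have "(c * c') / (s * s') = a * a'"
    using * ** by simp
  moreover have "((c * d' + d * c') * (s * s') - (c * c') * (s * e' + e * s')) / (s * s')\<^sup>2 = a * b' + b * a'"
  proof -
    have "(c * d' + d * c') * (s * s') - (c * c') * (s * e' + e * s')
        = c * (d' * s' - c' * e') * s + (d * s - c * e) * c' * s'"
      by (simp add: algebra_simps)
    moreover have "(c * y * s + x * c' * s') / (s * s')\<^sup>2 = c / s * (y / s'\<^sup>2) + x / s\<^sup>2 * (c' / s')" for x y
      using *(3) **(3) by (simp add: add_divide_distrib power_mult_distrib) (simp add: power2_eq_square)
    ultimately show ?thesis
      unfolding *(4,5) **(4,5) by simp
  qed
  ultimately show "(a * a', a * b' + b * a') \<in> ?H" by simp
qed

text \<open>Extension to the ring generated by \<open>t\<close>, where \<open>w\<close> becomes the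
  derivative of \<open>t\<close>. Here \<open>q\<close> is \<open>p\<close> with the derivation
  applied to its coefficients, and hypothesis \<open>c\<close> says that each relation satisfied by
  \<open>t\<close> stays true when differentiated.\<close>

lemma der_graph_adjoin:
  fixes t w :: "'f::field_char_0"
  assumes G: "der_graph G"
    and c: "\<And>p q. (\<And>i. (coeff p i, coeff q i) \<in> G) \<Longrightarrow> poly p t = 0 \<Longrightarrow> poly q t + w * poly (pderiv p) t = 0"
  shows "der_graph {(poly p t, poly q t + w * poly (pderiv p) t) | p q. \<forall>i. (coeff p i, coeff q i) \<in> G}" (is "der_graph ?H")
  unfolding der_graph_def
proof (intro conjI allI impI)
  note D = der_graphD[OF G]
  have I: "(poly p t, poly q t + w * poly (pderiv p) t) \<in> ?H" if "\<And>i. (coeff p i, coeff q i) \<in> G" for p q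
    using that by blast
  have "(coeff [:1:] i, coeff 0 i) \<in> G" for i
    using D(1) der_graph_0[OF G] by (cases i) auto
  from I[OF this] show "(1, 0) \<in> ?H" by (simp add: pderiv_pCons)
  show "b = 0" if "(0, b) \<in> ?H" for b
  proof -
    from that obtain p q where "\<And>i. (coeff p i, coeff q i) \<in> G" "0 = poly p t" "b = poly q t + w * poly (pderiv p) t"
      by auto
    then show ?thesis using c[of p q] by simp
  qed
  show "(- a, - b) \<in> ?H" if "(a, b) \<in> ?H" for a b
  proof -
    from that obtain p q where *: "\<And>i. (coeff p i, coeff q i) \<in> G" "a = poly p t" "b = poly q t + w * poly (pderiv p) t"
      by auto
    then show ?thesis
      using I[of "- p" "- q"] D(3) by (simp add: pderiv_minus)
  qed
  fix a b a' b' assume "(a, b) \<in> ?H" "(a', b') \<in> ?H"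
  then obtain p q p' q' where *: "\<And>i. (coeff p i, coeff q i) \<in> G" "a = poly p t" "b = poly q t + w * poly (pderiv p) t"
    and **: "\<And>i. (coeff p' i, coeff q' i) \<in> G" "a' = poly p' t" "b' = poly q' t + w * poly (pderiv p') t"
    by auto
  show "(a + a', b + b') \<in> ?H"
    using I[of "p + p'" "q + q'"] D(2) * ** by (simp add: pderiv_add algebra_simps)
  have "(coeff (p * p') i, coeff (p * q' + q * p') i) \<in> G" for i
    unfolding coeff_mult coeff_add sum.distrib[symmetric]
    by (rule der_graph_sum[OF G]) (use D(4) * ** in blast)
  from I[OF this] show "(a * a', a * b' + b * a') \<in> ?H"
    using * ** by (simp add: pderiv_mult algebra_simps)
qed

text \<open>When the domain is a field, a consistent derivative of \<open>t\<close> exists: for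
  transcendental \<open>t\<close> any value works, and for algebraic \<open>t\<close> the minimal
  polynomial \<open>m\<close> dictates it, because its derivative does not vanish at
  \<open>t\<close> in characteristic zero.\<close>

lemma der_graph_step:
  fixes t :: "'f::field_char_0"
  assumes G: "der_graph G" and fld: "\<forall>a b. (a, b) \<in> G \<longrightarrow> a \<noteq> 0 \<longrightarrow> (\<exists>b'. (1 / a, b') \<in> G)"
  shows "\<exists>w. \<forall>p q. (\<forall>i. (coeff p i, coeff q i) \<in> G) \<longrightarrow> poly p t = 0 \<longrightarrow> poly q t + w * poly (pderiv p) t = 0"
proof -
  note D = der_graphD[OF G]
  define R where "R = {(p, q). (\<forall>i. (coeff p i, coeff q i) \<in> G) \<and> poly p t = 0}"
  show ?thesis
  proof (cases "\<exists>p q. (p, q) \<in> R \<and> p \<noteq> 0")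
    \<comment> \<open>\<open>t\<close> is transcendental over the domain, and \<open>w = 0\<close>
      is taken.\<close>
    case False
    have "q = 0" if "\<forall>i. (coeff p i, coeff q i) \<in> G" "p = 0" for p q
      using that D(5) by (auto intro: poly_eqI)
    then have "poly q t + 0 * poly (pderiv p) t = 0" if "\<forall>i. (coeff p i, coeff q i) \<in> G" "poly p t = 0" for p q
    proof -
      have "p = 0" using False that by (auto simp: R_def)
      then show ?thesis using \<open>\<And>p q. \<lbrakk>\<forall>i. (coeff p i, coeff q i) \<in> G; p = 0\<rbrakk> \<Longrightarrow> q = 0\<close>[of p q] that by simp
    qed
    then show ?thesis by blast
  next
    case True
    define P where "P = (\<lambda>n. \<exists>p q. (p, q) \<in> R \<and> p \<noteq> 0 \<and> degree p = n)"
    have "\<exists>n. P n" using True by (auto simp: P_def)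
    then have "P (LEAST n. P n)" by (metis LeastI_ex)
    then obtain m mq where m: "(m, mq) \<in> R" "m \<noteq> 0" "degree m = (LEAST n. P n)"
      by (auto simp: P_def)
    have min: "p = 0" if "(p, q) \<in> R" "degree p < degree m" for p q
      using not_less_Least[of "degree p" P] that m by (auto simp: P_def)
    have mG: "(coeff m i, coeff mq i) \<in> G" for i
      using m by (auto simp: R_def)
    have mt: "poly m t = 0"
      using m by (auto simp: R_def)
    have dm: "degree m \<noteq> 0"
      using m mt by (metis degree_eq_zeroE mult_zero_right pCons_0_0 poly_0 poly_pCons add_0_right)
    \<comment> \<open>The value forced by differentiating the relation \<open>poly m t = 0\<close>;
      \<open>mq\<close> is \<open>m\<close> with differentiated coefficients.\<close>
    define w where "w = - poly mq t / poly (pderiv m) t"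
    have nz: "poly (pderiv m) t \<noteq> 0"
    proof
      assume "poly (pderiv m) t = 0"
      moreover have "(coeff (pderiv m) i, coeff (pderiv mq) i) \<in> G" for i
        using D(4)[OF der_graph_of_nat[OF G, of "Suc i"] mG[of "Suc i"]] by (simp add: coeff_pderiv)
      ultimately have "(pderiv m, pderiv mq) \<in> R"
        by (simp add: R_def)
      then have "pderiv m = 0"
        using dm by (intro min) (auto simp: degree_pderiv)
      then show False
        using dm by (simp add: pderiv_eq_0_iff)
    qed
    define V where "V = (\<lambda>p q. poly q t + w * poly (pderiv p) t)"
    have V0: "V m mq = 0"
      using nz by (simp add: V_def w_def)
    have "V p q = 0" if "(p, q) \<in> R" for p q
      using that
    proof (induct "degree p" arbitrary: p q rule: less_induct)
      case less
      show ?case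
      proof (cases "degree p < degree m")
        case True
        then have "p = 0" using min less by blast
        moreover have "q = 0"
          using less.prems D(5) \<open>p = 0\<close> by (auto simp: R_def intro: poly_eqI)
        ultimately show ?thesis by (simp add: V_def)
      next
        case False
        \<comment> \<open>Division by \<open>m\<close>: subtracting
          \<open>monom \<alpha> d * m\<close>, together with its derivative, leaves \<open>V\<close>
          unchanged and lowers the degree. The derivative \<open>\<beta>\<close> of the quotient of
          the leading coefficients exists by \<open>fld\<close>.\<close>
        define d where "d = degree p - degree m"
        obtain b' where "(1 / lead_coeff m, b') \<in> G"
          using fld[rule_format, OF mG[of "degree m"]] m(2) by auto
        moreover have "(lead_coeff p, coeff q (degree p)) \<in> G"
          using less.prems by (auto simp: R_def)
        ultimately obtain \<beta> where ab: "(lead_coeff p / lead_coeff m, \<beta>) \<in> G"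
          using D(4) by fastforce
        define \<alpha> where "\<alpha> = lead_coeff p / lead_coeff m"
        define p' where "p' = p - monom \<alpha> d * m"
        define q' where "q' = q - (monom \<alpha> d * mq + monom \<beta> d * m)"
        have mo: "coeff (monom a d * r) i = (if d \<le> i then a * coeff r (i - d) else 0)" for a r i
          by (simp add: coeff_monom_mult)
        have "(coeff p' i, coeff q' i) \<in> G" for i
          unfolding p'_def q'_def coeff_diff coeff_add mo
          by (rule der_graph_diff[OF G]) 
            (use less.prems D(4)[OF ab mG] der_graph_0[OF G] in \<open>auto simp: R_def \<alpha>_def\<close>)
        moreover have "poly p' t = 0"
          using less.prems mt by (auto simp: R_def p'_def)
        ultimately have pR: "(p', q') \<in> R"
          by (simp add: R_def)
        have Vp: "V p q = V p' q'"
        proof -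
          have "poly mq t = - (w * poly (pderiv m) t)"
            using V0 by (simp add: V_def eq_neg_iff_add_eq_0)
          then show ?thesis
            using mt by (simp add: V_def p'_def q'_def pderiv_diff pderiv_mult algebra_simps)
        qed
        show ?thesis
        proof (cases "degree p' < degree p")
          case True
          then show ?thesis using less.hyps pR Vp by simp
        next
          case F: False
          have "degree (monom \<alpha> d * m) \<le> degree p"
            using degree_mult_le[of "monom \<alpha> d" m] degree_monom_le[of \<alpha> d] False by (simp add: d_def)
          then have "degree p' \<le> degree p"
            unfolding p'_def by (simp add: degree_diff_le)
          moreover have "coeff p' (degree p) = 0"
            unfolding p'_def coeff_diff mo using False m(2) by (simp add: d_def \<alpha>_def)
          ultimately have "degree p = 0 \<and> p' = 0"
            using F by (metis leading_coeff_0_iff le_antisym not_less degree_0)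
          then show ?thesis
            using False dm by simp
        qed
      qed
    qed
    then show ?thesis
      unfolding V_def R_def by blast
  qed
qed

text \<open>A maximal extension of the graph, as a subring of the dual numbers, is defined on the whole field.\<close>

lemma der_graph_extend:
  fixes G0 :: "('f::field_char_0 \<times> 'f) set"
  assumes G0: "der_graph G0"
  shows "\<exists>D. is_der D \<and> (\<forall>(a, b)\<in>G0. D a = b)"
proof -
  let ?A = "{G. der_graph G \<and> G0 \<subseteq> G}"
  have "\<exists>M\<in>?A. \<forall>X\<in>?A. M \<subseteq> X \<longrightarrow> X = M"
  proof (rule subset_Zorn_nonempty)
    show "?A \<noteq> {}" using G0 by auto
    fix C assume C: "C \<noteq> {}" "subset.chain ?A C"
    have mem: "der_graph G" "G0 \<subseteq> G" if "G \<in> C" for G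
      using C that by (auto simp: subset.chain_def)
    have two: "\<exists>G\<in>C. x \<in> G \<and> y \<in> G" if "x \<in> \<Union>C" "y \<in> \<Union>C" for x y
    proof -
      from that obtain G H where "G \<in> C" "H \<in> C" "x \<in> G" "y \<in> H" by auto
      moreover have "G \<subseteq> H \<or> H \<subseteq> G"
        using C \<open>G \<in> C\<close> \<open>H \<in> C\<close> unfolding subset.chain_def by blast
      ultimately show ?thesis by blast
    qed
    have "der_graph (\<Union>C)"
      unfolding der_graph_def
    proof (intro conjI allI impI)
      show "(1, 0) \<in> \<Union>C" using C mem der_graphD(1) by blast
      show "(- a, - b) \<in> \<Union>C" if "(a, b) \<in> \<Union>C" for a b
        using that mem der_graphD(3) by blast
      show "b = 0" if "(0, b) \<in> \<Union>C" for b
        using that mem der_graphD(5) by blast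
      fix a b c d assume "(a, b) \<in> \<Union>C" "(c, d) \<in> \<Union>C"
      then obtain G where G: "G \<in> C" "(a, b) \<in> G" "(c, d) \<in> G"
        using two by blast
      show "(a + c, b + d) \<in> \<Union>C" "(a * c, a * d + b * c) \<in> \<Union>C"
        using G der_graphD(2,4)[OF mem(1)[OF G(1)] G(2,3)] by blast+
    qed
    then show "\<Union>C \<in> ?A"
      using C mem by auto
  qed
  then obtain G where G': "G \<in> ?A" "\<forall>X\<in>?A. G \<subseteq> X \<longrightarrow> X = G"
    by (elim bexE)
  then have G: "der_graph G" "G0 \<subseteq> G"
    by auto
  have max: "H = G" if "der_graph H" "G \<subseteq> H" for H
    using G' G that by auto
  \<comment> \<open>The extension by the quotient rule cannot be larger than a maximal graph, so the
    domain of \<open>G\<close> is a field.\<close>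
  have fld: "\<exists>b'. (1 / a, b') \<in> G" if "(a, b) \<in> G" "a \<noteq> 0" for a b
  proof -
    let ?H = "{(c / s, (d * s - c * e) / s\<^sup>2) | c d s e. (c, d) \<in> G \<and> (s, e) \<in> G \<and> s \<noteq> 0}"
    have "G \<subseteq> ?H"
    proof
      fix x assume x: "x \<in> G"
      obtain a b where ab: "x = (a, b)" by (cases x)
      have "(a / 1, (b * 1 - a * 0) / 1\<^sup>2) \<in> ?H"
        using x der_graphD(1)[OF G(1)] unfolding ab
        by (intro CollectI exI[of _ a] exI[of _ b] exI[of _ 1] exI[of _ 0]) simp
      then show "x \<in> ?H" by (simp add: ab)
    qed
    then have "?H = G" using max der_graph_inverse[OF G(1)] by blast
    moreover have "(1 / a, (0 * a - 1 * b) / a\<^sup>2) \<in> ?H"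
      using that der_graphD(1)[OF G(1)] by blast
    ultimately show ?thesis by blast
  qed
  have surj: "\<exists>b. (t, b) \<in> G" for t
  proof -
    obtain w where w: "\<And>p q. (\<And>i. (coeff p i, coeff q i) \<in> G) \<Longrightarrow> poly p t = 0 \<Longrightarrow> poly q t + w * poly (pderiv p) t = 0"
      using der_graph_step[OF G(1), of t] fld by blast
    let ?H = "{(poly p t, poly q t + w * poly (pderiv p) t) | p q. \<forall>i. (coeff p i, coeff q i) \<in> G}"
    have "G \<subseteq> ?H"
    proof
      fix x assume "x \<in> G"
      then have "\<forall>i. (coeff [:fst x:] i, coeff [:snd x:] i) \<in> G"
        using der_graph_0[OF G(1)] by (auto simp: coeff_pCons split: nat.split)
      then have "(poly [:fst x:] t, poly [:snd x:] t + w * poly (pderiv [:fst x:]) t) \<in> ?H"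
        by blast
      then show "x \<in> ?H" by (simp add: pderiv_pCons)
    qed
    then have "?H = G" using max der_graph_adjoin[OF G(1) w] by blast
    moreover have "\<forall>i. (coeff [:0, 1:] i, coeff 0 i) \<in> G"
      using der_graph_0[OF G(1)] der_graphD(1)[OF G(1)] by (auto simp: coeff_pCons split: nat.split)
    then have "(poly [:0, 1:] t, poly 0 t + w * poly (pderiv [:0, 1:]) t) \<in> ?H" by blast
    ultimately have "(poly [:0, 1:] t, poly 0 t + w * poly (pderiv [:0, 1:]) t) \<in> G" by simp
    then show ?thesis by auto
  qed
  define D where "D = (\<lambda>t. SOME b. (t, b) \<in> G)"
  have D: "(t, D t) \<in> G" for t
    unfolding D_def using someI_ex[OF surj] .
  have Deq: "D a = b" if "(a, b) \<in> G" for a b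
    using der_graphD(5)[OF G(1), of "D a - b"] der_graph_diff[OF G(1) D[of a] that] by simp
  have "is_der D"
    unfolding is_der_def using Deq D der_graphD(2,4)[OF G(1)] by blast
  moreover have "\<forall>(a, b)\<in>G0. D a = b"
    using G Deq by auto
  ultimately show ?thesis by blast
qed

text \<open>By independence a value determines its polynomial, so the partial derivative with
  respect to \<open>j\<close> is well defined on the ring generated by the values; it then extends
  to the field. This is the source of the field derivations used below.\<close>

lemma indep_dual_derivation:
  assumes "indep S x" "j \<in> S"
  shows "\<exists>D. is_der D \<and> (\<forall>i\<in>S. D (x i) = (if i = j then 1 else 0))"
proof -
  let ?G = "{(peval of_rat x p, peval of_rat x (pdiff j p)) | p. p \<in> poly_over S}"
  note [simp] = peval_cst[OF rhom_of_rat] peval_add[OF rhom_of_rat] peval_mult[OF rhom_of_rat] peval_var[OF rhom_of_rat]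
    rhom_uminus[OF rhom_peval[OF rhom_of_rat]]
  have I: "(peval of_rat x p, peval of_rat x (pdiff j p)) \<in> ?G" if "p \<in> poly_over S" for p
    using that by blast
  have "der_graph ?G"
    unfolding der_graph_def
  proof (intro conjI allI impI)
    show "(1, 0) \<in> ?G"
      using I[of 1] peval_cst[OF rhom_of_rat, of x 1] by simp
    show "b = 0" if "(0, b) \<in> ?G" for b
    proof -
      from that obtain p where "p \<in> poly_over S" "peval of_rat x p = 0" "b = peval of_rat x (pdiff j p)"
        by (smt (verit) Pair_inject mem_Collect_eq)
      then show ?thesis using indepD[OF assms(1), of p] by simp
    qed
    show "(- a, - b) \<in> ?G" if "(a, b) \<in> ?G" for a b
    proof -
      have "pdiff j (- p) = - pdiff j p" for p :: "'a qpoly"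
        using pdiff_add[of j p "- p"] by (simp add: add_eq_0_iff)
      then show ?thesis
        using that I[OF poly_over_uminus] by fastforce
    qed
    fix a b c d assume "(a, b) \<in> ?G" "(c, d) \<in> ?G"
    then obtain p q where pq: "p \<in> poly_over S" "q \<in> poly_over S"
      "a = peval of_rat x p" "b = peval of_rat x (pdiff j p)" "c = peval of_rat x q" "d = peval of_rat x (pdiff j q)"
      by blast
    show "(a + c, b + d) \<in> ?G"
      using I[OF poly_over_add[OF pq(1,2)]] pq by (simp add: pdiff_add)
    show "(a * c, a * d + b * c) \<in> ?G"
      using I[OF poly_over_mult[OF pq(1,2)]] pq by (simp add: pdiff_mult add.commute)
  qed
  then obtain D where D: "is_der D" "\<forall>(a, b)\<in>?G. D a = b"
    using der_graph_extend by blast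
  have "D (x i) = (if i = j then 1 else 0)" if "i \<in> S" for i
    using D(2) I[of "var i"] that peval_cst[OF rhom_of_rat, of x 1]
    by (auto simp: poly_over_var pdiff_var)
  then show ?thesis using D by blast
qed

text \<open>Converse to the existence of dual derivations: if a variable of \<open>T\<close> occurs
  in a relation, its derivation produces a nonzero relation of smaller degree. By induction only
  variables of \<open>S\<close> can occur.\<close>

lemma indep_extend:
  fixes x :: "'x \<Rightarrow> 'f::field_char_0"
  assumes S: "indep S x"
    and D: "\<And>j. j \<in> T \<Longrightarrow> \<exists>D. is_der D \<and> D (x j) \<noteq> 0 \<and> (\<forall>i\<in>S \<union> T. i \<noteq> j \<longrightarrow> D (x i) = 0)"
  shows "indep (S \<union> T) x"
  unfolding indep_def
proof (intro ballI impI)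
  fix p assume "p \<in> poly_over (S \<union> T)" "peval of_rat x p = 0"
  then show "p = 0"
  proof (induct "tdeg p" arbitrary: p rule: less_induct)
    case less
    have "vars p \<inter> T = {}"
    proof (rule ccontr)
      assume "vars p \<inter> T \<noteq> {}"
      then obtain j where j: "j \<in> vars p" "j \<in> T" by auto
      obtain D where D: "is_der D" "D (x j) \<noteq> 0" "\<forall>i\<in>S \<union> T. i \<noteq> j \<longrightarrow> D (x i) = 0"
        using assms(2)[OF j(2)] by blast
      have "D (peval of_rat x p) = peval of_rat x (pdiff j p) * D (x j)"
        by (rule der_peval_1) (use D less.prems in \<open>auto simp: poly_over_def\<close>)
      then have "peval of_rat x (pdiff j p) = 0"
        using less.prems D der_0 by fastforce
      moreover have "pdiff j p \<noteq> 0"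
        using j by (simp add: pdiff_eq_0_iff)
      moreover have "tdeg (pdiff j p) < tdeg p"
        using tdeg_pdiff[of j p] \<open>pdiff j p \<noteq> 0\<close> by simp
      ultimately show False
        using less.hyps[of "pdiff j p"] pdiff_poly_over[OF less.prems(1)] by simp
    qed
    then have "p \<in> poly_over S"
      using less.prems by (auto simp: poly_over_def)
    then show ?case
      using S less.prems indepD by blast
  qed
qed

section \<open>A field with countably many independent elements\<close>

instance fract :: ("{idom, ring_char_0}") field_char_0
proof
  have "of_nat n = Fract (of_nat n) (1::'a)" for n
    by (induct n) (simp_all add: Zero_fract_def One_fract_def)
  then show "inj (of_nat :: nat \<Rightarrow> 'a fract)"
    by (auto intro!: injI simp: eq_fract)
qed

type_synonym gfield = "nat qpoly fract"

text \<open>The variables are independent in their rational function field, and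
  \<open>to_nat\<close> names the elements of a countable type by distinct variables.\<close>

lemma gfield_generic:
  "\<exists>g :: 'x::countable \<Rightarrow> gfield. indep UNIV g"
proof
  let ?F = "\<lambda>p::nat qpoly. Fract p 1"
  have hF: "rhom ?F"
    by (rule rhomI) (simp_all add: One_fract_def)
  have rat: "of_rat c = ?F (cst c)" for c
  proof -
    obtain a b where r: "c = of_int a / of_int b" "b \<noteq> 0"
      by (cases c) (auto simp: Fract_of_int_quotient)
    have int: "of_int k = ?F (cst (of_int k))" for k
    proof -
      have nat: "of_nat n = ?F (cst (of_nat n))" for n
        by (induct n) (simp_all add: rhom_0[OF hF] rhom_1[OF hF] rhom_add[OF hF] cst_add)
      show ?thesis
        by (cases k rule: int_cases2) (simp_all add: nat rhom_uminus[OF hF, symmetric] rhom_uminus[OF rhom_cst, symmetric])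
    qed
    have "of_rat c * of_int b = (of_int a :: gfield)"
      using r by (simp add: of_rat_divide)
    also have "\<dots> = ?F (cst c) * of_int b"
      using r by (simp add: int rhom_mult[OF hF, symmetric] rhom_mult[OF rhom_cst, symmetric])
    finally show ?thesis using r by simp
  qed
  show "indep UNIV (\<lambda>x::'x. ?F (var (to_nat x)))"
    unfolding indep_def
  proof (intro ballI impI)
    fix p :: "'x qpoly"
    assume 0: "peval of_rat (\<lambda>x. ?F (var (to_nat x))) p = 0"
    define p' where "p' = peval cst (\<lambda>x. var (to_nat x)) p"
    have "(\<lambda>c. ?F (cst c)) = of_rat"
      by (simp add: rat fun_eq_iff)
    then have "?F p' = 0"
      unfolding p'_def peval_hom[OF hF] using 0 by simp
    then have "p' = 0" by (simp add: Zero_fract_def eq_fract)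
    moreover have "peval cst (\<lambda>n. var (from_nat n)) p' = p"
      unfolding p'_def peval_hom[OF rhom_peval[OF rhom_cst]]
      by (simp add: peval_cst[OF rhom_cst] peval_var[OF rhom_cst] peval_id)
    ultimately show "p = 0" by simp
  qed
qed

section \<open>Irreducible polynomials are prime\<close>

text \<open>Evaluation at independent values embeds the polynomials into a field.\<close>

lemma qpoly_no_zero_divisors:
  fixes p q :: "'x::countable qpoly"
  assumes "p * q = 0"
  shows "p = 0 \<or> q = 0"
proof -
  obtain g :: "'x \<Rightarrow> gfield" where g: "indep UNIV g"
    using gfield_generic by blast
  have "peval of_rat g p * peval of_rat g q = 0"
    using assms by (simp flip: peval_mult[OF rhom_of_rat])
  then show ?thesis
    using g by (auto simp: indep_def poly_over_def)
qed

lemma qpoly_mult_left_cancel: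
  fixes p q r :: "'x::countable qpoly"
  assumes "p * q = p * r" "p \<noteq> 0"
  shows "q = r"
  using qpoly_no_zero_divisors[of p "q - r"] assms by (simp add: algebra_simps)

section \<open>Coefficients and degree with respect to one variable\<close>

lemma lookup_pcoeff: "lookup (pcoeff x d p) m = (if lookup m x = 0 then lookup p (m + single x d) else 0)"
proof -
  have "lookup (pcoeff x d p) m = (\<Sum>n\<in>{n\<in>keys p. lookup n x = d}. if n - single x d = m then lookup p n else 0)"
    by (simp add: pcoeff_def lookup_sum lookup_single when_def)
  also have "\<dots> = (\<Sum>n\<in>{n\<in>keys p. lookup n x = d}. if n = m + single x d \<and> lookup m x = 0 then lookup p n else 0)"
  proof (rule sum.cong[OF refl])
    fix n assume n: "n \<in> {n\<in>keys p. lookup n x = d}"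
    have 1: "n = n - single x d + single x d"
      by (rule poly_mapping_eqI) (use n in \<open>auto simp: lookup_add lookup_minus lookup_single when_def\<close>)
    have "n - single x d = m \<longleftrightarrow> n = m + single x d \<and> lookup m x = 0"
    proof
      assume "n - single x d = m"
      then show "n = m + single x d \<and> lookup m x = 0"
        using 1 n by (metis (mono_tags, lifting) diff_self_eq_0 lookup_minus lookup_single_eq mem_Collect_eq)
    next
      assume "n = m + single x d \<and> lookup m x = 0"
      then show "n - single x d = m" by simp
    qed
    then show "(if n - single x d = m then lookup p n else 0) = (if n = m + single x d \<and> lookup m x = 0 then lookup p n else 0)"
      by simp
  qed
  also have "\<dots> = (if lookup m x = 0 then lookup p (m + single x d) else 0)"
    by (auto simp: lookup_add in_keys_iff)
  finally show ?thesis .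
qed

lemma vars_pcoeff: "vars (pcoeff x d p) \<subseteq> vars p - {x}"
proof
  fix y assume "y \<in> vars (pcoeff x d p)"
  then obtain m where "m \<in> keys (pcoeff x d p)" "y \<in> keys m"
    by (auto simp: vars_def)
  then have "m + single x d \<in> keys p" "y \<in> keys (m + single x d)" "lookup m x = 0" "lookup m y \<noteq> 0"
    by (auto simp: in_keys_iff lookup_pcoeff lookup_add split: if_splits)
  then show "y \<in> vars p - {x}"
    by (auto simp: vars_def)
qed

lemma pcoeff_add: "pcoeff x d (p + q) = pcoeff x d p + pcoeff x d q"
  by (rule poly_mapping_eqI) (simp add: lookup_pcoeff lookup_add)

lemma pcoeff_gt_pdeg: "pdeg x p < d \<Longrightarrow> pcoeff x d p = 0"
proof (rule poly_mapping_eqI)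
  fix m :: "'a \<Rightarrow>\<^sub>0 nat"
  assume d: "pdeg x p < d"
  have "lookup n x \<le> pdeg x p" if "n \<in> keys p" for n
    unfolding pdeg_def using that by (intro Max_ge) auto
  then have "m + single x d \<notin> keys p"
    using d by (fastforce simp: lookup_add)
  then show "lookup (pcoeff x d p) m = lookup 0 m"
    by (simp add: lookup_pcoeff in_keys_iff)
qed

lemma pcoeff_pdeg_neq_0:
  assumes "p \<noteq> 0"
  shows "pcoeff x (pdeg x p) p \<noteq> 0"
proof -
  have "pdeg x p \<in> insert 0 ((\<lambda>m. lookup m x) ` keys p)"
    unfolding pdeg_def by (intro Max_in) auto
  moreover have "keys p \<noteq> {}" using assms by simp
  moreover have "lookup n x \<le> pdeg x p" if "n \<in> keys p" for n
    unfolding pdeg_def using that by (intro Max_ge) auto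
  ultimately obtain n where n: "n \<in> keys p" "lookup n x = pdeg x p"
    by fastforce
  have "n = n - single x (pdeg x p) + single x (pdeg x p)"
    by (rule poly_mapping_eqI) (use n in \<open>auto simp: lookup_add lookup_minus lookup_single when_def\<close>)
  then have "lookup (pcoeff x (pdeg x p) p) (n - single x (pdeg x p)) \<noteq> 0"
    using n by (simp add: lookup_pcoeff lookup_minus in_keys_iff)
  then show ?thesis by auto
qed

lemma pdeg_0 [simp]: "pdeg x 0 = 0"
  by (simp add: pdeg_def)

lemma pdeg_eq_0_iff: "pdeg x p = 0 \<longleftrightarrow> x \<notin> vars p"
proof
  assume 0: "pdeg x p = 0"
  have "lookup n x \<le> pdeg x p" if "n \<in> keys p" for n
    unfolding pdeg_def using that by (intro Max_ge) auto
  then show "x \<notin> vars p"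
    using 0 by (auto simp: vars_def in_keys_iff)
next
  assume "x \<notin> vars p"
  then have "insert 0 ((\<lambda>m. lookup m x) ` keys p) = {0}"
    by (auto simp: vars_def in_keys_iff)
  then show "pdeg x p = 0"
    unfolding pdeg_def by (simp only:) simp
qed

text \<open>\<open>p\<close> as a univariate polynomial in \<open>x\<close>. The coefficients stay
  in the same type although they are free of \<open>x\<close>; products and degrees of
  \<open>pcoeff\<close> are then read off from univariate polynomials.\<close>

definition vpoly :: "'x \<Rightarrow> 'x qpoly \<Rightarrow> 'x qpoly poly"
  where "vpoly x p = peval (\<lambda>c. [:cst c:]) (\<lambda>z. if z = x then [:0, 1:] else [:var z:]) p"

lemma rhom_cst_poly: "rhom (\<lambda>c. [:cst c :: 'x qpoly:])"
  by (rule rhom_comp[OF rhom_const_poly rhom_cst])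

lemma coeff_vpoly: "coeff (vpoly x p) d = pcoeff x d p"
proof -
  note [simp] = peval_cst[OF rhom_cst_poly] peval_add[OF rhom_cst_poly] peval_mult[OF rhom_cst_poly] peval_var[OF rhom_cst_poly]
  have "p \<in> poly_over UNIV" by (simp add: poly_over_def)
  then show ?thesis
  proof (induct p arbitrary: d rule: qpoly_induct)
    case (cst c)
    have "pcoeff x d (cst c) = (if d = 0 then cst c else 0)"
    proof (rule poly_mapping_eqI)
      fix m :: "'a \<Rightarrow>\<^sub>0 nat"
      have "m + single x d \<noteq> 0" if "d \<noteq> 0"
      proof
        assume "m + single x d = 0"
        then have "lookup (m + single x d) x = 0" by simp
        then show False using that by (simp add: lookup_add)
      qed
      then show "lookup (pcoeff x d (cst c)) m = lookup (if d = 0 then cst c else 0) m"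
        by (auto simp: lookup_pcoeff cst_def lookup_single when_def)
    qed
    then show ?case
      by (auto simp: vpoly_def coeff_pCons split: nat.split)
  next
    case (add p q)
    then show ?case by (simp add: vpoly_def pcoeff_add)
  next
    case (mult_var p y)
    show ?case
    proof (cases "y = x")
      case True
      have "pcoeff x d (p * var x) = (case d of 0 \<Rightarrow> 0 | Suc k \<Rightarrow> pcoeff x k p)"
      proof (rule poly_mapping_eqI)
        fix m
        show "lookup (pcoeff x d (p * var x)) m = lookup (case d of 0 \<Rightarrow> 0 | Suc k \<Rightarrow> pcoeff x k p) m"
        proof (cases d)
          case 0
          then show ?thesis by (simp add: lookup_pcoeff lookup_mult_var_0)
        next
          case (Suc k)
          have "m + single x d = (m + single x k) + single x 1"
            by (simp add: Suc add.assoc flip: single_add)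
          then show ?thesis
            by (simp add: Suc lookup_pcoeff lookup_mult_var del: One_nat_def)
        qed
      qed
      then show ?thesis
        using mult_var True by (cases d) (simp_all add: vpoly_def)
    next
      case False
      have "pcoeff x d (p * var y) = pcoeff x d p * var y"
      proof (rule poly_mapping_eqI)
        fix m
        show "lookup (pcoeff x d (p * var y)) m = lookup (pcoeff x d p * var y) m"
        proof (cases "lookup m y = 0")
          case True
          then show ?thesis
            using False by (simp add: lookup_pcoeff lookup_mult_var_0 lookup_add lookup_single)
        next
          case nz: False
          define n where "n = m - single y 1"
          have m: "m = n + single y 1"
            by (rule poly_mapping_eqI) (use nz in \<open>auto simp: n_def lookup_add lookup_minus lookup_single when_def\<close>)
          have "n + single y 1 + single x d = (n + single x d) + single y 1"
            by (simp add: add_ac)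
          then show ?thesis
            using False by (simp add: m lookup_pcoeff lookup_mult_var lookup_add lookup_single del: One_nat_def)
        qed
      qed
      then show ?thesis
        using mult_var False by (simp add: vpoly_def mult.commute)
    qed
  qed
qed

lemma vpoly_mult: "vpoly x (p * q) = vpoly x p * vpoly x q"
  by (simp add: vpoly_def peval_mult[OF rhom_cst_poly])

lemma pcoeff_mult: "pcoeff x n (p * q) = (\<Sum>i\<le>n. pcoeff x i p * pcoeff x (n - i) q)"
  by (simp add: coeff_mult vpoly_mult flip: coeff_vpoly)

lemma poly_vpoly: "poly (vpoly x p) (var x) = p"
proof -
  have "poly (vpoly x p) (var x) = peval cst var p"
    unfolding vpoly_def peval_hom[OF rhom_poly] by (auto intro!: arg_cong2[where f = "\<lambda>a b. peval a b p"])
  then show ?thesis by (simp add: peval_id)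
qed

lemma degree_vpoly: "degree (vpoly x p) = pdeg x p"
proof (cases "p = 0")
  case True
  then show ?thesis by (simp add: vpoly_def)
next
  case False
  show ?thesis
  proof (rule antisym)
    show "degree (vpoly x p) \<le> pdeg x p"
      by (rule degree_le) (simp add: coeff_vpoly pcoeff_gt_pdeg)
    show "pdeg x p \<le> degree (vpoly x p)"
      by (rule le_degree) (simp add: coeff_vpoly pcoeff_pdeg_neq_0 False)
  qed
qed

lemma sum_pcoeff: "p = (\<Sum>d\<le>pdeg x p. pcoeff x d p * var x ^ d)"
  using poly_vpoly[of x p] by (simp add: poly_altdef degree_vpoly coeff_vpoly)

lemma pcoeff_free: "x \<notin> vars p \<Longrightarrow> pcoeff x d p = (if d = 0 then p else 0)"
proof -
  assume "x \<notin> vars p"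
  then have "pdeg x p = 0" by (simp add: pdeg_eq_0_iff)
  then show ?thesis
    using sum_pcoeff[of p x] pcoeff_gt_pdeg[of x p d] by (cases d) auto
qed

lemma pcoeff_mult_free: "x \<notin> vars p \<Longrightarrow> pcoeff x n (p * q) = p * pcoeff x n q"
proof -
  assume x: "x \<notin> vars p"
  have "pcoeff x n (p * q) = (\<Sum>i\<le>n. if i = 0 then p * pcoeff x (n - i) q else 0)"
    unfolding pcoeff_mult by (rule sum.cong) (simp_all add: pcoeff_free[OF x])
  then show ?thesis by simp
qed

lemma pcoeff_diff: "pcoeff x d (p - q) = pcoeff x d p - pcoeff x d q"
  using pcoeff_add[of x d "p - q" q] by (simp add: algebra_simps)

lemma pdeg_mult:
  fixes p q :: "'x::countable qpoly"
  assumes "p \<noteq> 0" "q \<noteq> 0"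
  shows "pdeg x (p * q) = pdeg x p + pdeg x q"
proof (rule antisym)
  show "pdeg x (p * q) \<le> pdeg x p + pdeg x q"
    using degree_mult_le[of "vpoly x p" "vpoly x q"] by (simp add: degree_vpoly flip: vpoly_mult)
  have "pcoeff x (pdeg x p + pdeg x q) (p * q) = pcoeff x (pdeg x p) p * pcoeff x (pdeg x q) q"
    using coeff_mult_degree_sum[of "vpoly x p" "vpoly x q"]
    by (simp add: degree_vpoly coeff_vpoly flip: vpoly_mult)
  also have "\<dots> \<noteq> 0"
    using qpoly_no_zero_divisors[of "pcoeff x (pdeg x p) p" "pcoeff x (pdeg x q) q"]
      pcoeff_pdeg_neq_0[OF assms(1)] pcoeff_pdeg_neq_0[OF assms(2)] by blast
  finally show "pdeg x p + pdeg x q \<le> pdeg x (p * q)"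
    using pcoeff_gt_pdeg[of x "p * q"] by (meson not_le_imp_less)
qed

text \<open>A variable occurs exactly when the degree in it is positive, and degrees add.\<close>

lemma vars_mult_eq:
  fixes p q :: "'x::countable qpoly"
  assumes "p \<noteq> 0" "q \<noteq> 0"
  shows "vars (p * q) = vars p \<union> vars q"
proof (rule Set.set_eqI)
  fix x
  show "x \<in> vars (p * q) \<longleftrightarrow> x \<in> vars p \<union> vars q"
    using pdeg_mult[OF assms, of x] pdeg_eq_0_iff[of x p] pdeg_eq_0_iff[of x q] pdeg_eq_0_iff[of x "p * q"] by auto
qed

lemma qpoly_vars_empty: "vars p = {} \<Longrightarrow> \<exists>c. p = cst c"
proof -
  assume "vars p = {}"
  then have "m = 0" if "m \<in> keys p" for m
    using that by (auto simp: vars_def)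
  then have "keys p \<subseteq> {0}" by auto
  then have "p = cst (lookup p 0)"
    by (intro poly_mapping_eqI) (auto simp: cst_def lookup_single when_def in_keys_iff)
  then show ?thesis ..
qed

lemma qpoly_unit_iff:
  fixes p :: "'x::countable qpoly"
  shows "p dvd 1 \<longleftrightarrow> p \<noteq> 0 \<and> vars p = {}"
proof
  assume "p dvd 1"
  then obtain q where q: "1 = p * q" by (elim dvdE)
  then have "p \<noteq> 0" "q \<noteq> 0" by auto
  then show "p \<noteq> 0 \<and> vars p = {}"
    using vars_mult_eq[of p q] q by auto
next
  assume p: "p \<noteq> 0 \<and> vars p = {}"
  then obtain c where c: "p = cst c" using qpoly_vars_empty by blast
  then have "1 = p * cst (1 / c)"
    using p by (auto simp flip: cst_mult)
  then show "p dvd 1" by (rule dvdI)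
qed

text \<open>A factor of a nonzero polynomial cannot contain new variables, so divisors, units and
  irreducibility do not depend on the ambient set of variables.\<close>

lemma dvd_poly_over:
  fixes p f :: "'x::countable qpoly"
  assumes "f = p * k" "f \<in> poly_over V" "f \<noteq> 0"
  shows "p \<in> poly_over V" "k \<in> poly_over V"
proof -
  have "p \<noteq> 0" "k \<noteq> 0" using assms by auto
  then show "p \<in> poly_over V" "k \<in> poly_over V"
    using assms vars_mult_eq[of p k] by (auto simp: poly_over_def)
qed

lemma dvd_pcoeff_iff:
  assumes "x \<notin> vars p"
  shows "p dvd f \<longleftrightarrow> (\<forall>d. p dvd pcoeff x d f)"
proof
  assume "p dvd f"
  then show "\<forall>d. p dvd pcoeff x d f"
    by (auto simp: pcoeff_mult_free assms elim!: dvdE)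
next
  assume "\<forall>d. p dvd pcoeff x d f"
  then have "p dvd (\<Sum>d\<le>pdeg x f. pcoeff x d f * var x ^ d)"
    by (intro dvd_sum dvd_mult2) auto
  then show "p dvd f"
    using sum_pcoeff[of f x] by simp
qed

section \<open>Pseudo-division and irreducible factors\<close>

lemma pseudo_division:
  fixes f m :: "'x::countable qpoly"
  assumes "m \<noteq> 0" "m \<in> poly_over V"
  shows "f \<in> poly_over V \<Longrightarrow> \<exists>k s r. pcoeff x (pdeg x m) m ^ k * f = s * m + r \<and> (r = 0 \<or> pdeg x r < pdeg x m)
    \<and> s \<in> poly_over V \<and> r \<in> poly_over V"
proof (induct "pdeg x f" arbitrary: f rule: less_induct)
  case less
  let ?l = "pcoeff x (pdeg x m) m"
  have pc: "pcoeff x d p \<in> poly_over V" if "p \<in> poly_over V" for p :: "'x qpoly" and d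
    using that vars_pcoeff[of x d p] by (auto simp: poly_over_def)
  show ?case
  proof (cases "pdeg x f < pdeg x m \<or> f = 0")
    case True
    then show ?thesis
      by (intro exI[of _ 0] exI[of _ f]) (use less.prems in auto)
  next
    case False
    define c where "c = pcoeff x (pdeg x f) f * var x ^ (pdeg x f - pdeg x m)"
    define f' where "f' = ?l * f - c * m"
    have cV: "c \<in> poly_over V"
    proof -
      \<comment> \<open>The power of \<open>x\<close> in \<open>c\<close> stays over
        \<open>V\<close>: if it is nontrivial, \<open>x\<close> occurs in \<open>f\<close>.\<close>
      have "pdeg x f - pdeg x m \<noteq> 0 \<Longrightarrow> x \<in> V"
        using less.prems pdeg_eq_0_iff[of x f] by (auto simp: poly_over_def)
      then show ?thesis
        unfolding c_def by (cases "pdeg x f - pdeg x m = 0") (auto intro!: poly_over_mult poly_over_power pc less.prems simp: poly_over_var)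
    qed
    have f'V: "f' \<in> poly_over V"
      unfolding f'_def by (intro poly_over_diff poly_over_mult pc less.prems assms cV)
    have cm: "pcoeff x n (c * m) = (if n < pdeg x f - pdeg x m then 0 else pcoeff x (pdeg x f) f * pcoeff x (n - (pdeg x f - pdeg x m)) m)" for n
    proof -
      have "vpoly x (var x ^ e * m) = monom 1 e * vpoly x m" for e
      proof (induct e)
        case (Suc e)
        have "vpoly x (var x ^ Suc e * m) = vpoly x (var x) * vpoly x (var x ^ e * m)"
          by (simp add: mult.assoc flip: vpoly_mult)
        also have "vpoly x (var x) = monom 1 1"
          by (simp add: vpoly_def peval_var[OF rhom_cst_poly] monom_altdef)
        finally show ?case using Suc by (simp add: mult_monom flip: mult.assoc)
      qed (simp add: monom_altdef)
      then have "pcoeff x n (var x ^ e * m) = (if n < e then 0 else pcoeff x (n - e) m)" for e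
        by (simp add: coeff_monom_mult flip: coeff_vpoly)
      moreover have "x \<notin> vars (pcoeff x (pdeg x f) f)"
        using vars_pcoeff by fastforce
      ultimately show ?thesis
        unfolding c_def by (simp add: pcoeff_mult_free mult.assoc)
    qed
    have lm: "x \<notin> vars ?l"
      using vars_pcoeff by fastforce
    have le: "pcoeff x n f' = 0" if "n \<ge> pdeg x f" for n
    proof (cases "n = pdeg x f")
      case True
      then show ?thesis
        using False by (simp add: f'_def pcoeff_diff pcoeff_mult_free lm cm)
    next
      case n: False
      then have "pcoeff x n f = 0" "pcoeff x (n - (pdeg x f - pdeg x m)) m = 0"
        using that False by (auto intro!: pcoeff_gt_pdeg)
      then show ?thesis
        by (simp add: f'_def pcoeff_diff pcoeff_mult_free lm cm)
    qed
    have "f' = 0 \<or> pdeg x f' < pdeg x f"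
      using le pcoeff_pdeg_neq_0[of f' x] not_le_imp_less by blast
    then obtain k s r where *: "?l ^ k * f' = s * m + r" "r = 0 \<or> pdeg x r < pdeg x m" "s \<in> poly_over V" "r \<in> poly_over V"
    proof
      assume "f' = 0"
      then show ?thesis using that[of 0 0 0] by simp
    next
      assume "pdeg x f' < pdeg x f"
      then show ?thesis using less.hyps[OF _ f'V] that by blast
    qed
    have "?l ^ Suc k * f = (s + ?l ^ k * c) * m + r"
      using *(1) by (simp add: f'_def algebra_simps)
    moreover have "s + ?l ^ k * c \<in> poly_over V"
      by (intro poly_over_add poly_over_mult poly_over_power pc assms * cV)
    ultimately show ?thesis
      using * by blast
  qed
qed

text \<open>Descent on the sum of the degrees in all variables, which drops when a nonconstant
  cofactor is split off.\<close>

lemma irreducible_divisor_exists: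
  fixes a :: "'x::countable qpoly"
  assumes "a \<noteq> 0" "\<not> a dvd 1"
  shows "\<exists>p. Factorial_Ring.irreducible p \<and> p dvd a"
  using assms
proof (induct "\<Sum>x\<in>vars a. pdeg x a" arbitrary: a rule: less_induct)
  case less
  show ?case
  proof (cases "Factorial_Ring.irreducible a")
    case False
    then obtain b c where bc: "a = b * c" "\<not> b dvd 1" "\<not> c dvd 1"
      using less.prems by (auto simp: Factorial_Ring.irreducible_def)
    then have nz: "b \<noteq> 0" "c \<noteq> 0" using less.prems by auto
    then obtain y where y: "y \<in> vars c"
      using bc qpoly_unit_iff by blast
    have "(\<Sum>x\<in>vars b. pdeg x b) = (\<Sum>x\<in>vars a. pdeg x b)"
      by (rule sum.mono_neutral_left) (use vars_mult_eq[OF nz] bc in \<open>auto simp: pdeg_eq_0_iff\<close>)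
    also have "\<dots> < (\<Sum>x\<in>vars a. pdeg x a)"
    proof (rule sum_strict_mono_ex1)
      show "\<forall>x\<in>vars a. pdeg x b \<le> pdeg x a"
        using pdeg_mult[OF nz] bc by simp
      show "\<exists>x\<in>vars a. pdeg x b < pdeg x a"
        using y pdeg_mult[OF nz, of y] pdeg_eq_0_iff[of y c] bc vars_mult_eq[OF nz] by (intro bexI[of _ y]) auto
    qed simp
    finally obtain p where "Factorial_Ring.irreducible p" "p dvd b"
      using less.hyps[of b] nz bc by auto
    then show ?thesis using bc by auto
  qed auto
qed

lemma irreducible_nonunit: "Factorial_Ring.irreducible p \<Longrightarrow> \<not> p dvd 1"
  and irreducible_neq_0: "Factorial_Ring.irreducible p \<Longrightarrow> p \<noteq> 0"
  and irreducible_split: "Factorial_Ring.irreducible p \<Longrightarrow> p = a * b \<Longrightarrow> a dvd 1 \<or> b dvd 1"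
  by (auto simp: Factorial_Ring.irreducible_def)

text \<open>Induction on the number of variables, with Gauss's lemma in the step.\<close>

lemma qpoly_irreducible_prime_aux:
  fixes V :: "'x::countable set"
  assumes "finite V"
  shows "Factorial_Ring.irreducible p \<Longrightarrow> p \<in> poly_over V \<Longrightarrow> f \<in> poly_over V \<Longrightarrow> g \<in> poly_over V \<Longrightarrow> p dvd f * g
    \<Longrightarrow> p dvd f \<or> p dvd g"
  using assms
proof (induct V arbitrary: p f g rule: finite_induct)
  case empty
  then have "p dvd 1"
    using irreducible_neq_0[of p] by (auto simp: qpoly_unit_iff poly_over_def)
  then show ?case
    using empty irreducible_nonunit by blast
next
  case (insert x V p f g)
  define A where "A = (poly_over V :: 'x qpoly set)"
  define AX where "AX = (poly_over (insert x V) :: 'x qpoly set)"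
  have A_AX: "A \<subseteq> AX"
    unfolding A_def AX_def by (rule poly_over_mono) auto
  have A_free: "x \<notin> vars a" if "a \<in> A" for a
    using that insert.hyps by (auto simp: A_def poly_over_def)
  have pcA: "pcoeff x d q \<in> A" if "q \<in> AX" for d q
    using that vars_pcoeff[of x d q] by (auto simp: A_def AX_def poly_over_def)
  have AX_A: "q \<in> A" if "q \<in> AX" "x \<notin> vars q" for q
    using that by (auto simp: A_def AX_def poly_over_def)
  \<comment> \<open>Let \<open>i\<close> and \<open>j\<close> be the first coefficients of
    \<open>f\<close> and \<open>g\<close> not divisible by \<open>\<pi>\<close>. All other terms of
    the coefficient of the product at \<open>i + j\<close> are divisible, hence so is the product of
    these two, against the induction hypothesis.\<close>
  have prime_A: "\<pi> dvd f \<or> \<pi> dvd g" if \<pi>: "Factorial_Ring.irreducible \<pi>" "\<pi> \<in> A" and fg: "f \<in> AX" "g \<in> AX" "\<pi> dvd f * g" for \<pi> f g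
  proof (rule ccontr)
    assume "\<not> (\<pi> dvd f \<or> \<pi> dvd g)"
    then have ex: "\<exists>i. \<not> \<pi> dvd pcoeff x i f" "\<exists>j. \<not> \<pi> dvd pcoeff x j g"
      using dvd_pcoeff_iff[OF A_free[OF \<pi>(2)]] by blast+
    define i where "i = (LEAST i. \<not> \<pi> dvd pcoeff x i f)"
    define j where "j = (LEAST j. \<not> \<pi> dvd pcoeff x j g)"
    have i: "\<not> \<pi> dvd pcoeff x i f" "\<And>k. k < i \<Longrightarrow> \<pi> dvd pcoeff x k f"
      unfolding i_def using LeastI_ex[OF ex(1)] not_less_Least by blast+
    have j: "\<not> \<pi> dvd pcoeff x j g" "\<And>k. k < j \<Longrightarrow> \<pi> dvd pcoeff x k g"
      unfolding j_def using LeastI_ex[OF ex(2)] not_less_Least by blast+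
    have "\<pi> dvd pcoeff x (i + j) (f * g)"
      using fg(3) dvd_pcoeff_iff[OF A_free[OF \<pi>(2)]] by blast
    moreover have "pcoeff x (i + j) (f * g)
        = pcoeff x i f * pcoeff x j g + (\<Sum>k\<in>{..i + j} - {i}. pcoeff x k f * pcoeff x (i + j - k) g)"
      unfolding pcoeff_mult by (subst sum.remove[of _ i]) auto
    moreover have "\<pi> dvd (\<Sum>k\<in>{..i + j} - {i}. pcoeff x k f * pcoeff x (i + j - k) g)"
    proof (rule dvd_sum)
      fix k assume "k \<in> {..i + j} - {i}"
      then have "k < i \<or> i + j - k < j" by auto
      then show "\<pi> dvd pcoeff x k f * pcoeff x (i + j - k) g"
        using i j by auto
    qed
    ultimately have "\<pi> dvd pcoeff x i f * pcoeff x j g"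
      using dvd_add_left_iff[of \<pi> "\<Sum>k\<in>{..i + j} - {i}. pcoeff x k f * pcoeff x (i + j - k) g" "pcoeff x i f * pcoeff x j g"]
      by simp
    then show False
      using insert.hyps(3)[OF \<pi>(1)] \<pi>(2) pcA fg i j unfolding A_def by blast
  qed
  \<comment> \<open>A factor \<open>a\<close> free of \<open>x\<close> can be removed from a
    product: each of its irreducible factors divides \<open>s\<close> or \<open>t\<close> by
    \<open>prime_A\<close>, and they are taken out one at a time.\<close>
  have cancel: "\<exists>s1 t1 b c. b \<in> A \<and> c \<in> A \<and> s = b * s1 \<and> t = c * t1 \<and> w = s1 * t1"
    if "a \<in> A" "a \<noteq> 0" "w \<in> AX" "s \<in> AX" "t \<in> AX" "a * w = s * t" for a w s t
    using that
  proof (induct "\<Sum>x\<in>vars a. pdeg x a" arbitrary: a s t rule: less_induct)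
    case less
    show ?case
    proof (cases "a dvd 1")
      case True
      then obtain a' where a': "1 = a * a'" by (elim dvdE)
      then have "a \<in> A" "a' \<in> A"
        using dvd_poly_over[OF a', of V] by (auto simp: A_def)
      moreover have "w = (a' * s) * t"
      proof -
        have "w = (a * a') * w" by (simp flip: a')
        also have "\<dots> = a' * (a * w)" by (simp only: mult_ac)
        also have "\<dots> = (a' * s) * t" by (simp only: less.prems(6) mult.assoc)
        finally show ?thesis .
      qed
      moreover have "s = a * (a' * s)"
        by (simp flip: mult.assoc a')
      moreover have "1 \<in> A" "t = 1 * t"
        by (simp_all add: A_def)
      ultimately show ?thesis by blast
    next
      case False
      then obtain \<pi> where \<pi>: "Factorial_Ring.irreducible \<pi>" "\<pi> dvd a"
        using irreducible_divisor_exists less.prems by blast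
      then obtain a' where a': "a = \<pi> * a'" by (elim dvdE)
      have \<pi>A: "\<pi> \<in> A" "a' \<in> A"
        using dvd_poly_over[OF a', of V] less.prems by (auto simp: A_def)
      have nz: "\<pi> \<noteq> 0" "a' \<noteq> 0" using a' less.prems by auto
      obtain y where y: "y \<in> vars \<pi>"
        using \<pi> nz irreducible_nonunit qpoly_unit_iff by blast
      have "(\<Sum>x\<in>vars a'. pdeg x a') = (\<Sum>x\<in>vars a. pdeg x a')"
        by (rule sum.mono_neutral_left) (use vars_mult_eq[OF nz] a' in \<open>auto simp: pdeg_eq_0_iff\<close>)
      also have "\<dots> < (\<Sum>x\<in>vars a. pdeg x a)"
      proof (rule sum_strict_mono_ex1)
        show "\<forall>x\<in>vars a. pdeg x a' \<le> pdeg x a"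
          using pdeg_mult[OF nz] a' by simp
        show "\<exists>x\<in>vars a. pdeg x a' < pdeg x a"
          using y pdeg_mult[OF nz, of y] pdeg_eq_0_iff[of y \<pi>] a' vars_mult_eq[OF nz] by (intro bexI[of _ y]) auto
      qed simp
      finally have lt: "(\<Sum>x\<in>vars a'. pdeg x a') < (\<Sum>x\<in>vars a. pdeg x a)" .
      have "\<pi> dvd s * t"
        using less.prems(6) a' by (metis dvd_triv_left mult.assoc)
      then consider "\<pi> dvd s" | "\<pi> dvd t"
        using prime_A \<pi> \<pi>A less.prems by blast
      then show ?thesis
      proof cases
        case 1
        then obtain s' where s': "s = \<pi> * s'" by (elim dvdE)
        have "a' * w = s' * t"
          by (rule qpoly_mult_left_cancel[of \<pi>]) (use less.prems(6) a' s' nz in \<open>simp_all add: mult.assoc\<close>)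
        moreover have "s' \<in> AX"
          using dvd_poly_over(2)[OF s', of "insert x V"] less.prems nz(1) qpoly_no_zero_divisors[of \<pi> s']
          by (cases "s' = 0") (auto simp: AX_def s')
        ultimately obtain s1 t1 b c where "b \<in> A" "c \<in> A" "s' = b * s1" "t = c * t1" "w = s1 * t1"
          using less.hyps[OF lt \<pi>A(2) nz(2)] less.prems by blast
        then show ?thesis
          using s' \<pi>A by (intro exI[of _ s1] exI[of _ t1] exI[of _ "\<pi> * b"] exI[of _ c]) (auto simp: A_def poly_over_mult mult.assoc)
      next
        case 2
        then obtain t' where t': "t = \<pi> * t'" by (elim dvdE)
        have "a' * w = s * t'"
          by (rule qpoly_mult_left_cancel[of \<pi>]) (use less.prems(6) a' t' nz in \<open>simp_all add: mult_ac\<close>)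
        moreover have "t' \<in> AX"
          using dvd_poly_over(2)[OF t', of "insert x V"] less.prems nz(1) qpoly_no_zero_divisors[of \<pi> t']
          by (cases "t' = 0") (auto simp: AX_def t')
        ultimately obtain s1 t1 b c where "b \<in> A" "c \<in> A" "s = b * s1" "t' = c * t1" "w = s1 * t1"
          using less.hyps[OF lt \<pi>A(2) nz(2)] less.prems by blast
        then show ?thesis
          using t' \<pi>A by (intro exI[of _ s1] exI[of _ t1] exI[of _ b] exI[of _ "\<pi> * c"]) (auto simp: A_def poly_over_mult mult.assoc)
      qed
    qed
  qed
  have p: "Factorial_Ring.irreducible p" "p \<in> AX" "f \<in> AX" "g \<in> AX" "p dvd f * g"
    using insert.prems by (auto simp: AX_def)
  have p0: "p \<noteq> 0" using p irreducible_neq_0 by blast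
  show ?case
  proof (cases "x \<in> vars p")
    case False
    then show ?thesis
      using prime_A p AX_A by blast
  next
    case True
    \<comment> \<open>An irreducible \<open>p\<close> that contains \<open>x\<close> has no
      nonconstant factor in \<open>A\<close>, so nonzero multipliers from \<open>A\<close> do not
      affect divisibility by \<open>p\<close>.\<close>
    have clear: "p dvd h" if cl: "a \<in> A" "a \<noteq> 0" "h \<in> AX" "p dvd a * h" for a h
    proof (cases "h = 0")
      case h0: False
      obtain k where k: "a * h = p * k" using cl(4) by (elim dvdE)
      have "a * h \<noteq> 0" using cl h0 qpoly_no_zero_divisors by blast
      then have "k \<in> AX"
        using dvd_poly_over(2)[OF k, of "insert x V"] cl A_AX by (auto simp: AX_def intro: poly_over_mult)
      then obtain s1 t1 b c where *: "b \<in> A" "c \<in> A" "p = b * s1" "k = c * t1" "h = s1 * t1"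
        using cancel[OF cl(1,2,3) p(2) _ k] by blast
      have "b dvd 1 \<or> s1 dvd 1" using irreducible_split p(1) *(3) by blast
      then show ?thesis
      proof
        assume "b dvd 1"
        then obtain b' where "1 = b * b'" by (elim dvdE)
        moreover have "p * b' = s1 * (b * b')" using *(3) by (simp add: mult_ac)
        ultimately have "s1 = p * b'" by simp
        then have "h = p * (b' * t1)" using *(5) by (metis mult.assoc)
        then show ?thesis by simp
      next
        assume "s1 dvd 1"
        then have "vars s1 = {}" "s1 \<noteq> 0" by (auto simp: qpoly_unit_iff)
        moreover have "b \<noteq> 0" using * p0 by auto
        ultimately have "vars p = vars b"
          using *(3) vars_mult_eq[of b s1] by simp
        then show ?thesis using True A_free * by blast
      qed
    qed simp
    \<comment> \<open>An element \<open>m\<close> of least degree in \<open>x\<close> is a greatest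
      common divisor of \<open>p\<close> and \<open>f\<close> over the fraction field of
      \<open>A\<close>; pseudo-division avoids leaving \<open>AX\<close>.\<close>
    define M where "M = {m. m \<noteq> 0 \<and> (\<exists>u\<in>AX. \<exists>v\<in>AX. m = u * p + v * f)}"
    have one_AX: "0 \<in> AX" "1 \<in> AX" by (simp_all add: AX_def)
    have "p \<in> M"
      unfolding M_def mem_Collect_eq
      using p0 one_AX by (intro conjI bexI[of _ 1] bexI[of _ 0]) simp_all
    then obtain m where m: "m \<in> M" "\<And>m'. m' \<in> M \<Longrightarrow> pdeg x m \<le> pdeg x m'"
      using exists_least_iff[of "\<lambda>n. \<exists>m\<in>M. pdeg x m = n"] by (metis not_le_imp_less)
    then obtain u v where uv: "u \<in> AX" "v \<in> AX" "m = u * p + v * f" "m \<noteq> 0"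
      by (auto simp: M_def)
    have mAX: "m \<in> AX"
      using uv p by (auto simp: AX_def intro!: poly_over_add poly_over_mult)
    define l where "l = pcoeff x (pdeg x m) m"
    have l: "l \<in> A" "l \<noteq> 0"
      using pcA[OF mAX] pcoeff_pdeg_neq_0[OF uv(4)] by (auto simp: l_def)
    have lk: "l ^ k \<in> A" "l ^ k \<noteq> 0" for k
    proof -
      show "l ^ k \<in> A" using l by (auto simp: A_def intro: poly_over_power)
      show "l ^ k \<noteq> 0" using l qpoly_no_zero_divisors by (induct k) auto
    qed
    have div: "\<exists>k s. l ^ k * h = s * m \<and> s \<in> AX" if hh: "\<exists>u\<in>AX. \<exists>v\<in>AX. h = u * p + v * f" "h \<in> AX" for h
    proof -
      obtain k s r where *: "l ^ k * h = s * m + r" "r = 0 \<or> pdeg x r < pdeg x m" "s \<in> AX" "r \<in> AX"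
        using pseudo_division[of m "insert x V" h x] uv(4) mAX hh by (auto simp: l_def AX_def)
      obtain u' v' where h: "u' \<in> AX" "v' \<in> AX" "h = u' * p + v' * f"
        using hh by blast
      have "r = (l ^ k * u' - s * u) * p + (l ^ k * v' - s * v) * f"
        using *(1) h(3) uv(3) by (simp add: algebra_simps)
      moreover have "l ^ k * u' - s * u \<in> AX" "l ^ k * v' - s * v \<in> AX"
        using h uv * lk(1)[of k] A_AX by (auto simp: AX_def intro!: poly_over_diff poly_over_mult)
      ultimately have "r \<noteq> 0 \<Longrightarrow> r \<in> M"
        unfolding M_def by blast
      then have "r = 0"
        using *(2) m(2) not_le by blast
      then show ?thesis using * by auto
    qed
    obtain k s where ks: "l ^ k * p = s * m" "s \<in> AX"
      using div[of p, OF bexI[of _ 1, OF bexI[of _ 0]]] p one_AX by auto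
    obtain k' s' where ks': "l ^ k' * f = s' * m" "s' \<in> AX"
      using div[of f, OF bexI[of _ 0, OF bexI[of _ 1]]] p one_AX by auto
    obtain s1 t1 b c where *: "b \<in> A" "c \<in> A" "s = b * s1" "m = c * t1" "p = s1 * t1"
      using cancel[OF lk p(2) ks(2) mAX ks(1)] by blast
    \<comment> \<open>If \<open>s1\<close> is a unit, \<open>p\<close> divides \<open>m\<close> and
      therefore \<open>l ^ k' * f\<close>. If \<open>t1\<close> is a unit, \<open>m\<close> is free
      of \<open>x\<close>, and \<open>p\<close> divides \<open>m * g\<close> because
      \<open>m\<close> combines \<open>p\<close> and \<open>f\<close>. In both cases
      \<open>clear\<close> finishes.\<close>
    have "s1 dvd 1 \<or> t1 dvd 1" using irreducible_split p(1) *(5) by blast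
    then show ?thesis
    proof
      assume "s1 dvd 1"
      then obtain b' where "1 = s1 * b'" by (elim dvdE)
      moreover have "p * b' = t1 * (s1 * b')" using *(5) by (simp add: mult_ac)
      ultimately have "t1 = p * b'" by simp
      then have "m = p * (c * b')" using *(4) by (metis mult.left_commute)
      then have "p dvd m" by simp
      then have "p dvd l ^ k' * f" using ks' by auto
      then show ?thesis using clear[OF lk p(3)] by blast
    next
      assume "t1 dvd 1"
      then have "vars t1 = {}" by (auto simp: qpoly_unit_iff)
      then have "m \<in> A"
        using * vars_mult[of c t1] by (auto simp: A_def poly_over_def)
      moreover have "p dvd m * g"
        using p(5) uv(3) by (simp add: distrib_right mult.assoc)
      ultimately show ?thesis
        using clear[of m g] uv(4) p(4) by blast
    qed
  qed
qed

lemma qpoly_irreducible_prime: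
  fixes p :: "'x::countable qpoly"
  assumes "Factorial_Ring.irreducible p" "p dvd f * g"
  shows "p dvd f \<or> p dvd g"
  by (rule qpoly_irreducible_prime_aux[of "vars p \<union> vars f \<union> vars g"]) (use assms in \<open>auto simp: poly_over_def\<close>)

section \<open>Freeing the distinguished slots\<close>

text \<open>Gaussian elimination for fewer equations \<open>B\<close> than unknowns
  \<open>A\<close>: a pivot \<open>a0\<close> eliminates the equation \<open>b\<close>.\<close>

lemma linear_dependence:
  fixes M :: "'a \<Rightarrow> 'b \<Rightarrow> 'f::field"
  assumes "finite B"
  shows "finite A \<Longrightarrow> card B < card A \<Longrightarrow> \<exists>e. (\<exists>a\<in>A. e a \<noteq> 0) \<and> (\<forall>b\<in>B. (\<Sum>a\<in>A. e a * M a b) = 0)"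
  using assms
proof (induct B arbitrary: A M rule: finite_induct)
  case empty
  then show ?case by (intro exI[of _ "\<lambda>_. 1"]) (auto simp: card_gt_0_iff)
next
  case (insert b B)
  show ?case
  proof (cases "\<forall>a\<in>A. M a b = 0")
    case True
    obtain e where "\<exists>a\<in>A. e a \<noteq> 0" "\<forall>c\<in>B. (\<Sum>a\<in>A. e a * M a c) = 0"
      using insert.hyps(3)[OF insert.prems(1), of M] insert.prems insert.hyps(1,2) by auto
    then show ?thesis using True by (intro exI[of _ e]) auto
  next
    case False
    then obtain a0 where a0: "a0 \<in> A" "M a0 b \<noteq> 0" by blast
    let ?A = "A - {a0}"
    let ?N = "\<lambda>a c. M a c - M a b / M a0 b * M a0 c"
    have "card B < card ?A"
      using insert.prems insert.hyps a0 by (simp add: card_Diff_singleton)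
    then obtain e where e: "\<exists>a\<in>?A. e a \<noteq> 0" "\<forall>c\<in>B. (\<Sum>a\<in>?A. e a * ?N a c) = 0"
      using insert.hyps(3)[of ?A ?N] insert.prems(1) by auto
    define t where "t = - (\<Sum>a\<in>?A. e a * M a b) / M a0 b"
    let ?e = "e(a0 := t)"
    have s: "(\<Sum>a\<in>A. ?e a * M a c) = t * M a0 c + (\<Sum>a\<in>?A. e a * M a c)" for c
    proof -
      have "(\<Sum>a\<in>?A. ?e a * M a c) = (\<Sum>a\<in>?A. e a * M a c)"
        by (rule sum.cong) auto
      then show ?thesis using a0 insert.prems(1) by (simp add: sum.remove[of A a0])
    qed
    have "(\<Sum>a\<in>A. ?e a * M a b) = 0"
      unfolding s using a0 by (simp add: t_def)
    moreover have "(\<Sum>a\<in>A. ?e a * M a c) = 0" if "c \<in> B" for c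
    proof -
      have "t * M a0 c = - (\<Sum>a\<in>?A. e a * (M a b / M a0 b * M a0 c))"
        by (simp add: t_def sum_distrib_left sum_distrib_right sum_divide_distrib sum_negf mult_ac)
      then have "(\<Sum>a\<in>A. ?e a * M a c) = (\<Sum>a\<in>?A. e a * ?N a c)"
        unfolding s by (simp add: right_diff_distrib sum_subtractf)
      then show ?thesis using e that by simp
    qed
    moreover have "\<exists>a\<in>A. ?e a \<noteq> 0" using e(1) by auto
    ultimately show ?thesis by blast
  qed
qed

text \<open>Slots are changed one at a time; closure of \<open>N\<close> under partial derivatives
  restores the hypothesis at each new point.\<close>

lemma peval_taylor_set:
  fixes g :: "'x \<Rightarrow> 'f::field_char_0"
  assumes "finite X" "\<forall>p\<in>N. peval of_rat g p = 0" "\<forall>p\<in>N. \<forall>x\<in>X. pdiff x p \<in> N" "\<forall>x. x \<notin> X \<longrightarrow> g' x = g x"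
  shows "\<forall>p\<in>N. peval of_rat g' p = 0"
  using assms
proof (induct X arbitrary: g rule: finite_induct)
  case empty
  then have "g' = g" by auto
  then show ?case using empty by simp
next
  case (insert x X)
  have iter: "(pdiff x ^^ r) p \<in> N" if "p \<in> N" for p r
    using that insert.prems(2) by (induct r) auto
  have "\<forall>p\<in>N. peval of_rat (g(x := g' x)) p = 0"
    using insert.prems(1) iter by (auto intro!: peval_taylor)
  then show ?case
    by (rule insert.hyps(3)) (use insert.prems in auto)
qed

text \<open>The dual derivation of a slot carries a relation to its partial derivative, so all
  iterated partial derivatives vanish, and Taylor expansion makes the slot arbitrary: slots with
  dual derivations are free.\<close>

lemma peval_dual_ders:
  fixes g :: "'x \<Rightarrow> 'f::field_char_0"
  assumes "finite X" "p \<in> poly_over V" "peval of_rat g p = 0" "\<forall>x. x \<notin> X \<longrightarrow> g' x = g x"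
    and D: "\<And>x. x \<in> X \<Longrightarrow> \<exists>D. is_der D \<and> D (g x) = 1 \<and> (\<forall>z\<in>V. z \<noteq> x \<longrightarrow> D (g z) = 0)"
  shows "peval of_rat g' p = 0"
proof -
  let ?N = "{p \<in> poly_over V. peval of_rat g p = 0}"
  have N: "\<forall>p\<in>?N. \<forall>x\<in>X. pdiff x p \<in> ?N"
  proof (intro ballI)
    fix p x assume p: "p \<in> ?N" and x: "x \<in> X"
    obtain D where D: "is_der D" "D (g x) = 1" "\<forall>z\<in>V. z \<noteq> x \<longrightarrow> D (g z) = 0"
      using D[OF x] by blast
    have "D (peval of_rat g p) = peval of_rat g (pdiff x p) * D (g x)"
      by (rule der_peval_1) (use p D in \<open>auto simp: poly_over_def\<close>)
    then show "pdiff x p \<in> ?N"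
      using p D der_0[OF D(1)] by (auto intro: pdiff_poly_over)
  qed
  have "\<forall>p\<in>?N. peval of_rat g' p = 0"
    by (rule peval_taylor_set[OF assms(1) _ N assms(4)]) simp
  then show ?thesis using assms(2,3) by auto
qed

lemma peval_all_rat_set:
  fixes g :: "'x \<Rightarrow> 'f::field_char_0"
  assumes "finite X" "\<And>r. peval of_rat (\<lambda>x. if x \<in> X then of_rat (r x) else g x) p = 0"
    and "\<And>x. x \<notin> X \<Longrightarrow> g' x = g x"
  shows "peval of_rat g' p = 0"
  using assms
proof (induct X arbitrary: g rule: finite_induct)
  case empty
  then have "g' = g" by auto
  then show ?case using empty by simp
next
  case (insert x X)
  show ?case
  proof (rule insert.hyps(3)[of "g(x := g' x)"])
    fix r
    let ?h = "\<lambda>z. if z \<in> X then of_rat (r z) else g z"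
    have "(\<lambda>z. if z \<in> insert x X then of_rat ((r(x := t)) z) else g z) = ?h(x := of_rat t)" for t
      using insert.hyps(2) by auto
    then have "peval of_rat (?h(x := of_rat t)) p = 0" for t
      using insert.prems(1)[of "r(x := t)"] by simp
    then have "peval of_rat (?h(x := g' x)) p = 0"
      by (rule peval_all_rat)
    moreover have "(\<lambda>z. if z \<in> X then of_rat (r z) else (g(x := g' x)) z) = ?h(x := g' x)"
      using insert.hyps(2) by auto
    ultimately show "peval of_rat (\<lambda>z. if z \<in> X then of_rat (r z) else (g(x := g' x)) z) p = 0"
      by simp
  qed (use insert.prems in auto)
qed

lemma peval_const_slot:
  fixes g :: "'x \<Rightarrow> 'f::field_char_0"
  assumes "\<And>v. peval of_rat (g(x := v)) (pdiff x p) = 0"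
  shows "peval of_rat (g(x := v)) p = peval of_rat g p"
proof -
  have "pderiv (upoly x g p) = 0"
    using assms by (subst poly_all_0_iff_0[symmetric]) (simp add: pderiv_upoly poly_upoly)
  then obtain c where "upoly x g p = [:c:]"
    by (metis pderiv_eq_0_iff degree_eq_zeroE)
  then have "poly (upoly x g p) v = poly (upoly x g p) (g x)" by simp
  then show ?thesis by (simp add: poly_upoly)
qed

text \<open>Replacing the special values \<open>w h\<close> of the slots \<open>(h, T h)\<close>, \<open>h \<in> I\<close>, by arbitrary ones preserves the
  zeros: a counterexample of minimal total degree has nonzero partial derivatives in these slots, so that
  a derivation \<open>E\<close> killing all values but \<open>w h0\<close> would kill \<open>w h0\<close> and the monomials \<open>mn h \<alpha>\<close> too.\<close>

lemma slots_free:
  fixes mn :: "'h \<Rightarrow> 'e \<Rightarrow> 'f::field_char_0" and val :: "'h \<times> 'e \<Rightarrow> 'f" and J :: "'h set" and G :: "'h \<times> 'e \<Rightarrow> 'f" and A :: "'h \<Rightarrow> 'e set" and T :: "'h \<Rightarrow> 'e"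
  defines "ep \<equiv> \<lambda>h. - (\<Sum>\<alpha>\<in>A h - {T h}. G (h, \<alpha>) * mn h \<alpha>)"
  defines "slot \<equiv> \<lambda>w (h, \<alpha>). if h \<in> J then val (h, \<alpha>) else if \<alpha> = T h then w h else G (h, \<alpha>)"
  assumes fin: "finite S" "\<And>h. h \<in> S \<Longrightarrow> finite (A h)" and T: "\<And>h. h \<in> S \<Longrightarrow> T h \<in> A h"
    and dual: "\<And>h \<alpha>. h \<in> S - J \<Longrightarrow> \<alpha> \<in> A h \<Longrightarrow> \<alpha> \<noteq> T h \<Longrightarrow> \<exists>D. is_der D \<and> D (G (h, \<alpha>)) = 1
      \<and> (\<forall>h'\<in>S. \<forall>\<beta>\<in>A h'. \<beta> \<noteq> T h' \<longrightarrow> (h', \<beta>) \<noteq> (h, \<alpha>) \<longrightarrow> D (G (h', \<beta>)) = 0)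
      \<and> (\<forall>h'\<in>S. \<forall>\<beta>\<in>A h'. D (mn h' \<beta>) = 0) \<and> (\<forall>h'\<in>S \<inter> J. \<forall>\<beta>\<in>A h'. D (val (h', \<beta>)) = 0)"
    and rigid: "\<And>I h0. I \<subseteq> S - J \<Longrightarrow> h0 \<in> I \<Longrightarrow> \<exists>E. is_der E
      \<and> (\<forall>h\<in>S. \<forall>\<alpha>\<in>A h. \<alpha> \<noteq> T h \<longrightarrow> E (G (h, \<alpha>)) = 0) \<and> (\<forall>h\<in>S \<inter> J. \<forall>\<alpha>\<in>A h. E (val (h, \<alpha>)) = 0)
      \<and> (\<forall>h\<in>I - {h0}. E (ep h) = 0)
      \<and> (E (ep h0) \<noteq> 0 \<or> (\<exists>h\<in>I. \<exists>\<alpha>\<in>A h. E (mn h \<alpha>) \<noteq> 0))"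
    and mn: "\<And>h. h \<in> S \<Longrightarrow> mn h (T h) = 1"
  shows "I \<subseteq> S - J \<Longrightarrow> Q \<in> poly_over (SIGMA h : S. A h) \<Longrightarrow> (\<And>h. h \<in> I \<Longrightarrow> w h = ep h)
    \<Longrightarrow> (\<And>h. h \<in> S - J - I \<Longrightarrow> w h \<in> range of_rat) \<Longrightarrow> peval of_rat (slot w) Q = 0
    \<Longrightarrow> (\<And>h. h \<notin> I \<Longrightarrow> w' h = w h) \<Longrightarrow> peval of_rat (slot w') Q = 0"
proof (induct "card I" arbitrary: I Q w w' rule: less_induct)
  case IH: less
  have finI: "finite I" using IH.prems(1) fin(1) finite_subset by auto
  have slot_upd: "slot (v(h := r)) = (slot v)((h, T h) := r)" if "h \<in> S - J" for v h r
    using that by (auto simp: slot_def fun_eq_iff)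
  show ?case
    using IH.prems
  proof (induct "tdeg Q" arbitrary: Q w w' rule: less_induct)
    case (less Q w w')
    show ?case
    \<comment> \<open>A partial derivative in a slot of \<open>I\<close> has smaller degree; if it
      vanishes, the inner induction makes it vanish for all values of these slots, and
      \<open>Q\<close> is constant in the slot of \<open>h\<close>.\<close>
    proof (cases "\<exists>h\<in>I. peval of_rat (slot w) (pdiff (h, T h) Q) = 0")
      case True
      then obtain h where h: "h \<in> I" "peval of_rat (slot w) (pdiff (h, T h) Q) = 0" by blast
      have hS: "h \<in> S - J" using h less.prems by blast
      have all0: "peval of_rat (slot v) (pdiff (h, T h) Q) = 0" if "\<And>h'. h' \<notin> I \<Longrightarrow> v h' = w h'" for v
      proof (cases "pdiff (h, T h) Q = 0")
        case False
        then have "tdeg (pdiff (h, T h) Q) < tdeg Q" using tdeg_pdiff[of "(h, T h)" Q] by simp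
        then show ?thesis
          by (rule less.hyps[where w = w]) (use less.prems h that in \<open>auto intro: pdiff_poly_over\<close>)
      qed simp
      have const: "peval of_rat (slot (w(h := r))) Q = 0" for r
      proof -
        have "peval of_rat ((slot w)((h, T h) := v)) (pdiff (h, T h) Q) = 0" for v
          unfolding slot_upd[OF hS, symmetric] by (rule all0) (use h in auto)
        then show ?thesis
          using peval_const_slot[of "slot w" "(h, T h)" Q r] less.prems(5) by (simp add: slot_upd[OF hS])
      qed
      \<comment> \<open>With a rational value in its slot, \<open>h\<close> leaves \<open>I\<close>,
        and the outer induction treats the remaining slots; afterwards the rational value is
        released.\<close>
      have "peval of_rat (slot (w'(h := of_rat r))) Q = 0" for r
      proof (rule IH.hyps[of "I - {h}" Q "w(h := of_rat r)"])
        show "card (I - {h}) < card I" using h(1) finI by (rule card_Diff1_less[rotated])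
        show "I - {h} \<subseteq> S - J" using less.prems(1) by blast
        show "(w(h := of_rat r)) h' = ep h'" if "h' \<in> I - {h}" for h'
          using less.prems(3) that by simp
        show "(w(h := of_rat r)) h' \<in> range of_rat" if "h' \<in> S - J - (I - {h})" for h'
          using less.prems(4) that by (cases "h' = h") auto
        show "(w'(h := of_rat r)) h' = (w(h := of_rat r)) h'" if "h' \<notin> I - {h}" for h'
          using less.prems(6) that by (cases "h' = h") auto
      qed (rule less.prems const)+
      then have "peval of_rat ((slot w')((h, T h) := of_rat r)) Q = 0" for r
        by (simp add: slot_upd[OF hS])
      then have "peval of_rat ((slot w')((h, T h) := w' h)) Q = 0"
        by (rule peval_all_rat)
      then show ?thesis
        by (simp add: slot_upd[OF hS, symmetric])
    next
      case False
      show ?thesis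
      proof (cases "I = {}")
        case True
        then have "w' = w" using less.prems by auto
        then show ?thesis using less.prems by simp
      next
        case ne: False
        then obtain h0 where h0: "h0 \<in> I" by blast
        obtain E where E: "is_der E" "\<forall>h\<in>S. \<forall>\<alpha>\<in>A h. \<alpha> \<noteq> T h \<longrightarrow> E (G (h, \<alpha>)) = 0"
          "\<forall>h\<in>S \<inter> J. \<forall>\<alpha>\<in>A h. E (val (h, \<alpha>)) = 0" "\<forall>h\<in>I - {h0}. E (ep h) = 0"
          "E (ep h0) \<noteq> 0 \<or> (\<exists>h\<in>I. \<exists>\<alpha>\<in>A h. E (mn h \<alpha>) \<noteq> 0)"
          using rigid[OF less.prems(1) h0] by blast
        have nz: "peval of_rat (slot w) (pdiff (h, T h) Q) \<noteq> 0" if "h \<in> I" for h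
          using False that by blast
        have kills: "E (slot w x) = 0" if x: "x \<in> (SIGMA h : S. A h)" "x \<noteq> (h0, T h0)" for x
        proof -
          obtain h \<alpha> where x_def: "x = (h, \<alpha>)" by (cases x)
          have "E (w h) = 0" if hJ: "h \<notin> J" "\<alpha> = T h"
          proof (cases "h \<in> I")
            case True
            then show ?thesis using less.prems(3) E(4) x that x_def by auto
          next
            case hI: False
            then obtain r where "w h = of_rat r" using less.prems(4)[of h] x hJ x_def by auto
            then show ?thesis using der_of_rat[OF E(1)] by simp
          qed
          then show ?thesis using E x by (auto simp: slot_def x_def)
        qed
        have Qv: "vars Q \<subseteq> (SIGMA h : S. A h)" using less.prems(2) by (auto simp: poly_over_def)
        \<comment> \<open>All slots except that of \<open>h0\<close> hold values killed by
          \<open>E\<close>, and the partial derivative in this slot is nonzero, so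
          \<open>E (ep h0)\<close> must vanish.\<close>
        have "E (peval of_rat (slot w) Q) = peval of_rat (slot w) (pdiff (h0, T h0) Q) * E (slot w (h0, T h0))"
          by (rule der_peval_1[OF E(1)]) (use kills Qv in blast)
        moreover have slot_h0: "slot w (h0, T h0) = ep h0"
          using h0 less.prems by (auto simp: slot_def)
        ultimately have Eh0: "E (ep h0) = 0"
          using less.prems(5) nz[OF h0] der_0[OF E(1)] by simp
        have kills_all: "E (slot w x) = 0" if "x \<in> (SIGMA h : S. A h)" for x
          using kills[OF that] Eh0 slot_h0 by (cases "x = (h0, T h0)") auto
        have kill_peval: "E (peval of_rat (slot w) p) = 0" if "p \<in> poly_over (SIGMA h : S. A h)" for p
          by (rule der_peval_0[OF E(1)]) (use kills_all that in \<open>auto simp: poly_over_def\<close>)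
        have "E (mn h \<alpha>) = 0" if h: "h \<in> I" and \<alpha>: "\<alpha> \<in> A h" for h \<alpha>
        proof (cases "\<alpha> = T h")
          case True
          then show ?thesis using mn[of h] h less.prems(1) der_1[OF E(1)] by auto
        next
          case False
          have hS: "h \<in> S - J" using h less.prems by blast
          obtain D where D: "is_der D" "D (G (h, \<alpha>)) = 1"
            "\<forall>h'\<in>S. \<forall>\<beta>\<in>A h'. \<beta> \<noteq> T h' \<longrightarrow> (h', \<beta>) \<noteq> (h, \<alpha>) \<longrightarrow> D (G (h', \<beta>)) = 0"
            "\<forall>h'\<in>S. \<forall>\<beta>\<in>A h'. D (mn h' \<beta>) = 0" "\<forall>h'\<in>S \<inter> J. \<forall>\<beta>\<in>A h'. D (val (h', \<beta>)) = 0"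
            using dual[OF hS \<alpha> False] by blast
          \<comment> \<open>\<open>G (h, \<alpha>)\<close> enters twice: in its own slot and,
            through \<open>ep h\<close>, in the slot of \<open>T h\<close>. Applying
            \<open>D\<close> to the relation therefore expresses \<open>mn h \<alpha>\<close> as a
            quotient of values of two partial derivatives of \<open>Q\<close>, and \<open>E\<close>
            kills both.\<close>
          have Dep: "D (ep h') = (if h' = h then - mn h \<alpha> else 0)" if h': "h' \<in> S" for h'
          proof -
            have "D (ep h') = - (\<Sum>\<beta>\<in>A h' - {T h'}. D (G (h', \<beta>) * mn h' \<beta>))"
              by (simp add: ep_def der_uminus[OF D(1)] der_sum[OF D(1)])
            also have "(\<Sum>\<beta>\<in>A h' - {T h'}. D (G (h', \<beta>) * mn h' \<beta>))
              = (\<Sum>\<beta>\<in>A h' - {T h'}. if (h', \<beta>) = (h, \<alpha>) then mn h \<alpha> else 0)"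
              by (rule sum.cong) (use D h' in \<open>auto simp: der_mult[OF D(1)]\<close>)
            also have "\<dots> = (if h' = h then mn h \<alpha> else 0)"
              using fin(2)[OF h'] \<alpha> False by (auto simp: sum.delta)
            finally show ?thesis by simp
          qed
          have Dslot: "D (slot w x) = 0" if x: "x \<in> (SIGMA h : S. A h)" "x \<noteq> (h, \<alpha>)" "x \<noteq> (h, T h)" for x
          proof -
            obtain h' \<beta> where x_def: "x = (h', \<beta>)" by (cases x)
            have "D (w h') = 0" if hJ: "h' \<notin> J" "\<beta> = T h'"
            proof (cases "h' \<in> I")
              case True
              then show ?thesis using less.prems(3) Dep[of h'] x that x_def by auto
            next
              case hI: False
              then obtain r where "w h' = of_rat r" using less.prems(4)[of h'] x hJ x_def by auto
              then show ?thesis using der_of_rat[OF D(1)] by simp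
            qed
            then show ?thesis using D x by (auto simp: slot_def x_def)
          qed
          have s: "slot w (h, \<alpha>) = G (h, \<alpha>)" "slot w (h, T h) = ep h"
            using hS False less.prems(3)[OF h] by (auto simp: slot_def)
          have "D (peval of_rat (slot w) Q)
            = (\<Sum>x\<in>vars Q \<union> {(h, \<alpha>), (h, T h)}. peval of_rat (slot w) (pdiff x Q) * D (slot w x))"
            by (rule der_peval[OF D(1)]) auto
          also have "\<dots> = (\<Sum>x\<in>{(h, \<alpha>), (h, T h)}. peval of_rat (slot w) (pdiff x Q) * D (slot w x))"
            by (rule sum.mono_neutral_right) (use Dslot Qv in auto)
          also have "\<dots> = peval of_rat (slot w) (pdiff (h, \<alpha>) Q) - peval of_rat (slot w) (pdiff (h, T h) Q) * mn h \<alpha>"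
            using False D(2) Dep[of h] hS by (simp add: s)
          finally have "peval of_rat (slot w) (pdiff (h, \<alpha>) Q) = peval of_rat (slot w) (pdiff (h, T h) Q) * mn h \<alpha>"
            using less.prems(5) der_0[OF D(1)] by simp
          then have "E (peval of_rat (slot w) (pdiff (h, T h) Q) * mn h \<alpha>) = 0"
            using kill_peval[OF pdiff_poly_over[OF less.prems(2)], of "(h, \<alpha>)"] by simp
          then show ?thesis
            using kill_peval[OF pdiff_poly_over[OF less.prems(2)], of "(h, T h)"] nz[OF h]
            by (simp add: der_mult[OF E(1)])
        qed
        then show ?thesis using E(5) Eh0 by blast
      qed
    qed
  qed
qed

section \<open>Differential polynomials\<close>

lemma deriv_poly_superset: "finite X \<Longrightarrow> vars p \<subseteq> X \<Longrightarrow> deriv_poly p = (\<Sum>x\<in>X. pdiff x p * var (dnext x))"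
  unfolding deriv_poly_def by (rule sum.mono_neutral_left) (auto simp: pdiff_eq_0_iff[THEN iffD2])

lemma deriv_poly_add: "deriv_poly (p + q) = deriv_poly p + deriv_poly q"
proof -
  let ?X = "vars p \<union> vars q"
  have "deriv_poly (p + q) = (\<Sum>x\<in>?X. pdiff x (p + q) * var (dnext x))"
    by (rule deriv_poly_superset) (use vars_add[of p q] in auto)
  also have "\<dots> = (\<Sum>x\<in>?X. pdiff x p * var (dnext x)) + (\<Sum>x\<in>?X. pdiff x q * var (dnext x))"
    by (simp add: pdiff_add distrib_right sum.distrib)
  finally show ?thesis by (simp add: deriv_poly_superset[of ?X])
qed

lemma deriv_poly_mult: "deriv_poly (p * q) = p * deriv_poly q + deriv_poly p * q"
proof -
  let ?X = "vars p \<union> vars q"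
  have "deriv_poly (p * q) = (\<Sum>x\<in>?X. pdiff x (p * q) * var (dnext x))"
    by (rule deriv_poly_superset) (use vars_mult[of p q] in auto)
  also have "\<dots> = p * (\<Sum>x\<in>?X. pdiff x q * var (dnext x)) + (\<Sum>x\<in>?X. pdiff x p * var (dnext x)) * q"
    by (simp add: pdiff_mult distrib_right sum.distrib sum_distrib_left sum_distrib_right algebra_simps)
  finally show ?thesis by (simp add: deriv_poly_superset[of ?X])
qed

lemma is_der_deriv_poly: "is_der deriv_poly"
  by (simp add: is_der_def deriv_poly_add deriv_poly_mult)

lemma deriv_poly_cst [simp]: "deriv_poly (cst c) = 0"
  by (simp add: deriv_poly_def)

lemma deriv_poly_0 [simp]: "deriv_poly 0 = 0"
  by (rule der_0[OF is_der_deriv_poly])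

lemma deriv_poly_var: "deriv_poly (var x) = var (dnext x)"
  by (simp add: deriv_poly_def pdiff_var)

lemma vars_deriv_poly: "vars (deriv_poly p) \<subseteq> vars p \<union> dnext ` vars p"
proof -
  have "vars (deriv_poly p) \<subseteq> (\<Union>x\<in>vars p. vars (pdiff x p * var (dnext x)))"
    unfolding deriv_poly_def by (rule vars_sum)
  also have "\<dots> \<subseteq> vars p \<union> dnext ` vars p"
  proof (rule UN_least)
    fix x assume "x \<in> vars p"
    then show "vars (pdiff x p * var (dnext x)) \<subseteq> vars p \<union> dnext ` vars p"
      using vars_mult[of "pdiff x p" "var (dnext x)"] vars_pdiff[of x p] by auto
  qed
  finally show ?thesis .
qed

lemma deriv_poly_closed: "p \<in> poly_over (B \<times> UNIV) \<Longrightarrow> deriv_poly p \<in> poly_over (B \<times> UNIV)"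
  using vars_deriv_poly[of p] by (force simp: poly_over_def)

section \<open>The derivation on Laurent polynomials and Leibniz's rule\<close>

definition mono_deriv :: "('b \<times> nat \<Rightarrow>\<^sub>0 int) \<Rightarrow> ('b \<times> nat, 'r::comm_ring_1) lpoly"
  where "mono_deriv m = (\<Sum>v\<in>keys m. single (m - single v 1 + single (dnext v) 1) (of_int (lookup m v)))"

text \<open>Regroups the definition by monomials, separating the derivative of the coefficient from
  that of the monomial; the freedom in \<open>M\<close> lets two polynomials share one index
  set.\<close>

lemma deriv_laurent_alt:
  assumes M: "finite M" "keys f \<subseteq> M"
  shows "deriv_laurent f = (\<Sum>m\<in>M. single m (deriv_poly (lookup f m)) + single 0 (lookup f m) * mono_deriv m)"
proof -
  let ?V = "\<Union>m\<in>keys f. keys m"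
  have "(\<Sum>v\<in>lvars f. lpdiff v f * single (single (dnext v) 1) 1)
    = (\<Sum>v\<in>?V. \<Sum>m\<in>keys f. single (m - single v 1 + single (dnext v) 1) (of_int (lookup m v) * lookup f m))"
    by (simp add: lvars_def lpdiff_def sum_distrib_right mult_single)
  also have "\<dots> = (\<Sum>m\<in>keys f. \<Sum>v\<in>?V. single (m - single v 1 + single (dnext v) 1) (of_int (lookup m v) * lookup f m))"
    by (rule sum.swap)
  also have "\<dots> = (\<Sum>m\<in>keys f. single 0 (lookup f m) * mono_deriv m)"
  proof (rule sum.cong)
    fix m assume m: "m \<in> keys f"
    have "(\<Sum>v\<in>?V. single (m - single v 1 + single (dnext v) 1) (of_int (lookup m v) * lookup f m))
      = (\<Sum>v\<in>keys m. single (m - single v 1 + single (dnext v) 1) (of_int (lookup m v) * lookup f m))"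
      by (rule sum.mono_neutral_right) (use m in \<open>auto simp: in_keys_iff\<close>)
    then show "(\<Sum>v\<in>?V. single (m - single v 1 + single (dnext v) 1) (of_int (lookup m v) * lookup f m))
      = single 0 (lookup f m) * mono_deriv m"
      by (simp add: mono_deriv_def sum_distrib_left mult_single mult.commute)
  qed simp
  finally have "deriv_laurent f = (\<Sum>m\<in>keys f. single m (deriv_poly (lookup f m)) + single 0 (lookup f m) * mono_deriv m)"
    by (simp add: deriv_laurent_def sum.distrib)
  also have "\<dots> = (\<Sum>m\<in>M. single m (deriv_poly (lookup f m)) + single 0 (lookup f m) * mono_deriv m)"
    by (rule sum.mono_neutral_left) (use M in \<open>auto simp: in_keys_iff\<close>)
  finally show ?thesis .
qed

lemma deriv_laurent_add: "deriv_laurent (f + g) = deriv_laurent f + deriv_laurent g"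
proof -
  let ?M = "keys f \<union> keys g"
  have "deriv_laurent (f + g) = (\<Sum>m\<in>?M. single m (deriv_poly (lookup (f + g) m)) + single 0 (lookup (f + g) m) * mono_deriv m)"
    by (rule deriv_laurent_alt) (use keys_add[of f g] in auto)
  also have "\<dots> = deriv_laurent f + deriv_laurent g"
    by (simp add: deriv_laurent_alt[of ?M] lookup_add deriv_poly_add single_add distrib_right sum.distrib add_ac)
  finally show ?thesis .
qed

lemma deriv_laurent_single: "deriv_laurent (single m c) = single m (deriv_poly c) + single 0 c * mono_deriv m"
  by (subst deriv_laurent_alt[of "{m}"]) auto

lemma deriv_laurent_0 [simp]: "deriv_laurent 0 = 0"
  by (simp add: deriv_laurent_def lvars_def)

lemma deriv_laurent_sum: "deriv_laurent (sum f A) = (\<Sum>x\<in>A. deriv_laurent (f x))"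
  by (induct A rule: infinite_finite_induct) (auto simp: deriv_laurent_add)

lemma mono_deriv_superset: "finite V \<Longrightarrow> keys m \<subseteq> V \<Longrightarrow>
    mono_deriv m = (\<Sum>v\<in>V. single (m - single v 1 + single (dnext v) 1) (of_int (lookup m v)))"
  unfolding mono_deriv_def by (rule sum.mono_neutral_left) (auto simp: in_keys_iff)

lemma mono_deriv_add: "mono_deriv (m + n) = single m 1 * mono_deriv n + mono_deriv m * (single n 1 :: ('b \<times> nat, 'r::comm_ring_1) lpoly)"
proof -
  let ?V = "keys m \<union> keys n"
  have "mono_deriv (m + n) = (\<Sum>v\<in>?V. single (m + n - single v 1 + single (dnext v) 1) (of_int (lookup (m + n) v) :: 'r))"
    by (rule mono_deriv_superset) (use keys_add[of m n] in auto)
  also have "\<dots> = single m 1 * mono_deriv n + mono_deriv m * single n 1"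
    by (simp add: mono_deriv_superset[of ?V] lookup_add single_add sum.distrib sum_distrib_left sum_distrib_right mult_single
      algebra_simps)
  finally show ?thesis .
qed

lemma deriv_laurent_mult_single:
  "deriv_laurent (single m c * single n d) = single m c * deriv_laurent (single n d) + deriv_laurent (single m c) * single n d"
proof -
  have s: "single 0 (c * d) = single 0 c * (single 0 d :: ('a, 'b) dlpoly)" by (simp add: mult_single)
  have c: "single m c = single 0 c * (single m 1 :: ('a, 'b) dlpoly)" "single n d = single 0 d * (single n 1 :: ('a, 'b) dlpoly)"
    by (simp_all add: mult_single)
  have "single (m + n) (deriv_poly (c * d)) = single m c * single n (deriv_poly d) + single m (deriv_poly c) * single n d"
    by (simp add: mult_single deriv_poly_mult single_add)
  moreover have "single 0 (c * d) * mono_deriv (m + n) = single m c * (single 0 d * mono_deriv n) + (single 0 c * mono_deriv m) * single n d"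
    unfolding s mono_deriv_add c by (simp only: algebra_simps)
  ultimately show ?thesis
    by (simp add: mult_single deriv_laurent_single distrib_left distrib_right add_ac)
qed

lemma deriv_laurent_mult: "deriv_laurent (f * g) = f * deriv_laurent g + deriv_laurent f * g"
proof -
  have "f * g = (\<Sum>m\<in>keys f. \<Sum>n\<in>keys g. single m (lookup f m) * single n (lookup g n))"
    by (subst poly_mapping_sum_single[of f], subst poly_mapping_sum_single[of g]) (rule sum_product)
  then have "deriv_laurent (f * g) = (\<Sum>m\<in>keys f. \<Sum>n\<in>keys g. single m (lookup f m) * deriv_laurent (single n (lookup g n)))
      + (\<Sum>m\<in>keys f. \<Sum>n\<in>keys g. deriv_laurent (single m (lookup f m)) * single n (lookup g n))"
    by (simp add: deriv_laurent_sum deriv_laurent_mult_single sum.distrib)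
  also have "\<dots> = (\<Sum>m\<in>keys f. single m (lookup f m)) * deriv_laurent (\<Sum>n\<in>keys g. single n (lookup g n))
      + deriv_laurent (\<Sum>m\<in>keys f. single m (lookup f m)) * (\<Sum>n\<in>keys g. single n (lookup g n))"
    by (simp only: deriv_laurent_sum sum_product)
  finally show ?thesis
    by (simp only: poly_mapping_sum_single[symmetric])
qed

lemma is_der_deriv_laurent: "is_der deriv_laurent"
  by (simp add: is_der_def deriv_laurent_add deriv_laurent_mult)

lemma deriv_laurent_cst: "deriv_laurent (cst p) = cst (deriv_poly p)"
  by (simp add: cst_def deriv_laurent_single mono_deriv_def)

lemma deriv_laurent_iter_cst: "(deriv_laurent ^^ k) (cst p) = cst ((deriv_poly ^^ k) p)"
  by (induct k) (auto simp: deriv_laurent_cst)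

lemma deriv_poly_iter_var: "(deriv_poly ^^ k) (var (b, m)) = var (b, m + k)"
  by (induct k) (auto simp: deriv_poly_var)

lemma der_iter_add: "is_der D \<Longrightarrow> (D ^^ k) (a + b) = (D ^^ k) a + (D ^^ k) b"
  by (induct k) (auto simp: der_add)

lemma der_iter_0: "is_der D \<Longrightarrow> (D ^^ k) 0 = 0"
  by (induct k) (auto simp: der_0)

lemma der_iter_sum: "is_der D \<Longrightarrow> (D ^^ k) (sum f A) = (\<Sum>x\<in>A. (D ^^ k) (f x))"
  by (induct A rule: infinite_finite_induct) (auto simp: der_iter_add der_iter_0)

lemma der_iter_mult:
  assumes D: "is_der D"
  shows "(D ^^ k) (a * b) = (\<Sum>j\<le>k. of_nat (k choose j) * (D ^^ j) a * (D ^^ (k - j)) b)"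
proof (induct k)
  case (Suc k)
  have t: "D (of_nat n * x * y) = of_nat n * x * D y + of_nat n * D x * y" for n x y
    by (simp add: der_mult[OF D] der_of_nat[OF D] algebra_simps)
  have "(D ^^ Suc k) (a * b) = (\<Sum>j\<le>k. of_nat (k choose j) * (D ^^ j) a * (D ^^ Suc (k - j)) b)
      + (\<Sum>j\<le>k. of_nat (k choose j) * (D ^^ Suc j) a * (D ^^ (k - j)) b)"
    by (simp add: Suc der_sum[OF D] t sum.distrib)
  \<comment> \<open>The additional term at \<open>j = Suc k\<close> has binomial coefficient
    zero.\<close>
  also have "(\<Sum>j\<le>k. of_nat (k choose j) * (D ^^ j) a * (D ^^ Suc (k - j)) b)
    = (\<Sum>j\<le>Suc k. of_nat (k choose j) * (D ^^ j) a * (D ^^ (Suc k - j)) b)"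
    by (auto simp: Suc_diff_le binomial_eq_0 intro: sum.cong)
  also have "\<dots> = a * (D ^^ Suc k) b + (\<Sum>j\<le>k. of_nat (k choose Suc j) * (D ^^ Suc j) a * (D ^^ (k - j)) b)"
    by (subst sum.atMost_Suc_shift) simp
  also have "\<dots> + (\<Sum>j\<le>k. of_nat (k choose j) * (D ^^ Suc j) a * (D ^^ (k - j)) b)
    = a * (D ^^ Suc k) b + (\<Sum>j\<le>k. of_nat (Suc k choose Suc j) * (D ^^ Suc j) a * (D ^^ (k - j)) b)"
    by (simp add: sum.distrib[symmetric] distrib_right add_ac)
  also have "\<dots> = (\<Sum>j\<le>Suc k. of_nat (Suc k choose j) * (D ^^ j) a * (D ^^ (Suc k - j)) b)"
    by (subst sum.atMost_Suc_shift) simp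
  finally show ?case .
qed simp

section \<open>Evaluation of Laurent polynomials\<close>

definition lmon :: "('v \<Rightarrow> 'f::field) \<Rightarrow> ('v \<Rightarrow>\<^sub>0 int) \<Rightarrow> 'f"
  where "lmon u m = (\<Prod>v\<in>keys m. u v powi lookup m v)"

definition leval :: "('v \<Rightarrow> 'f::field) \<Rightarrow> ('r \<Rightarrow> 'f) \<Rightarrow> ('v, 'r::zero) lpoly \<Rightarrow> 'f"
  where "leval u \<phi> f = (\<Sum>m\<in>keys f. \<phi> (lookup f m) * lmon u m)"

lemma lmon_superset:
  assumes "finite X" "keys m \<subseteq> X"
  shows "lmon u m = (\<Prod>v\<in>X. u v powi lookup m v)"
  unfolding lmon_def
  by (rule prod.mono_neutral_left) (use assms in \<open>auto simp: in_keys_iff\<close>)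

lemma lmon_0 [simp]: "lmon u 0 = 1"
  by (simp add: lmon_def)

lemma lmon_add:
  assumes u: "\<And>v. u v \<noteq> 0"
  shows "lmon u (m + n) = lmon u m * lmon u n"
proof -
  let ?X = "keys m \<union> keys n"
  have "lmon u (m + n) = (\<Prod>v\<in>?X. u v powi lookup (m + n) v)"
    by (rule lmon_superset) (use keys_add[of m n] in auto)
  also have "\<dots> = (\<Prod>v\<in>?X. u v powi lookup m v) * (\<Prod>v\<in>?X. u v powi lookup n v)"
    using u by (simp add: lookup_add power_int_add prod.distrib)
  finally show ?thesis by (simp add: lmon_superset[of ?X])
qed

lemma lmon_neq_0: "(\<And>v. u v \<noteq> 0) \<Longrightarrow> lmon u m \<noteq> 0"
  by (simp add: lmon_def)

lemma lmon_uminus: "(\<And>v. u v \<noteq> 0) \<Longrightarrow> lmon u (- m) = inverse (lmon u m)"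
  using lmon_add[of u m "- m"] lmon_neq_0[of u m] by (simp add: inverse_eq_divide nonzero_eq_divide_eq mult.commute)

lemma lmon_diff: "(\<And>v. u v \<noteq> 0) \<Longrightarrow> lmon u (m - n) = lmon u m / lmon u n"
  using lmon_add[of u m "- n"] lmon_uminus[of u n] by (simp add: divide_inverse)

lemma leval_superset:
  assumes "rhom \<phi>" "finite M" "keys f \<subseteq> M"
  shows "leval u \<phi> f = (\<Sum>m\<in>M. \<phi> (lookup f m) * lmon u m)"
  unfolding leval_def
  by (rule sum.mono_neutral_left) (use assms rhom_0[OF assms(1)] in \<open>auto simp: in_keys_iff\<close>)

lemma leval_add:
  assumes "rhom \<phi>"
  shows "leval u \<phi> (f + g) = leval u \<phi> f + leval u \<phi> g"
proof -
  let ?M = "keys f \<union> keys g"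
  have "leval u \<phi> (f + g) = (\<Sum>m\<in>?M. \<phi> (lookup (f + g) m) * lmon u m)"
    by (rule leval_superset[OF assms]) (use keys_add[of f g] in auto)
  also have "\<dots> = (\<Sum>m\<in>?M. \<phi> (lookup f m) * lmon u m) + (\<Sum>m\<in>?M. \<phi> (lookup g m) * lmon u m)"
    by (simp add: lookup_add rhom_add[OF assms] distrib_right sum.distrib)
  finally show ?thesis by (simp add: leval_superset[OF assms, of ?M])
qed

lemma leval_0 [simp]: "leval u \<phi> 0 = 0"
  by (simp add: leval_def)

lemma leval_single: "rhom \<phi> \<Longrightarrow> leval u \<phi> (single m c) = \<phi> c * lmon u m"
  by (cases "c = 0") (auto simp: leval_def rhom_0)

lemma leval_cst: "rhom \<phi> \<Longrightarrow> leval u \<phi> (cst c) = \<phi> c"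
  by (simp add: cst_def leval_single)

lemma leval_sum: "rhom \<phi> \<Longrightarrow> leval u \<phi> (sum f A) = (\<Sum>x\<in>A. leval u \<phi> (f x))"
  by (induct A rule: infinite_finite_induct) (auto simp: leval_add)

lemma leval_mult:
  fixes \<phi> :: "'r::comm_ring_1 \<Rightarrow> 'f::field"
  assumes h: "rhom \<phi>" and u: "\<And>v. u v \<noteq> 0"
  shows "leval u \<phi> (f * g) = leval u \<phi> f * leval u \<phi> g"
proof -
  have "f * g = (\<Sum>m\<in>keys f. \<Sum>n\<in>keys g. single m (lookup f m) * single n (lookup g n))"
    by (subst poly_mapping_sum_single[of f], subst poly_mapping_sum_single[of g]) (rule sum_product)
  then have "leval u \<phi> (f * g)
      = (\<Sum>m\<in>keys f. \<Sum>n\<in>keys g. (\<phi> (lookup f m) * lmon u m) * (\<phi> (lookup g n) * lmon u n))"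
    by (simp add: leval_sum[OF h] mult_single leval_single[OF h] rhom_mult[OF h] lmon_add[of u, OF u] mult_ac)
  then show ?thesis by (simp add: leval_def sum_product)
qed

lemma rhom_leval: "rhom \<phi> \<Longrightarrow> (\<And>v. u v \<noteq> 0) \<Longrightarrow> rhom (leval u \<phi>)"
  using leval_cst[of \<phi> u 1] by (intro rhomI) (auto simp: leval_add leval_mult rhom_1)

lemma leval_cong: "(\<And>m. m \<in> keys f \<Longrightarrow> \<phi> (lookup f m) = \<psi> (lookup f m)) \<Longrightarrow> leval u \<phi> f = leval u \<psi> f"
  by (simp add: leval_def)

text \<open>The power rule in logarithmic form. Negative exponents follow by differentiating the
  product of \<open>x powi k\<close> with the opposite power.\<close>

lemma der_powi:
  fixes x :: "'f::field"
  assumes D: "is_der D" and x: "x \<noteq> 0"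
  shows "D (x powi k) = of_int k * (x powi k) * (D x / x)"
proof -
  have n: "D (x ^ n) = of_nat n * x ^ n * (D x / x)" for n
  proof (induct n)
    case (Suc n)
    then show ?case using x by (simp add: der_mult[OF D] field_simps)
  qed (simp add: der_1[OF D])
  show ?thesis
  proof (cases "k \<ge> 0")
    case True
    then show ?thesis using n[of "nat k"] by (simp add: power_int_def)
  next
    case False
    define y where "y = x powi k"
    have "x ^ nat (- k) * y = 1"
      using x False by (simp add: y_def power_int_def power_inverse)
    then have "x ^ nat (- k) * D y + D (x ^ nat (- k)) * y = 0"
      using der_mult[OF D, of "x ^ nat (- k)" y] der_1[OF D] by simp
    then have "x ^ nat (- k) * D y = x ^ nat (- k) * (of_int k * y * (D x / x))"
      using False by (simp add: n algebra_simps eq_neg_iff_add_eq_0)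
    then have "D y = of_int k * y * (D x / x)" using x by (subst (asm) mult_left_cancel) simp_all
    then show ?thesis by (simp add: y_def)
  qed
qed

lemma der_lmon:
  fixes u :: "'v \<Rightarrow> 'f::field"
  assumes D: "is_der D" and u: "\<And>v. u v \<noteq> 0"
  shows "D (lmon u m) = lmon u m * (\<Sum>v\<in>keys m. of_int (lookup m v) * (D (u v) / u v))"
proof -
  have "D (\<Prod>v\<in>X. u v powi lookup m v)
      = (\<Prod>v\<in>X. u v powi lookup m v) * (\<Sum>v\<in>X. of_int (lookup m v) * (D (u v) / u v))" if "finite X" for X
    using that
  proof (induct X rule: finite_induct)
    case (insert v X)
    then show ?case
      by (simp add: der_mult[OF D] der_powi[OF D u] algebra_simps)
  qed (simp add: der_1[OF D])
  then show ?thesis by (simp add: lmon_def)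
qed

lemma der_lmon_0:
  fixes u :: "'v \<Rightarrow> 'f::field"
  assumes "is_der D" "\<And>v. u v \<noteq> 0" "\<And>v. v \<in> keys m \<Longrightarrow> D (u v) = 0"
  shows "D (lmon u m) = 0"
  using assms by (simp add: der_lmon)

text \<open>The derivations \<open>u\<^sub>v \<partial>/\<partial>u\<^sub>v\<close> have the monomials as eigenvectors with distinct systems of eigenvalues.\<close>

lemma lmon_independent:
  fixes u :: "'v \<Rightarrow> 'f::field_char_0"
  assumes u: "\<And>v. u v \<noteq> 0"
    and D: "\<And>v. is_der (D v)" "\<And>v. D v (u v) = 1" "\<And>v w. w \<noteq> v \<Longrightarrow> D v (u w) = 0"
  shows "finite M \<Longrightarrow> (\<And>m v. m \<in> M \<Longrightarrow> D v (c m) = 0) \<Longrightarrow> (\<Sum>m\<in>M. c m * lmon u m) = 0 \<Longrightarrow> m \<in> M \<Longrightarrow> c m = 0"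
proof (induct "card M" arbitrary: M c m rule: less_induct)
  case (less M c m1)
  show ?case
  proof (cases "M = {m1}")
    case True
    then show ?thesis using less.prems(3) lmon_neq_0[of u m1, OF u] by simp
  next
    case False
    \<comment> \<open>Subtracting \<open>lookup m0 v\<close> times the relation from its image under
      \<open>u v * D v\<close> removes \<open>m0\<close> and multiplies the coefficient of
      \<open>m1\<close> by a nonzero integer.\<close>
    then obtain m0 where m0: "m0 \<in> M" "m0 \<noteq> m1" using less.prems(4) by blast
    then obtain v where v: "lookup m1 v \<noteq> lookup m0 v"
      by (metis poly_mapping_eqI)
    have Dl: "D v (lmon u m) = lmon u m * (of_int (lookup m v) / u v)" for m
    proof -
      have "(\<Sum>w\<in>keys m. of_int (lookup m w) * (D v (u w) / u w)) = (\<Sum>w\<in>keys m. if w = v then of_int (lookup m v) / u v else 0)"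
        by (rule sum.cong) (use D in auto)
      also have "\<dots> = of_int (lookup m v) / u v"
        by (auto simp: in_keys_iff)
      finally show ?thesis by (simp add: der_lmon[OF D(1) u])
    qed
    have "0 = D v (\<Sum>m\<in>M. c m * lmon u m)"
      using less.prems(3) der_0[OF D(1)] by simp
    also have "\<dots> = (\<Sum>m\<in>M. c m * lmon u m * of_int (lookup m v)) / u v"
      unfolding der_sum[OF D(1)] sum_divide_distrib
      by (rule sum.cong) (use less.prems(2) in \<open>simp_all add: der_mult[OF D(1)] Dl\<close>)
    finally have "(\<Sum>m\<in>M. c m * lmon u m * of_int (lookup m v)) = 0"
      using u by simp
    moreover have "(\<Sum>m\<in>M. c m * lmon u m * of_int (lookup m0 v)) = 0"
      using less.prems(3) by (simp flip: sum_distrib_right)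
    ultimately have "(\<Sum>m\<in>M. of_int (lookup m v - lookup m0 v) * c m * lmon u m) = 0"
      by (simp add: algebra_simps sum_subtractf)
    then have s: "(\<Sum>m\<in>M - {m0}. of_int (lookup m v - lookup m0 v) * c m * lmon u m) = 0"
      using m0 less.prems(1) by (simp add: sum.remove[of M m0])
    have "of_int (lookup m1 v - lookup m0 v) * c m1 = 0"
    proof (rule less.hyps[OF _ _ _ s])
      show "card (M - {m0}) < card M" using less.prems(1) m0(1) by (rule card_Diff1_less)
      show "D w (of_int (lookup m v - lookup m0 v) * c m) = 0" if "m \<in> M - {m0}" for m w
        using less.prems(2)[of m w] that by (simp add: der_mult[OF D(1)] der_of_int[OF D(1)] del: of_int_diff)
    qed (use less.prems m0 in auto)
    then show ?thesis using v by simp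
  qed
qed

section \<open>Subrings and ideals as plain sets; rings of Laurent polynomials\<close>

lemma ring_on_simps [simp]:
  "carrier (ring_on A) = A" "x \<otimes>\<^bsub>ring_on A\<^esub> y = x * y" "x \<oplus>\<^bsub>ring_on A\<^esub> y = x + y"
  "\<one>\<^bsub>ring_on A\<^esub> = 1" "\<zero>\<^bsub>ring_on A\<^esub> = 0"
  by (simp_all add: ring_on_def)

definition subring_set :: "'a::comm_ring_1 set \<Rightarrow> bool"
  where "subring_set A \<longleftrightarrow> 1 \<in> A \<and> (\<forall>a\<in>A. \<forall>b\<in>A. a + b \<in> A \<and> a * b \<in> A) \<and> (\<forall>a\<in>A. - a \<in> A)"

lemma subring_setD:
  assumes "subring_set A"
  shows "1 \<in> A" "0 \<in> A" "a \<in> A \<Longrightarrow> b \<in> A \<Longrightarrow> a + b \<in> A" "a \<in> A \<Longrightarrow> b \<in> A \<Longrightarrow> a * b \<in> A"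
    "a \<in> A \<Longrightarrow> - a \<in> A" "a \<in> A \<Longrightarrow> b \<in> A \<Longrightarrow> a - b \<in> A"
proof -
  have "1 + - 1 \<in> A" using assms unfolding subring_set_def by blast
  then show "0 \<in> A" by simp
  have "a + - b \<in> A" if "a \<in> A" "b \<in> A" using assms that unfolding subring_set_def by blast
  then show "a \<in> A \<Longrightarrow> b \<in> A \<Longrightarrow> a - b \<in> A" by simp
qed (use assms in \<open>auto simp: subring_set_def\<close>)

lemma cring_ring_on:
  assumes "subring_set A"
  shows "cring (ring_on A)"
proof (rule cringI)
  note S = subring_setD[OF assms]
  show "abelian_group (ring_on A)"
  proof (rule abelian_groupI)
    fix x assume "x \<in> carrier (ring_on A)"
    then show "\<exists>y\<in>carrier (ring_on A). y \<oplus>\<^bsub>ring_on A\<^esub> x = \<zero>\<^bsub>ring_on A\<^esub>"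
      using S(5) by (auto intro!: bexI[of _ "- x"])
  qed (use S in \<open>auto simp: add_ac\<close>)
  show "comm_monoid (ring_on A)"
    by (rule comm_monoidI) (use S in \<open>auto simp: mult_ac\<close>)
qed (simp add: distrib_right)

lemma ideal_ring_on_iff:
  assumes A: "subring_set A"
  shows "ideal I (ring_on A) \<longleftrightarrow> I \<subseteq> A \<and> 0 \<in> I \<and> (\<forall>a\<in>I. \<forall>b\<in>I. a + b \<in> I) \<and> (\<forall>a\<in>I. \<forall>x\<in>A. a * x \<in> I)"
    (is "_ = ?R")
proof
  interpret cring "ring_on A" by (rule cring_ring_on[OF A])
  note S = subring_setD[OF A]
  show ?R if I: "ideal I (ring_on A)"
  proof -
    interpret ideal I "ring_on A" by (rule I)
    show ?thesis
      using a_subset additive_subgroup.zero_closed[OF additive_subgroup_axioms] I_r_closed a_closed by auto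
  qed
  show "ideal I (ring_on A)" if ?R
  proof (rule idealI)
    show "subgroup I (add_monoid (ring_on A))"
    proof (rule add.subgroupI)
      fix a assume a: "a \<in> I"
      have "a * - 1 \<in> I" using that a S by blast
      moreover have "\<ominus>\<^bsub>ring_on A\<^esub> a = - a"
        by (rule minus_equality) (use that a S in auto)
      ultimately show "\<ominus>\<^bsub>ring_on A\<^esub> a \<in> I" by simp
    qed (use that in auto)
  qed (use that ring_axioms in \<open>auto simp: mult.commute\<close>)
qed

lemma subring_set_poly_over: "subring_set (poly_over X)"
  by (auto simp: subring_set_def poly_over_add poly_over_mult poly_over_uminus)

lemma laurent_over_iff: "0 \<in> A \<Longrightarrow> f \<in> laurent_over A V \<longleftrightarrow> (\<forall>m. lookup f m \<in> A) \<and> (\<forall>m\<in>keys f. keys m \<subseteq> V)"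
  by (auto simp: laurent_over_def lvars_def in_keys_iff)

lemma laurent_over_single: "c \<in> A \<Longrightarrow> keys m \<subseteq> V \<Longrightarrow> single m c \<in> laurent_over A V"
  by (auto simp: laurent_over_def lvars_def)

lemma laurent_over_add:
  assumes "subring_set A" "f \<in> laurent_over A V" "g \<in> laurent_over A V"
  shows "f + g \<in> laurent_over A V"
  using assms keys_add[of f g] subring_setD[OF assms(1)] by (auto simp: laurent_over_iff lookup_add) (metis UnE subsetD)

lemma laurent_over_uminus:
  assumes "subring_set A" "f \<in> laurent_over A V"
  shows "- f \<in> laurent_over A V"
  using assms subring_setD[OF assms(1)] by (auto simp: laurent_over_iff)

lemma laurent_over_0: "0 \<in> laurent_over A V"
  by (simp add: laurent_over_def lvars_def)

lemma laurent_over_sum: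
  assumes "subring_set A"
  shows "(\<And>x. x \<in> X \<Longrightarrow> f x \<in> laurent_over A V) \<Longrightarrow> sum f X \<in> laurent_over A V"
  by (induct X rule: infinite_finite_induct)
    (simp_all add: laurent_over_add[OF assms] laurent_over_0)

lemma laurent_over_mult:
  fixes f g :: "('v, 'r::comm_ring_1) lpoly"
  assumes "subring_set A" "f \<in> laurent_over A V" "g \<in> laurent_over A V"
  shows "f * g \<in> laurent_over A V"
proof -
  have "f * g = (\<Sum>m\<in>keys f. \<Sum>n\<in>keys g. single m (lookup f m) * single n (lookup g n))"
    by (subst poly_mapping_sum_single[of f], subst poly_mapping_sum_single[of g]) (rule sum_product)
  also have "\<dots> \<in> laurent_over A V"
  proof (intro laurent_over_sum[OF assms(1)])
    fix m n assume m: "m \<in> keys f" "n \<in> keys g"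
    have "keys m \<subseteq> V" "keys n \<subseteq> V"
      using m assms by (auto simp: laurent_over_def lvars_def)
    then have "keys (m + n) \<subseteq> V"
      using keys_add[of m n] by blast
    moreover have "lookup f m * lookup g n \<in> A"
      using assms subring_setD[OF assms(1)] by (auto simp: laurent_over_iff)
    ultimately show "single m (lookup f m) * single n (lookup g n) \<in> laurent_over A V"
      by (simp add: mult_single laurent_over_single)
  qed
  finally show ?thesis .
qed

lemma subring_set_laurent_over: "subring_set A \<Longrightarrow> subring_set (laurent_over A V :: ('v, 'r::comm_ring_1) lpoly set)"
  unfolding subring_set_def[of "laurent_over A V"]
  using laurent_over_single[of 1 A 0 V] subring_setD(1)[of A]
  by (auto intro: laurent_over_add laurent_over_mult laurent_over_uminus)

lemma subring_set_of_int:
  assumes "subring_set A"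
  shows "of_int k \<in> A"
proof -
  have "of_nat n \<in> A" for n
    by (induct n) (use subring_setD[OF assms] in auto)
  then show ?thesis
    using subring_setD[OF assms] by (cases k) (auto simp del: of_nat_Suc)
qed

lemma deriv_laurent_closed:
  fixes f :: "('b, 'a) dlpoly"
  assumes f: "f \<in> laurent_over (poly_over (B \<times> UNIV)) (V \<times> UNIV)"
  shows "deriv_laurent f \<in> laurent_over (poly_over (B \<times> UNIV)) (V \<times> UNIV)"
proof -
  let ?A = "poly_over (B \<times> UNIV) :: ('a \<times> nat) qpoly set" and ?L = "laurent_over (poly_over (B \<times> UNIV)) (V \<times> UNIV) :: ('b, 'a) dlpoly set"
  note S = subring_set_poly_over[of "B \<times> UNIV"]
  have "deriv_laurent f = (\<Sum>m\<in>keys f. single m (deriv_poly (lookup f m)) + single 0 (lookup f m) * mono_deriv m)"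
    by (rule deriv_laurent_alt) auto
  also have "\<dots> \<in> ?L"
  proof (intro laurent_over_sum[OF S] laurent_over_add[OF S])
    fix m assume m: "m \<in> keys f"
    have km: "keys m \<subseteq> V \<times> UNIV" and cm: "lookup f m \<in> ?A"
      using f m by (auto simp: laurent_over_def lvars_def)
    show "single m (deriv_poly (lookup f m)) \<in> ?L"
      using km deriv_poly_closed[OF cm] by (rule laurent_over_single[rotated])
    have "mono_deriv m \<in> ?L"
      unfolding mono_deriv_def
    proof (intro laurent_over_sum[OF S] laurent_over_single)
      fix v assume v: "v \<in> keys m"
      show "of_int (lookup m v) \<in> ?A" by (rule subring_set_of_int[OF S])
      have "keys (m - single v 1 + single (dnext v) 1) \<subseteq> insert (dnext v) (keys m)"
        using v by (auto simp: in_keys_iff lookup_add lookup_minus lookup_single when_def split: if_splits)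
      then show "keys (m - single v 1 + single (dnext v) 1) \<subseteq> V \<times> UNIV"
        using km v by (cases v) auto
    qed
    then show "single 0 (lookup f m) * mono_deriv m \<in> ?L"
      by (intro laurent_over_mult[OF S] laurent_over_single) (use cm in auto)
  qed
  finally show ?thesis .
qed

section \<open>Laurent polynomials at independent values\<close>

lemma indep_mono: "indep S x \<Longrightarrow> S' \<subseteq> S \<Longrightarrow> indep S' x"
  using poly_over_mono unfolding indep_def by blast

lemma indep_reindex:
  assumes S: "indep (f ` S) x" and f: "inj f"
  shows "indep S (x \<circ> f)"
  unfolding indep_def
proof (intro ballI impI)
  fix p assume p: "p \<in> poly_over S" "peval of_rat (x \<circ> f) p = 0"
  let ?q = "peval cst (\<lambda>z. var (f z)) p"
  have "peval of_rat x ?q = 0"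
    using p(2) by (simp add: peval_hom[OF rhom_peval[OF rhom_of_rat]] peval_cst[OF rhom_of_rat] peval_var[OF rhom_of_rat] comp_def)
  moreover have "?q \<in> poly_over (f ` S)"
    by (rule peval_closed) (use p in \<open>auto simp: poly_over_add poly_over_mult poly_over_var poly_over_def[of S]\<close>)
  ultimately have "?q = 0" using S indepD by blast
  then have "peval cst (\<lambda>y. var (inv_into UNIV f y)) ?q = 0" by simp
  then show "p = 0"
    by (simp add: peval_hom[OF rhom_peval[OF rhom_cst]] peval_cst[OF rhom_cst] peval_var[OF rhom_cst] inv_f_f[OF f] peval_id)
qed

lemma indep_Inr_neq_0:
  assumes "indep S (case_sum a u)" "Inr v \<in> S"
  shows "u v \<noteq> 0"
proof
  assume "u v = 0"
  then have "peval of_rat (case_sum a u) (var (Inr v)) = 0" by (simp add: peval_var[OF rhom_of_rat])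
  then have "var (Inr v) = (0 :: ('a + 'b) qpoly)"
    using assms by (intro indepD[OF assms(1)]) (auto simp: poly_over_var)
  then show False using vars_var[of "Inr v :: 'a + 'b"] by simp
qed

text \<open>Derivations dual to the \<open>u\<close> kill the values of the coefficients, so
  \<open>lmon_independent\<close> makes each of these values zero; a coefficient with value zero at
  independent arguments is itself zero.\<close>

lemma leval_generic_eq_0:
  fixes a :: "'x \<Rightarrow> 'f::field_char_0" and u :: "'v \<Rightarrow> 'f"
  assumes ind: "indep (Inl ` X \<union> range Inr) (case_sum a u)"
    and f: "f \<in> laurent_over (poly_over X) V" "leval u (peval of_rat a) f = 0"
  shows "f = 0"
proof -
  have u: "u v \<noteq> 0" for v by (rule indep_Inr_neq_0[OF ind]) simp
  have nl: "lookup f m \<in> poly_over X" for m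
    using f(1) by (simp add: laurent_over_iff)
  have "\<exists>D. is_der D \<and> D (u v) = 1 \<and> (\<forall>w. w \<noteq> v \<longrightarrow> D (u w) = 0) \<and> (\<forall>x\<in>X. D (a x) = 0)" for v
  proof -
    obtain D where D: "is_der D"
      "\<forall>j\<in>Inl ` X \<union> range Inr. D (case_sum a u j) = (if j = Inr v then 1 else 0)"
      using indep_dual_derivation[OF ind, of "Inr v"] by blast
    have "D (u w) = (if w = v then 1 else 0)" for w
      using bspec[OF D(2), of "Inr w"] by simp
    moreover have "D (a x) = 0" if "x \<in> X" for x
      using bspec[OF D(2), of "Inl x"] that by simp
    ultimately show ?thesis using D(1) by (intro exI[of _ D]) simp
  qed
  then obtain D where D: "\<And>v. is_der (D v)" "\<And>v. D v (u v) = 1" "\<And>v w. w \<noteq> v \<Longrightarrow> D v (u w) = 0"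
    "\<And>v x. x \<in> X \<Longrightarrow> D v (a x) = 0"
    by metis
  have "lookup f m = 0" if m: "m \<in> keys f" for m
  proof -
    have "peval of_rat a (lookup f m) = 0"
    proof (rule lmon_independent[where D = D, OF u D(1,2,3) _ _ _ m])
      show "D v (peval of_rat a (lookup f n)) = 0" for n v
        by (rule der_peval_0[OF D(1)], rule D(4)) (use nl[of n] in \<open>auto simp: poly_over_def\<close>)
      show "(\<Sum>m\<in>keys f. peval of_rat a (lookup f m) * lmon u m) = 0" using f(2) by (simp add: leval_def)
    qed auto
    moreover have "indep X a"
      using indep_reindex[OF indep_mono[OF ind Un_upper1]] by (simp add: comp_def)
    ultimately show ?thesis using indepD nl by blast
  qed
  then show ?thesis
    by (metis in_keys_iff keys_eq_empty all_not_in_conv)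
qed

lemma rhom_cst_cst: "rhom (\<lambda>c::rat. cst (cst c) :: ('m::comm_monoid_add \<Rightarrow>\<^sub>0 ('n::comm_monoid_add \<Rightarrow>\<^sub>0 rat)))"
  by (intro rhom_comp[where f = cst and g = cst] rhom_cst)

text \<open>Congruences of variables pass to polynomials. Used for the differential ideal of the
  system and for \<open>ideal_S_tau\<close>, to replace distinguished coefficients by their solved
  forms.\<close>

lemma cst_minus_peval:
  assumes A: "\<And>q. q \<in> poly_over X \<Longrightarrow> cst q \<in> A" "\<And>x. x \<in> X \<Longrightarrow> \<sigma> x \<in> A"
    and I: "0 \<in> I" "\<And>f g. f \<in> I \<Longrightarrow> g \<in> I \<Longrightarrow> f + g \<in> I" "\<And>f x. f \<in> I \<Longrightarrow> x \<in> A \<Longrightarrow> f * x \<in> I"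
    and \<sigma>: "\<And>x. x \<in> X \<Longrightarrow> cst (var x) - \<sigma> x \<in> I"
  shows "p \<in> poly_over X \<Longrightarrow> cst p - peval (\<lambda>c. cst (cst c)) \<sigma> p \<in> (I :: ('v, 'x qpoly) lpoly set)"
proof (induct p rule: qpoly_induct)
  case (cst c)
  then show ?case using I(1) by (simp add: peval_cst[OF rhom_cst_cst])
next
  case (add p q)
  have "cst (p + q) - peval (\<lambda>c. cst (cst c)) \<sigma> (p + q)
      = (cst p - peval (\<lambda>c. cst (cst c)) \<sigma> p) + (cst q - peval (\<lambda>c. cst (cst c)) \<sigma> q)"
    by (simp add: peval_add[OF rhom_cst_cst] cst_add)
  then show ?case using add I(2) by metis
next
  case (mult_var p x)
  have "cst (p * var x) - peval (\<lambda>c. cst (cst c)) \<sigma> (p * var x)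
      = (cst (var x) - \<sigma> x) * cst p + (cst p - peval (\<lambda>c. cst (cst c)) \<sigma> p) * \<sigma> x"
    by (simp add: peval_mult[OF rhom_cst_cst] peval_var[OF rhom_cst_cst] cst_mult algebra_simps)
  then show ?case
    using mult_var I(2,3) A \<sigma> by metis
qed

lemma diff_ideal_least:
  "ideal I (ring_on A) \<Longrightarrow> (\<And>f. f \<in> I \<Longrightarrow> d f \<in> I) \<Longrightarrow> S \<subseteq> I \<Longrightarrow> f \<in> diff_ideal d A S \<Longrightarrow> f \<in> I"
  unfolding diff_ideal_def by blast

lemma diff_ideal_intros:
  assumes A: "subring_set A"
  shows "f \<in> S \<Longrightarrow> f \<in> diff_ideal d A S"
    and "f \<in> diff_ideal d A S \<Longrightarrow> d f \<in> diff_ideal d A S"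
    and "0 \<in> diff_ideal d A S"
    and "f \<in> diff_ideal d A S \<Longrightarrow> g \<in> diff_ideal d A S \<Longrightarrow> f + g \<in> diff_ideal d A S"
    and "f \<in> diff_ideal d A S \<Longrightarrow> x \<in> A \<Longrightarrow> f * x \<in> diff_ideal d A S"
  by (auto simp: diff_ideal_def ideal_ring_on_iff[OF A])

section \<open>The generic zero of the differential ideal\<close>

definition tail_poly :: "gsystem \<Rightarrow> nat \<Rightarrow> sys_poly"
  where "tail_poly P i = (\<Sum>s\<in>{1..num_terms P i}. single (monom_at P i s - monom_at P i 0) (var ((i, s), 0)))"

lemma gpoly_split: "gpoly P i = single (monom_at P i 0) 1 * (cst (var ((i, 0), 0)) + tail_poly P i)"
proof -
  have "{..num_terms P i} = insert 0 {1..num_terms P i}" by auto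
  then have "gpoly P i = single (monom_at P i 0) (var ((i, 0), 0)) + (\<Sum>s\<in>{1..num_terms P i}. single (monom_at P i s) (var ((i, s), 0)))"
    by (simp add: gpoly_def)
  then show ?thesis
    by (simp add: tail_poly_def cst_def distrib_left sum_distrib_left mult_single)
qed

text \<open>Modulo the differential ideal of the system, \<open>\<partial>\<^sup>k \<aa>\<^sub>i\<close> is \<open>- \<partial>\<^sup>k (tail_poly P i)\<close>.\<close>

definition solve :: "gsystem \<Rightarrow> (nat \<times> nat) \<times> nat \<Rightarrow> sys_poly"
  where "solve P = (\<lambda>((i, s), k). if s = 0 then - (deriv_laurent ^^ k) (tail_poly P i) else cst (var ((i, s), k)))"

definition non_leading :: "(nat \<times> nat) set"
  where "non_leading = {(i, s). s \<noteq> 0}"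

lemma subring_set_ring_DU: "subring_set (ring_DU P)"
  unfolding ring_DU_def ring_D_def by (intro subring_set_laurent_over subring_set_poly_over)

lemma deriv_ring_DU: "f \<in> ring_DU P \<Longrightarrow> deriv_laurent f \<in> ring_DU P"
  unfolding ring_DU_def ring_D_def by (rule deriv_laurent_closed)

lemma deriv_iter_ring_DU: "f \<in> ring_DU P \<Longrightarrow> (deriv_laurent ^^ k) f \<in> ring_DU P"
  by (induct k) (auto intro: deriv_ring_DU)

lemma deriv_iter_closed: "f \<in> laurent_over (poly_over (B \<times> UNIV)) (V \<times> UNIV) \<Longrightarrow>
    (deriv_laurent ^^ k) f \<in> laurent_over (poly_over (B \<times> UNIV)) (V \<times> UNIV)"
  by (induct k) (auto intro: deriv_laurent_closed)

lemma keys_monom_diff: "keys (m - n :: 'v \<Rightarrow>\<^sub>0 int) \<subseteq> keys m \<union> keys n"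
  by (auto simp: in_keys_iff lookup_minus)

locale gsys =
  fixes P :: gsystem
  assumes gen: "generic_system P"
begin

abbreviation "N \<equiv> {1..dim_n P}"

lemma monom_keys: "i \<in> N \<Longrightarrow> s \<le> num_terms P i \<Longrightarrow> keys (monom_at P i s) \<subseteq> {1..dim_n P - 1} \<times> UNIV"
  using gen unfolding generic_system_def by blast

lemma gpoly_ring_DU: "i \<in> N \<Longrightarrow> gpoly P i \<in> ring_DU P"
  unfolding gpoly_def ring_DU_def ring_D_def
  by (intro laurent_over_sum laurent_over_single subring_set_poly_over monom_keys)
    (auto simp: poly_over_var indets_A_def)

lemma tail_ring_DU: "i \<in> N \<Longrightarrow> tail_poly P i \<in> ring_DU P"
  unfolding tail_poly_def ring_DU_def ring_D_def
  by (intro laurent_over_sum laurent_over_single subring_set_poly_over order_trans[OF keys_monom_diff] Un_least monom_keys)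
    (auto simp: poly_over_var indets_A_def)

lemma tail_non_leading: "tail_poly P i \<in> laurent_over (poly_over (non_leading \<times> UNIV)) (UNIV \<times> UNIV)"
  unfolding tail_poly_def
  by (intro laurent_over_sum laurent_over_single subring_set_poly_over)
    (auto simp: poly_over_var non_leading_def)

lemma solve_non_leading: "solve P x \<in> laurent_over (poly_over (non_leading \<times> UNIV)) (UNIV \<times> UNIV)"
proof -
  obtain i s k where x: "x = ((i, s), k)" by (metis prod.exhaust)
  have "cst (var ((i, s), k)) \<in> laurent_over (poly_over (non_leading \<times> UNIV)) (UNIV \<times> UNIV)" if "s \<noteq> 0"
    unfolding cst_def by (rule laurent_over_single) (use that in \<open>auto simp: poly_over_var non_leading_def\<close>)
  then show ?thesis
    using deriv_iter_closed[OF tail_non_leading] by (auto simp: solve_def x intro: laurent_over_uminus subring_set_poly_over)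
qed

lemma cst_ring_DU: "p \<in> ring_D P \<Longrightarrow> cst p \<in> ring_DU P"
  unfolding cst_def ring_DU_def by (rule laurent_over_single) auto

lemma solve_ring_DU: "x \<in> indets_A P \<times> UNIV \<Longrightarrow> solve P x \<in> ring_DU P"
proof -
  assume x: "x \<in> indets_A P \<times> UNIV"
  then obtain i s k where x': "x = ((i, s), k)" "i \<in> N" by (auto simp: indets_A_def)
  have "var x \<in> ring_D P" using x unfolding ring_D_def poly_over_var .
  then show ?thesis
    using cst_ring_DU deriv_iter_ring_DU[OF tail_ring_DU[OF x'(2)]] subring_setD(5)[OF subring_set_ring_DU]
    by (auto simp: solve_def x'(1))
qed

definition sys_ideal :: "sys_poly set"
  where "sys_ideal = diff_ideal deriv_laurent (ring_DU P) (gpoly P ` N)"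

lemma sys_ideal_intros:
  "f \<in> gpoly P ` N \<Longrightarrow> f \<in> sys_ideal"
  "f \<in> sys_ideal \<Longrightarrow> deriv_laurent f \<in> sys_ideal"
  "0 \<in> sys_ideal"
  "f \<in> sys_ideal \<Longrightarrow> g \<in> sys_ideal \<Longrightarrow> f + g \<in> sys_ideal"
  "f \<in> sys_ideal \<Longrightarrow> x \<in> ring_DU P \<Longrightarrow> f * x \<in> sys_ideal"
  unfolding sys_ideal_def by (rule diff_ideal_intros[OF subring_set_ring_DU]; assumption)+

lemma sys_ideal_iter: "f \<in> sys_ideal \<Longrightarrow> (deriv_laurent ^^ k) f \<in> sys_ideal"
  by (induct k) (auto intro: sys_ideal_intros)

text \<open>Monomials are units, so the ideal contains the generic polynomial divided by its
  distinguished monomial, which is the distinguished coefficient plus \<open>tail_poly P i\<close>;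
  this is differentiated \<open>k\<close> times.\<close>

lemma cst_minus_solve:
  assumes x: "x \<in> indets_A P \<times> UNIV"
  shows "cst (var x) - solve P x \<in> sys_ideal"
proof -
  obtain i s k where x': "x = ((i, s), k)" "i \<in> N" using x by (auto simp: indets_A_def)
  show ?thesis
  proof (cases "s = 0")
    case False
    then show ?thesis using sys_ideal_intros(3) by (simp add: solve_def x')
  next
    case True
    have m: "single (- monom_at P i 0) 1 \<in> ring_DU P"
      unfolding ring_DU_def by (rule laurent_over_single) (use monom_keys[OF x'(2), of 0] in \<open>auto simp: ring_D_def\<close>)
    have "gpoly P i * single (- monom_at P i 0) 1 \<in> sys_ideal"
      by (rule sys_ideal_intros(5)[OF sys_ideal_intros(1) m]) (use x' in auto)
    also have "gpoly P i * single (- monom_at P i 0) 1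
        = (single (monom_at P i 0) 1 * single (- monom_at P i 0) 1) * (cst (var ((i, 0), 0)) + tail_poly P i)"
      unfolding gpoly_split by (simp only: mult_ac)
    also have "\<dots> = cst (var ((i, 0), 0)) + tail_poly P i"
      by (simp add: mult_single)
    finally have "(deriv_laurent ^^ k) (cst (var ((i, 0), 0)) + tail_poly P i) \<in> sys_ideal"
      by (rule sys_ideal_iter)
    then show ?thesis
      by (simp add: der_iter_add[OF is_der_deriv_laurent] deriv_laurent_iter_cst deriv_poly_iter_var solve_def x' True)
  qed
qed

abbreviation "psolve \<equiv> peval (\<lambda>c. cst (cst c)) (solve P)"

lemma psolve_non_leading: "psolve p \<in> laurent_over (poly_over (non_leading \<times> UNIV)) (UNIV \<times> UNIV)"
proof -
  have S: "subring_set (laurent_over (poly_over (non_leading \<times> (UNIV :: nat set))) (UNIV \<times> UNIV :: (nat \<times> nat) set))"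
    by (intro subring_set_laurent_over subring_set_poly_over)
  have "cst (cst c) \<in> laurent_over (poly_over (non_leading \<times> (UNIV :: nat set))) (UNIV \<times> UNIV :: (nat \<times> nat) set)" for c
    unfolding cst_def[of "cst c"] by (rule laurent_over_single) auto
  then show ?thesis
    by (rule peval_closed) (use subring_setD[OF S] solve_non_leading in auto)
qed

lemma cst_minus_psolve: "p \<in> ring_D P \<Longrightarrow> cst p - psolve p \<in> sys_ideal"
  unfolding ring_D_def
  by (rule cst_minus_peval[where A = "ring_DU P"])
    (use cst_ring_DU solve_ring_DU sys_ideal_intros cst_minus_solve in \<open>auto simp: ring_D_def\<close>)

end

locale generic_point = gsys +
  fixes a0 :: "(nat \<times> nat) \<times> nat \<Rightarrow> 'f::field_char_0" and u :: "nat \<times> nat \<Rightarrow> 'f"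
  assumes generic: "indep (Inl ` (non_leading \<times> UNIV) \<union> range Inr) (case_sum a0 u)"
begin

lemma u_neq_0: "u v \<noteq> 0"
  by (rule indep_Inr_neq_0[OF generic]) simp

definition pt :: "(nat \<times> nat) \<times> nat \<Rightarrow> 'f"
  where "pt x = leval u (peval of_rat a0) (solve P x)"

lemma rhom_ev: "rhom (peval (of_rat :: rat \<Rightarrow> 'f) g)"
  by (rule rhom_peval[OF rhom_of_rat])

lemma rhom_lev: "rhom (leval u (peval (of_rat :: rat \<Rightarrow> 'f) g))"
  by (rule rhom_leval[OF rhom_ev u_neq_0])

lemma peval_pt: "peval of_rat pt p = leval u (peval of_rat a0) (psolve p)"
  unfolding peval_hom[OF rhom_lev]
  by (rule arg_cong2[where f = "\<lambda>\<phi> g. peval \<phi> g p"]) (auto simp: pt_def leval_cst[OF rhom_ev] peval_cst[OF rhom_of_rat])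

lemma pt_non_leading: "x \<in> non_leading \<times> UNIV \<Longrightarrow> pt x = a0 x"
  by (auto simp: pt_def solve_def non_leading_def leval_cst[OF rhom_ev] peval_var[OF rhom_of_rat])

lemma leval_pt_non_leading:
  assumes "f \<in> laurent_over (poly_over (non_leading \<times> UNIV)) V"
  shows "leval u (peval of_rat pt) f = leval u (peval of_rat a0) f"
  by (rule leval_cong, rule peval_cong)
    (use assms in \<open>auto simp: laurent_over_def poly_over_def intro!: pt_non_leading\<close>)

text \<open>By Leibniz's rule it suffices that all derivatives of the factor other than the monomial
  vanish, and \<open>pt\<close> is defined to achieve this.\<close>

lemma leval_gpoly_pt: "leval u (peval of_rat pt) ((deriv_laurent ^^ k) (gpoly P i)) = 0"
proof -
  note D = is_der_deriv_laurent
  have 0: "leval u (peval of_rat pt) ((deriv_laurent ^^ k) (cst (var ((i, 0), 0)) + tail_poly P i)) = 0" for k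
  proof -
    have "leval u (peval of_rat pt) ((deriv_laurent ^^ k) (tail_poly P i)) = leval u (peval of_rat a0) ((deriv_laurent ^^ k) (tail_poly P i))"
      by (rule leval_pt_non_leading[OF deriv_iter_closed[OF tail_non_leading]])
    then show ?thesis
      by (simp add: der_iter_add[OF D] deriv_laurent_iter_cst deriv_poly_iter_var leval_add[OF rhom_ev] leval_cst[OF rhom_ev]
        peval_var[OF rhom_of_rat] pt_def solve_def rhom_uminus[OF rhom_lev])
  qed
  show ?thesis
    unfolding gpoly_split der_iter_mult[OF D] leval_sum[OF rhom_ev] leval_mult[OF rhom_ev u_neq_0] 0 by simp
qed

lemma sys_ideal_vanishes:
  assumes "\<And>i k. i \<in> N \<Longrightarrow> leval u (peval of_rat b) ((deriv_laurent ^^ k) (gpoly P i)) = 0" "cst p \<in> sys_ideal"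
  shows "peval of_rat b p = 0"
proof -
  let ?ev = "leval u (peval of_rat b)"
  \<comment> \<open>The derivatives are separate coordinates of the point, so evaluation does not
    commute with the derivation; asking that all derivatives of \<open>f\<close> vanish yields a
    differential ideal nevertheless.\<close>
  let ?I = "{f\<in>ring_DU P. \<forall>k. ?ev ((deriv_laurent ^^ k) f) = 0}"
  note D = is_der_deriv_laurent and S = subring_setD[OF subring_set_ring_DU]
  have "cst p \<in> ?I"
  proof (rule diff_ideal_least)
    show "ideal ?I (ring_on (ring_DU P))"
      unfolding ideal_ring_on_iff[OF subring_set_ring_DU]
      using S by (auto simp: der_iter_0[OF D] der_iter_add[OF D] der_iter_mult[OF D] leval_add[OF rhom_ev]
        leval_sum[OF rhom_ev] leval_mult[OF rhom_ev u_neq_0] simp del: funpow.simps)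
    show "deriv_laurent f \<in> ?I" if "f \<in> ?I" for f
    proof -
      have eq: "(deriv_laurent ^^ k) (deriv_laurent f) = (deriv_laurent ^^ Suc k) f" for k
        by (simp only: funpow_Suc_right comp_def)
      show ?thesis
        unfolding mem_Collect_eq eq using that deriv_ring_DU by blast
    qed
    show "gpoly P ` N \<subseteq> ?I" using gpoly_ring_DU assms(1) by auto
    show "cst p \<in> diff_ideal deriv_laurent (ring_DU P) (gpoly P ` N)" using assms(2) by (simp add: sys_ideal_def)
  qed
  then have "?ev ((deriv_laurent ^^ 0) (cst p)) = 0" by blast
  then show ?thesis by (simp add: leval_cst[OF rhom_ev])
qed

text \<open>\<open>pt\<close> is a generic zero: \<open>p\<close> is congruent to
  \<open>psolve p\<close>, which is zero as soon as its value at independent arguments is.\<close>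

lemma sys_ideal_iff:
  assumes p: "p \<in> ring_D P"
  shows "cst p \<in> sys_ideal \<longleftrightarrow> peval of_rat pt p = 0"
proof
  show "cst p \<in> sys_ideal \<Longrightarrow> peval of_rat pt p = 0"
    by (rule sys_ideal_vanishes[of pt]) (simp_all add: leval_gpoly_pt)
  assume "peval of_rat pt p = 0"
  then have "psolve p = 0"
    by (intro leval_generic_eq_0[OF generic psolve_non_leading]) (simp add: peval_pt)
  then show "cst p \<in> sys_ideal"
    using cst_minus_psolve[OF p] by simp
qed

end

section \<open>Reduction by the differential resultant\<close>

lemma domain_poly_over: "domain (ring_on (poly_over X :: 'x::countable qpoly set))"
proof (rule domainI)
  show "cring (ring_on (poly_over X :: 'x qpoly set))"
    by (rule cring_ring_on[OF subring_set_poly_over])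
qed (auto dest: qpoly_no_zero_divisors)

text \<open>Passes from the record structure to the type class; factors and inverses stay over
  \<open>X\<close> by \<open>dvd_poly_over\<close>.\<close>

lemma ring_irreducible_poly_over:
  fixes R :: "'x::countable qpoly"
  assumes R: "R \<in> poly_over X" "ring_irreducible\<^bsub>ring_on (poly_over X)\<^esub> R"
  shows "Factorial_Ring.irreducible R"
proof -
  interpret domain "ring_on (poly_over X :: 'x qpoly set)" by (rule domain_poly_over)
  have unit: "c \<in> Units (ring_on (poly_over X)) \<longleftrightarrow> c dvd 1" if "c \<in> poly_over X" for c :: "'x qpoly"
  proof
    show "c \<in> Units (ring_on (poly_over X)) \<Longrightarrow> c dvd 1" by (auto simp: Units_def) (metis dvd_triv_right)
    assume "c dvd 1"
    then obtain d where d: "1 = c * d" by (elim dvdE)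
    then have "d \<in> poly_over X" using dvd_poly_over(2)[of 1 c d X] by simp
    then show "c \<in> Units (ring_on (poly_over X))" using d that by (auto simp: Units_def mult.commute)
  qed
  have irr: "ring_irreducible\<^bsub>ring_on (poly_over X)\<^esub> R" "R \<in> carrier (ring_on (poly_over X))"
    using R by simp_all
  note E = ring_irreducibleE[OF irr(2,1)]
  show ?thesis
  proof (rule Factorial_Ring.irreducibleI)
    show "R \<noteq> 0" using E(1) by simp
    show "\<not> R dvd 1" using E(4) unit R by blast
    fix a b assume ab: "R = a * b"
    have "a \<in> poly_over X" "b \<in> poly_over X" using dvd_poly_over[OF ab R(1)] E(1) by simp_all
    then show "a dvd 1 \<or> b dvd 1"
      using E(5)[of a b] ab unit by auto
  qed
qed

lemma pdeg_pdiff: "x \<in> vars p \<Longrightarrow> pdeg x (pdiff x p) < pdeg x p"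
proof -
  assume x: "x \<in> vars p"
  then have "0 < pdeg x p" using pdeg_eq_0_iff[of x p] by blast
  moreover have "lookup m x < pdeg x p" if "m \<in> keys (pdiff x p)" for m
  proof -
    have "m + single x 1 \<in> keys p" using that by (auto simp: in_keys_iff lookup_pdiff)
    then have "lookup (m + single x 1) x \<le> pdeg x p"
      unfolding pdeg_def by (intro Max_ge) auto
    then show ?thesis by (simp add: lookup_add)
  qed
  ultimately show ?thesis by (simp add: pdeg_def[of x "pdiff x p"])
qed

lemma pdiff_commute_deriv: "pdiff (dnext x) (deriv_poly p) = pdiff x p + deriv_poly (pdiff (dnext x) p)"
proof -
  have "p \<in> poly_over UNIV" by (simp add: poly_over_def)
  then show ?thesis
  proof (induct p rule: qpoly_induct)
    case (mult_var p y)
    have inj: "dnext x = dnext y \<longleftrightarrow> x = y" by (cases x; cases y) auto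
    show ?case
      by (auto simp: deriv_poly_mult deriv_poly_add deriv_poly_var pdiff_add pdiff_mult_var mult_var inj algebra_simps)
  qed (simp_all add: deriv_poly_add pdiff_add)
qed

lemma dnext_iter: "(dnext ^^ k) (b, m) = (b, m + k)"
  by (induct k) auto

text \<open>By the commutator rule \<open>pdiff_commute_deriv\<close>, the partial derivative in the
  new top variable equals the preceding one, so the separant persists and the order rises by exactly
  one each time.\<close>

lemma leading_derivative:
  assumes "(b, s) \<in> vars R" "\<And>m. m > s \<Longrightarrow> (b, m) \<notin> vars R"
  shows "(b, s + k) \<in> vars ((deriv_poly ^^ k) R) \<and> (\<forall>m>s + k. (b, m) \<notin> vars ((deriv_poly ^^ k) R))"
proof (induct k)
  case 0
  then show ?case using assms by auto
next
  case (Suc k)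
  let ?p = "(deriv_poly ^^ k) R"
  have "pdiff (b, s + Suc k) (deriv_poly ?p) = pdiff (b, s + k) ?p"
    using pdiff_commute_deriv[of "(b, s + k)" ?p] Suc pdiff_eq_0_iff[of "(b, Suc (s + k))" ?p] by simp
  then have "(b, s + Suc k) \<in> vars (deriv_poly ?p)"
    using Suc pdiff_eq_0_iff by metis
  moreover have "(b, m) \<notin> vars (deriv_poly ?p)" if "m > s + Suc k" for m
  proof
    assume "(b, m) \<in> vars (deriv_poly ?p)"
    then consider "(b, m) \<in> vars ?p" | y where "y \<in> vars ?p" "(b, m) = dnext y"
      using vars_deriv_poly[of ?p] by auto
    then show False
    proof cases
      case 1
      then show ?thesis using Suc that by auto
    next
      case 2
      then have "y = (b, m - 1)" using that by (cases y) auto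
      then show ?thesis using Suc that 2 by auto
    qed
  qed
  ultimately show ?case by simp
qed

lemma coeff_pcoeff_vanish:
  fixes g :: "'x \<Rightarrow> 'f::field_char_0"
  assumes "\<And>v. peval of_rat (g(x := v)) p = 0"
  shows "peval of_rat g (pcoeff x d p) = 0"
proof -
  note [simp] = peval_add[OF rhom_of_rat] peval_mult[OF rhom_of_rat] peval_var[OF rhom_of_rat] peval_sum[OF rhom_of_rat]
    rhom_power[OF rhom_peval[OF rhom_of_rat]]
  let ?c = "\<lambda>d. peval of_rat g (pcoeff x d p)"
  have c: "peval of_rat (g(x := v)) (pcoeff x d p) = ?c d" for v d
    by (rule peval_cong) (use vars_pcoeff[of x d p] in auto)
  let ?q = "\<Sum>d\<le>pdeg x p. monom (?c d) d"
  have "poly ?q v = 0" for v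
  proof -
    have "0 = peval of_rat (g(x := v)) (\<Sum>d\<le>pdeg x p. pcoeff x d p * var x ^ d)"
      using assms[of v] sum_pcoeff[of p x] by simp
    then show ?thesis by (simp add: poly_sum poly_monom c)
  qed
  then have "?q = 0" by (simp add: poly_all_0_iff_0[symmetric])
  then have "coeff ?q d = 0" by simp
  then have "d \<le> pdeg x p \<Longrightarrow> ?c d = 0"
    by (simp add: coeff_sum)
  then show ?thesis
    using pcoeff_gt_pdeg[of x p d] by (cases "d \<le> pdeg x p") auto
qed

text \<open>\<open>t\<close> is ranked highest and the other indeterminates follow their numbers
  under \<open>to_nat\<close>. Since \<open>sat\<close> quantifies over all elimination rankings,
  \<open>t\<close> may be chosen freely.\<close>

definition top_ranking :: "'b set \<Rightarrow> ('b::countable) \<Rightarrow> (('b \<times> nat) \<times> ('b \<times> nat)) set"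
  where "top_ranking B t = {((a, k), (b, m)). a \<in> B \<and> b \<in> B \<and>
    (a = b \<and> k < m \<or> a \<noteq> b \<and> (b = t \<or> a \<noteq> t \<and> to_nat a < to_nat b))}"

lemma elimination_top_ranking: "elimination_ranking B (top_ranking B t)"
proof -
  have "trans (top_ranking B t)"
    by (rule transI) (auto simp: top_ranking_def)
  moreover have "irrefl (top_ranking B t)"
    by (auto simp: irrefl_def top_ranking_def)
  moreover have "total_on (B \<times> UNIV) (top_ranking B t)"
    by (auto simp: total_on_def top_ranking_def) (metis linorder_neqE_nat to_nat_split)+
  ultimately show ?thesis
    unfolding elimination_ranking_def ranking_def strict_linear_order_on_def
    by (auto simp: top_ranking_def) (metis linorder_neqE_nat to_nat_split)+
qed

lemma leader_unique:
  assumes rk: "ranking B rk" and x: "x \<in> vars p" "\<And>y. y \<in> vars p \<Longrightarrow> y \<noteq> x \<Longrightarrow> (y, x) \<in> rk"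
  shows "leader rk p = x"
  unfolding leader_def
proof (rule the_equality)
  show "x \<in> vars p \<and> (\<forall>y\<in>vars p. y \<noteq> x \<longrightarrow> (y, x) \<in> rk)" using x by blast
  fix z assume z: "z \<in> vars p \<and> (\<forall>y\<in>vars p. y \<noteq> z \<longrightarrow> (y, z) \<in> rk)"
  show "z = x"
  proof (rule ccontr)
    assume "z \<noteq> x"
    then have "(x, z) \<in> rk" "(z, x) \<in> rk" using x z by auto
    then have "(x, x) \<in> rk" using rk by (auto simp: ranking_def strict_linear_order_on_def dest: transD)
    then show False using rk by (cases x) (auto simp: ranking_def strict_linear_order_on_def irrefl_def)
  qed
qed

lemma leader_exists:
  assumes rk: "ranking B rk" and p: "vars p \<subseteq> B \<times> UNIV" "vars p \<noteq> {}"
  shows "\<exists>b s. leader rk p = (b, s) \<and> (b, s) \<in> vars p \<and> (\<forall>m>s. (b, m) \<notin> vars p)"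
proof -
  have tr: "trans rk" and ir: "irrefl rk" and tot: "total_on (B \<times> UNIV) rk"
    using rk by (auto simp: ranking_def strict_linear_order_on_def)
  have nxt: "(x, dnext x) \<in> rk" if "x \<in> B \<times> UNIV" for x
    using rk that unfolding ranking_def by blast
  have ex: "\<exists>x\<in>V. \<forall>y\<in>V. y \<noteq> x \<longrightarrow> (y, x) \<in> rk" if "finite V" "V \<noteq> {}" "V \<subseteq> B \<times> UNIV" for V
    using that
  proof (induct V rule: finite_ne_induct)
    case (insert a V)
    then obtain x where x: "x \<in> V" "\<forall>y\<in>V. y \<noteq> x \<longrightarrow> (y, x) \<in> rk" by auto
    have "a \<noteq> x" "a \<in> B \<times> UNIV" "x \<in> B \<times> UNIV" using insert x by auto
    then consider "(a, x) \<in> rk" | "(x, a) \<in> rk" using tot unfolding total_on_def by blast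
    then show ?case
    proof cases
      case 1
      then show ?thesis using x by blast
    next
      case 2
      then have "\<forall>y\<in>insert a V. y \<noteq> a \<longrightarrow> (y, a) \<in> rk" using x(2) tr by (auto dest: transD)
      then show ?thesis by blast
    qed
  qed simp
  obtain x where x: "x \<in> vars p" "\<forall>y\<in>vars p. y \<noteq> x \<longrightarrow> (y, x) \<in> rk"
    using ex[OF finite_vars p(2,1)] by (elim bexE)
  obtain b s where bs: "x = (b, s)" by (cases x)
  have b: "b \<in> B" using x p bs by auto
  have up: "((b, s), (b, s + Suc d)) \<in> rk" for d
  proof (induct d)
    case 0
    then show ?case using nxt[of "(b, s)"] b by simp
  next
    case (Suc d)
    have "((b, s + Suc d), dnext (b, s + Suc d)) \<in> rk"
      by (rule nxt) (use b in simp)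
    then show ?case using Suc tr by (auto dest: transD)
  qed
  have "(b, m) \<notin> vars p" if "m > s" for m
  proof
    assume "(b, m) \<in> vars p"
    then have "((b, m), (b, s)) \<in> rk" using x that bs by auto
    moreover have "((b, s), (b, m)) \<in> rk"
      using up[of "m - Suc s"] that by simp
    ultimately show False using tr ir by (auto dest: transD simp: irrefl_def)
  qed
  then show ?thesis
    using leader_unique[OF rk, of x p] x bs by auto
qed

locale resultant_point = generic_point P a0 u
  for P and a0 :: "(nat \<times> nat) \<times> nat \<Rightarrow> 'f::field_char_0" and u :: "nat \<times> nat \<Rightarrow> 'f" +
  fixes R :: coeff_poly
  assumes res: "is_diff_resultant P R"
begin

lemma R_ring_D: "R \<in> ring_D P"
  using res by (simp add: is_diff_resultant_def)

lemma R_irreducible: "Factorial_Ring.irreducible R"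
  by (rule ring_irreducible_poly_over[of R "indets_A P \<times> UNIV"])
    (use res in \<open>auto simp: is_diff_resultant_def ring_D_def\<close>)

lemma R_neq_0: "R \<noteq> 0"
  using R_irreducible irreducible_neq_0 by blast

lemma sat_iff: "p \<in> sat (indets_A P) R \<longleftrightarrow> p \<in> ring_D P \<and> peval of_rat pt p = 0"
proof -
  have "sat (indets_A P) R = {p\<in>ring_D P. cst p \<in> sys_ideal}"
    using res by (simp add: is_diff_resultant_def sys_ideal_def)
  then show ?thesis using sys_ideal_iff by blast
qed

text \<open>Proper derivatives of \<open>R\<close> have higher order in \<open>b\<close> than
  \<open>f\<close>, so they cannot reduce it; the alternative \<open>f = 0\<close> covers the final
  remainder.\<close>

lemma not_reducible_at:
  assumes rk: "elimination_ranking (indets_A P) rk"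
    and f: "\<And>s m. leader rk R = (b, s) \<Longrightarrow> m > s \<Longrightarrow> (b, m) \<notin> vars f"
    and b: "fst (leader rk R) = b" and k: "k > 0 \<or> f = 0"
  shows "\<not> reducible_at rk R f k"
proof -
  have rk': "ranking (indets_A P) rk" using rk by (simp add: elimination_ranking_def)
  have "vars R \<noteq> {}" using qpoly_unit_iff[of R] R_neq_0 R_irreducible irreducible_nonunit by blast
  then obtain s where s: "leader rk R = (b, s)" "(b, s) \<in> vars R" "\<forall>m>s. (b, m) \<notin> vars R"
    using leader_exists[OF rk', of R] R_ring_D b by (auto simp: ring_D_def poly_over_def)
  have "(b, s + k) \<in> vars ((deriv_poly ^^ k) R)" using leading_derivative[of b s R k] s by blast
  then have "pdeg (b, s + k) ((deriv_poly ^^ k) R) > 0"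
    using pdeg_eq_0_iff[of "(b, s + k)"] by (simp add: neq0_conv[symmetric])
  moreover have "pdeg (b, s + k) f = 0"
    using f[OF s(1), of "s + k"] k pdeg_eq_0_iff[of "(b, s + k)" f] by auto
  ultimately show ?thesis by (simp add: reducible_at_def s(1) dnext_iter Let_def)
qed

text \<open>A single step with \<open>k = 0\<close> reduces \<open>R\<close> to zero under every
  elimination ranking, so \<open>R\<close> lies in its own saturation.\<close>

lemma peval_pt_R: "peval of_rat pt R = 0"
proof -
  have "diff_remainder rk R R 0" if rk: "elimination_ranking (indets_A P) rk" for rk
  proof -
    have rk': "ranking (indets_A P) rk" using rk by (simp add: elimination_ranking_def)
    have "vars R \<noteq> {}" using qpoly_unit_iff[of R] R_neq_0 R_irreducible irreducible_nonunit by blast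
    then obtain b s where s: "leader rk R = (b, s)" "(b, s) \<in> vars R" "\<forall>m>s. (b, m) \<notin> vars R"
      using leader_exists[OF rk', of R] R_ring_D by (auto simp: ring_D_def poly_over_def)
    have "ritt_step rk R R (pcoeff (b, s) (pdeg (b, s) R) R * R - pcoeff (b, s) (pdeg (b, s) R) R * var (b, s) ^ (pdeg (b, s) R - pdeg (b, s) R) * R)"
    proof (rule ritt_step.intros)
      show "reducible_at rk R R 0" by (simp add: reducible_at_def Let_def)
      show "\<forall>j>0. \<not> reducible_at rk R R j"
        using s by (intro allI impI not_reducible_at[OF rk, where b = b]) auto
    qed (use s in auto)
    then have "ritt_step rk R R 0" by simp
    moreover have "\<forall>k. \<not> reducible_at rk R 0 k"
      using s by (intro allI not_reducible_at[OF rk, where b = b]) auto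
    ultimately show ?thesis by (auto simp: diff_remainder_def)
  qed
  then have "R \<in> sat (indets_A P) R" using R_ring_D by (simp add: sat_def ring_D_def)
  then show ?thesis by (simp add: sat_iff)
qed

text \<open>With \<open>(i, 0)\<close> ranked highest, only \<open>R\<close> itself, never a proper
  derivative, takes part in the reduction of \<open>f\<close> to zero. Each step multiplies by the
  initial of \<open>R\<close>, which \<open>R\<close> does not divide; as \<open>R\<close> is prime,
  divisibility travels back from the remainder \<open>0\<close> to \<open>f\<close>.\<close>

lemma R_dvd:
  assumes s: "((i, 0), s) \<in> vars R" "\<And>m. m > s \<Longrightarrow> ((i, 0), m) \<notin> vars R"
    and f: "f \<in> ring_D P" "peval of_rat pt f = 0" "\<And>m. m > s \<Longrightarrow> ((i, 0), m) \<notin> vars f"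
  shows "R dvd f"
proof -
  let ?rk = "top_ranking (indets_A P) (i, 0)"
  have el: "elimination_ranking (indets_A P) ?rk" by (rule elimination_top_ranking)
  then have rk: "ranking (indets_A P) ?rk" by (simp add: elimination_ranking_def)
  have lead: "leader ?rk R = ((i, 0), s)"
  proof (rule leader_unique[OF rk s(1)])
    fix y assume y: "y \<in> vars R" "y \<noteq> ((i, 0), s)"
    obtain b m where bm: "y = (b, m)" by (cases y)
    have "b \<in> indets_A P" "(i, 0) \<in> indets_A P"
      using y s(1) R_ring_D bm by (auto simp: ring_D_def poly_over_def)
    moreover have "m < s" if "b = (i, 0)"
      using s(2)[of m] y that bm by (cases "m < s") auto
    ultimately show "(y, ((i, 0), s)) \<in> ?rk"
      by (auto simp: top_ranking_def bm)
  qed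
  let ?x = "((i, 0), s)"
  let ?I = "pcoeff ?x (pdeg ?x R) R"
  \<comment> \<open>A nonzero multiple of \<open>R\<close> contains the leader, of which the initial
    is free.\<close>
  have not_dvd: "\<not> R dvd ?I"
  proof
    assume "R dvd ?I"
    then obtain k where k: "?I = R * k" by (elim dvdE)
    have "?I \<noteq> 0" using pcoeff_pdeg_neq_0[OF R_neq_0] .
    then have "k \<noteq> 0" using k by auto
    then have "vars ?I = vars R \<union> vars k" using k R_neq_0 vars_mult_eq by metis
    then show False using s(1) vars_pcoeff[of ?x _ R] by blast
  qed
  have "f \<in> sat (indets_A P) R" using f by (simp add: sat_iff)
  then have "(ritt_step ?rk R)\<^sup>*\<^sup>* f 0"
    using el by (simp add: sat_def diff_remainder_def)
  then show ?thesis
    using f(3)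
  proof (induct rule: converse_rtranclp_induct)
    case base
    then show ?case by simp
  next
    case (step f g)
    from step(1) show ?case
    proof cases
      case (1 k G x)
      have "\<not> reducible_at ?rk R f k" if "k > 0"
        by (rule not_reducible_at[OF el, of "(i, 0)"]) (use lead step(4) that in auto)
      then have "k = 0" using 1(2) by (cases k) auto
      then have g: "g = ?I * f - pcoeff ?x (pdeg ?x f) f * var ?x ^ (pdeg ?x f - pdeg ?x R) * R"
        using 1 lead by simp
      have "((i, 0), m) \<notin> vars g" if m: "m > s" for m
      proof -
        have "vars g \<subseteq> vars (?I * f) \<union> vars (pcoeff ?x (pdeg ?x f) f * var ?x ^ (pdeg ?x f - pdeg ?x R) * R)"
          unfolding g by (rule vars_diff)
        also have "\<dots> \<subseteq> - {((i, 0), m)}"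
        proof -
          have "?I \<in> poly_over (- {((i, 0), m)})" "f \<in> poly_over (- {((i, 0), m)})" "R \<in> poly_over (- {((i, 0), m)})"
            "pcoeff ?x (pdeg ?x f) f \<in> poly_over (- {((i, 0), m)})" "var ?x \<in> poly_over (- {((i, 0), m)})"
            using s(2)[OF m] step(4)[OF m] vars_pcoeff[of ?x "pdeg ?x f" f] vars_pcoeff[of ?x "pdeg ?x R" R] m
            by (auto simp: poly_over_def)
          then have "?I * f \<in> poly_over (- {((i, 0), m)})"
            "pcoeff ?x (pdeg ?x f) f * var ?x ^ (pdeg ?x f - pdeg ?x R) * R \<in> poly_over (- {((i, 0), m)})"
            by (auto intro!: poly_over_mult poly_over_power)
          then show ?thesis by (simp add: poly_over_def)
        qed
        finally show ?thesis by blast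
      qed
      then have "R dvd g" by (rule step(3))
      then have "R dvd g + pcoeff ?x (pdeg ?x f) f * var ?x ^ (pdeg ?x f - pdeg ?x R) * R"
        by (intro dvd_add) simp_all
      then have "R dvd ?I * f" by (simp add: g)
      then show ?thesis using not_dvd qpoly_irreducible_prime[OF R_irreducible] by blast
    qed
  qed
qed

text \<open>A nonzero multiple of \<open>R\<close> contains the leader. So the coordinates of
  \<open>pt\<close> over \<open>indets_A P\<close> become independent when those of
  \<open>(i, 0)\<close> of order at least \<open>s\<close> are left out.\<close>

lemma vanishing_below_R:
  assumes s: "((i, 0), s) \<in> vars R" "\<And>m. m > s \<Longrightarrow> ((i, 0), m) \<notin> vars R"
    and f: "f \<in> ring_D P" "peval of_rat pt f = 0" "\<And>m. m \<ge> s \<Longrightarrow> ((i, 0), m) \<notin> vars f"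
  shows "f = 0"
proof (rule ccontr)
  assume "f \<noteq> 0"
  have "R dvd f" by (rule R_dvd[OF s f(1,2)]) (use f(3) in auto)
  then obtain k where k: "f = R * k" by (elim dvdE)
  then have "k \<noteq> 0" using \<open>f \<noteq> 0\<close> by auto
  then have "vars f = vars R \<union> vars k" using k R_neq_0 vars_mult_eq[of R k] by simp
  then show False using s(1) f(3)[of s] by auto
qed

text \<open>The separant has smaller degree in the leader than \<open>R\<close>, so \<open>R\<close>
  cannot divide it.\<close>

lemma separant_neq_0:
  assumes s: "((i, 0), s) \<in> vars R" "\<And>m. m > s \<Longrightarrow> ((i, 0), m) \<notin> vars R"
  shows "peval of_rat pt (pdiff ((i, 0), s) R) \<noteq> 0"
proof
  let ?S = "pdiff ((i, 0), s) R"
  assume 0: "peval of_rat pt ?S = 0"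
  have "?S \<in> ring_D P" using R_ring_D unfolding ring_D_def by (rule pdiff_poly_over)
  moreover have "((i, 0), m) \<notin> vars ?S" if "m > s" for m
    using vars_pdiff[of "((i, 0), s)" R] s(2)[OF that] by blast
  ultimately have "R dvd ?S" using R_dvd[OF s _ 0] by blast
  then obtain k where k: "?S = R * k" by (elim dvdE)
  have "?S \<noteq> 0" using s(1) pdiff_eq_0_iff by metis
  then have "k \<noteq> 0" using k by auto
  then have "pdeg ((i, 0), s) ?S = pdeg ((i, 0), s) R + pdeg ((i, 0), s) k"
    unfolding k using R_neq_0 by (intro pdeg_mult)
  then show False using pdeg_pdiff[OF s(1)] by simp
qed

text \<open>Otherwise \<open>R\<close> would be a relation among the independent coordinates in
  \<open>non_leading\<close>.\<close>

lemma R_leading_exists: "\<exists>i s. ((i, 0), s) \<in> vars R"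
proof (rule ccontr)
  assume no: "\<not> ?thesis"
  have nl: "R \<in> poly_over (non_leading \<times> UNIV)"
  proof -
    have "x \<in> non_leading \<times> UNIV" if "x \<in> vars R" for x
      using that no by (cases x) (auto simp: non_leading_def intro: gr0I)
    then show ?thesis by (auto simp: poly_over_def)
  qed
  have "peval of_rat a0 R = peval of_rat pt R"
    by (rule peval_cong) (use nl pt_non_leading in \<open>auto simp: poly_over_def\<close>)
  moreover have "indep (non_leading \<times> UNIV) a0"
    using indep_reindex[OF indep_mono[OF generic Un_upper1]] by (simp add: comp_def)
  ultimately have "R = 0" using indepD nl peval_pt_R by metis
  then show False using R_neq_0 by blast
qed

text \<open>All orders up to that of \<open>R\<close> are included, whether or not they occur in
  \<open>R\<close>, because a derivative of a generic polynomial involves the lower derivatives of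
  its coefficients as well.\<close>

definition R_slots :: "((nat \<times> nat) \<times> nat) set"
  where "R_slots = {((i, 0), k) | i k. \<exists>s\<ge>k. ((i, 0), s) \<in> vars R}"

lemma R_leading_max:
  assumes "((i, 0), k) \<in> R_slots"
  obtains s where "((i, 0), s) \<in> vars R" "\<And>m. m > s \<Longrightarrow> ((i, 0), m) \<notin> vars R" "\<And>m. ((i, 0), m) \<in> R_slots \<longleftrightarrow> m \<le> s"
proof -
  let ?S = "{s. ((i, 0), s) \<in> vars R}"
  have fin: "finite ?S"
    by (rule finite_subset[of _ "snd ` vars R"]) force+
  have "?S \<noteq> {}" using assms by (auto simp: R_slots_def)
  then have M: "Max ?S \<in> ?S" using fin by (rule Max_in[rotated])
  have le: "s \<le> Max ?S" if "((i, 0), s) \<in> vars R" for s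
    using that fin by (intro Max_ge) auto
  show ?thesis
  proof (rule that)
    show "((i, 0), Max ?S) \<in> vars R" using M by simp
    show "((i, 0), m) \<notin> vars R" if "m > Max ?S" for m using le[of m] that by auto
    show "((i, 0), m) \<in> R_slots \<longleftrightarrow> m \<le> Max ?S" for m
      using le M by (auto simp: R_slots_def intro: le_trans)
  qed
qed

text \<open>Free variables are stripped one at a time: \<open>f\<close> vanishes whatever their
  values, so its coefficients in them vanish at \<open>b\<close>. What remains has order at most
  that of \<open>R\<close> and falls under \<open>R_dvd\<close>; divisibility lifts back because
  \<open>R\<close> is free of these variables.\<close>

lemma R_dvd_free:
  assumes b: "\<And>x. x \<in> non_leading \<times> UNIV \<union> R_slots \<Longrightarrow> b x = pt x"
    and D: "\<And>x. x \<notin> non_leading \<times> UNIV \<union> R_slots \<Longrightarrow>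
      \<exists>D. is_der D \<and> D (b x) = 1 \<and> (\<forall>z. z \<noteq> x \<longrightarrow> D (b z) = 0)"
    and f: "f \<in> ring_D P" "peval of_rat b f = 0"
  shows "R dvd f"
proof -
  let ?N = "non_leading \<times> UNIV \<union> R_slots"
  have "finite X \<Longrightarrow> f \<in> ring_D P \<Longrightarrow> peval of_rat b f = 0 \<Longrightarrow> vars f - ?N \<subseteq> X \<Longrightarrow> R dvd f" for X f
  proof (induct X arbitrary: f rule: finite_induct)
    case empty
    obtain i k where "((i, 0), k) \<in> R_slots" using R_leading_exists by (auto simp: R_slots_def)
    then obtain s where s: "((i, 0), s) \<in> vars R" "\<And>m. m > s \<Longrightarrow> ((i, 0), m) \<notin> vars R"
      "\<And>m. ((i, 0), m) \<in> R_slots \<longleftrightarrow> m \<le> s"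
      using R_leading_max by blast
    have "peval of_rat pt f = peval of_rat b f"
      by (rule peval_cong) (use empty b in auto)
    moreover have "((i, 0), m) \<notin> vars f" if "m > s" for m
      using empty s(3)[of m] that by (auto simp: non_leading_def)
    ultimately show ?case using R_dvd[OF s(1,2)] empty by simp
  next
    case (insert x X)
    show ?case
    proof (cases "x \<in> ?N")
      case True
      then show ?thesis using insert by blast
    next
      case False
      then have xR: "x \<notin> vars R"
        by (cases x) (auto simp: R_slots_def non_leading_def)
      have "peval of_rat (b(x := v)) f = 0" for v
        by (rule peval_dual_ders[of "{x}" f UNIV b]) (use D[OF False] insert in \<open>auto simp: poly_over_def\<close>)
      then have 0: "peval of_rat b (pcoeff x d f) = 0" for d by (rule coeff_pcoeff_vanish)
      have "R dvd pcoeff x d f" for d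
      proof (rule insert.hyps(3)[OF _ 0])
        show "pcoeff x d f \<in> ring_D P" "vars (pcoeff x d f) - ?N \<subseteq> X"
          using insert.prems vars_pcoeff[of x d f] by (auto simp: ring_D_def poly_over_def)
      qed
      then show ?thesis using dvd_pcoeff_iff[OF xR] by blast
    qed
  qed
  from this[of "vars f"] show ?thesis using f by auto
qed

end

section \<open>The derivatives of the generic polynomials\<close>

lemma lookup_cst_mult: "lookup (cst c * f) m = c * lookup (f :: ('v, 'r::comm_ring_1) lpoly) m"
  using lookup_single_mult[of 0 c f m] by (simp add: cst_def)

lemma of_nat_cst: "of_nat n = cst (of_nat n :: 'r::comm_ring_1)"
  by (induct n) (auto simp: cst_add)

lemma lookup_sum_poly: "lookup (sum f A) m = (\<Sum>x\<in>A. lookup (f x) m)"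
  by (induct A rule: infinite_finite_induct) (auto simp: lookup_add)

lemma pdiff_sum: "pdiff x (sum f A) = (\<Sum>y\<in>A. pdiff x (f y))"
  by (induct A rule: infinite_finite_induct) (auto simp: pdiff_add)

lemma linear_form_eq_0_iff:
  assumes "finite X"
  shows "(\<Sum>x\<in>X. cst (c x) * var x) = 0 \<longleftrightarrow> (\<forall>x\<in>X. c x = (0 :: rat))"
proof
  assume 0: "(\<Sum>x\<in>X. cst (c x) * var x) = 0"
  show "\<forall>x\<in>X. c x = 0"
  proof
    fix y assume y: "y \<in> X"
    have "0 = pdiff y (\<Sum>x\<in>X. cst (c x) * var x)" by (simp add: 0)
    also have "\<dots> = (\<Sum>x\<in>X. pdiff y (cst (c x) * var x))" by (rule pdiff_sum)
    also have "\<dots> = (\<Sum>x\<in>X. if x = y then cst (c x) else 0)"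
      by (rule sum.cong) (auto simp: pdiff_mult_var)
    also have "\<dots> = cst (c y)" using y assms by simp
    finally have "lookup (cst (c y) :: 'a qpoly) 0 = 0" by simp
    then show "c y = 0" by (simp add: cst_def)
  qed
qed simp

text \<open>Derivatives of a monomial have rational coefficients; the lookup at \<open>0\<close>
  extracts the number from the constant polynomial.\<close>

definition mono_coeff :: "(nat \<times> nat \<Rightarrow>\<^sub>0 int) \<Rightarrow> nat \<Rightarrow> (nat \<times> nat \<Rightarrow>\<^sub>0 int) \<Rightarrow> rat"
  where "mono_coeff m j \<mu> = lookup (lookup ((deriv_laurent ^^ j) (single m 1 :: sys_poly)) \<mu>) 0"

lemma lookup_deriv_mono: "lookup ((deriv_laurent ^^ j) (single m 1 :: sys_poly)) \<mu> = cst (mono_coeff m j \<mu>)"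
proof -
  have "single m 1 \<in> (laurent_over (poly_over ({} \<times> UNIV)) (UNIV \<times> UNIV) :: sys_poly set)"
    by (rule laurent_over_single) auto
  then have "(deriv_laurent ^^ j) (single m 1 :: sys_poly) \<in> laurent_over (poly_over ({} \<times> UNIV)) (UNIV \<times> UNIV)"
    by (rule deriv_iter_closed)
  then have "vars (lookup ((deriv_laurent ^^ j) (single m 1 :: sys_poly)) \<mu>) = {}"
    by (simp add: laurent_over_iff) (simp add: poly_over_def)
  then obtain c where c: "lookup ((deriv_laurent ^^ j) (single m 1 :: sys_poly)) \<mu> = cst c"
    using qpoly_vars_empty by blast
  then show ?thesis by (simp add: mono_coeff_def c) (simp add: cst_def)
qed

lemma mono_coeff_0: "mono_coeff m 0 \<mu> = (if \<mu> = m then 1 else 0)"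
  by (auto simp: mono_coeff_def lookup_single when_def)

abbreviation dgp :: "gsystem \<Rightarrow> nat \<Rightarrow> nat \<Rightarrow> sys_poly"
  where "dgp P i k \<equiv> (deriv_laurent ^^ k) (gpoly P i)"

definition gcoeff :: "gsystem \<Rightarrow> nat \<Rightarrow> nat \<Rightarrow> (nat \<times> nat \<Rightarrow>\<^sub>0 int) \<Rightarrow> (nat \<times> nat) \<times> nat \<Rightarrow> rat"
  where "gcoeff P i k \<mu> = (\<lambda>((_, s), j). of_nat (k choose j) * mono_coeff (monom_at P i s) (k - j) \<mu>)"

definition gslots :: "gsystem \<Rightarrow> nat \<Rightarrow> nat \<Rightarrow> ((nat \<times> nat) \<times> nat) set"
  where "gslots P i k = (\<lambda>(s, j). ((i, s), j)) ` ({..num_terms P i} \<times> {..k})"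

text \<open>Leibniz's rule makes each coefficient a linear form with rational weights in distinct
  variables. This rules out cancellation between terms.\<close>

lemma lookup_deriv_gpoly: "lookup (dgp P i k) \<mu> = (\<Sum>x\<in>gslots P i k. cst (gcoeff P i k \<mu> x) * var x)"
proof -
  note D = is_der_deriv_laurent
  have "dgp P i k = (\<Sum>s\<le>num_terms P i. (deriv_laurent ^^ k) (cst (var ((i, s), 0)) * single (monom_at P i s) 1))"
    by (simp add: gpoly_def der_iter_sum[OF D] cst_def mult_single)
  also have "\<dots> = (\<Sum>s\<le>num_terms P i. \<Sum>j\<le>k. cst (of_nat (k choose j) * var ((i, s), j)) * (deriv_laurent ^^ (k - j)) (single (monom_at P i s) 1))"
    by (simp add: der_iter_mult[OF D] deriv_laurent_iter_cst deriv_poly_iter_var cst_mult of_nat_cst)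
  finally have "lookup (dgp P i k) \<mu> = (\<Sum>s\<le>num_terms P i. \<Sum>j\<le>k. cst (gcoeff P i k \<mu> ((i, s), j)) * var ((i, s), j))"
    by (simp add: lookup_sum_poly lookup_cst_mult lookup_deriv_mono gcoeff_def cst_mult of_nat_cst mult_ac)
  also have "\<dots> = (\<Sum>x\<in>gslots P i k. cst (gcoeff P i k \<mu> x) * var x)"
    unfolding gslots_def by (subst sum.reindex) (auto simp: inj_on_def sum.cartesian_product intro!: sum.cong)
  finally show ?thesis .
qed

lemma finite_gslots: "finite (gslots P i k)"
  by (simp add: gslots_def)

lemma lookup_deriv_gpoly_neq_0_iff:
  "lookup (dgp P i k) \<mu> \<noteq> 0 \<longleftrightarrow> (\<exists>s\<le>num_terms P i. \<exists>j\<le>k. mono_coeff (monom_at P i s) j \<mu> \<noteq> 0)"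
proof -
  have "lookup (dgp P i k) \<mu> \<noteq> 0 \<longleftrightarrow> (\<exists>s\<le>num_terms P i. \<exists>j\<le>k. mono_coeff (monom_at P i s) (k - j) \<mu> \<noteq> 0)"
    unfolding lookup_deriv_gpoly linear_form_eq_0_iff[OF finite_gslots]
    by (fastforce simp: gslots_def gcoeff_def)
  also have "\<dots> \<longleftrightarrow> (\<exists>s\<le>num_terms P i. \<exists>j\<le>k. mono_coeff (monom_at P i s) j \<mu> \<noteq> 0)"
    by (metis diff_diff_cancel diff_le_self)
  finally show ?thesis .
qed

text \<open>A monomial produced by \<open>j\<close> derivations of some
  \<open>monom_at P i s\<close> reappears in every higher derivative, with the remaining derivations
  falling on the coefficient; binomial coefficients do not vanish in characteristic zero.\<close>

lemma lookup_deriv_gpoly_mono: "lookup (dgp P i k) \<mu> \<noteq> 0 \<Longrightarrow> k \<le> k' \<Longrightarrow> lookup (dgp P i k') \<mu> \<noteq> 0"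
  unfolding lookup_deriv_gpoly_neq_0_iff using le_trans by blast

lemma vars_lookup_deriv_gpoly: "vars (lookup (dgp P i k) \<mu>) \<subseteq> gslots P i k"
proof -
  have "vars (lookup (dgp P i k) \<mu>) \<subseteq> (\<Union>x\<in>gslots P i k. vars (cst (gcoeff P i k \<mu> x) * var x))"
    unfolding lookup_deriv_gpoly by (rule vars_sum)
  also have "\<dots> \<subseteq> gslots P i k" using vars_mult by fastforce
  finally show ?thesis .
qed

lemma pdiff_lookup_deriv_gpoly: "x \<in> gslots P i k \<Longrightarrow> pdiff x (lookup (dgp P i k) \<mu>) = cst (gcoeff P i k \<mu> x)"
proof -
  assume x: "x \<in> gslots P i k"
  have "pdiff x (\<Sum>y\<in>gslots P i k. cst (gcoeff P i k \<mu> y) * var y) = (\<Sum>y\<in>gslots P i k. pdiff x (cst (gcoeff P i k \<mu> y) * var y))"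
    by (rule pdiff_sum)
  also have "\<dots> = (\<Sum>y\<in>gslots P i k. if y = x then cst (gcoeff P i k \<mu> y) else 0)"
    by (rule sum.cong) (auto simp: pdiff_mult_var)
  also have "\<dots> = cst (gcoeff P i k \<mu> x)" using x finite_gslots by simp
  finally show ?thesis by (simp add: lookup_deriv_gpoly)
qed

lemma gcoeff_top: "gcoeff P i k \<mu> ((i, s), k) = (if \<mu> = monom_at P i s then 1 else 0)"
  by (simp add: gcoeff_def mono_coeff_0)

lemma gslots_top: "((i, 0), k) \<in> gslots P i k"
  by (auto simp: gslots_def)

text \<open>The top derivative of the distinguished coefficient arises only when all derivations hit
  it, and then its monomial is untouched. This recovers \<open>(i, k)\<close> from the polynomial
  and pins down \<open>T\<close>.\<close>

lemma top_var_iff: "((i, 0), k) \<in> vars (lookup (dgp P i k) \<mu>) \<longleftrightarrow> \<mu> = monom_at P i 0"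
  using pdiff_eq_0_iff[of "((i, 0), k)" "lookup (dgp P i k) \<mu>"] pdiff_lookup_deriv_gpoly[OF gslots_top, where P = P and i = i and k = k and \<mu> = \<mu>]
  by (auto simp: gcoeff_top split: if_splits)

lemma dgp_inj: "dgp P i k = dgp P i' k' \<Longrightarrow> i = i' \<and> k = k'"
proof -
  have *: "i = i' \<and> k \<le> k'" if "dgp P i k = dgp P i' k'" for i k i' k'
    using top_var_iff[where P = P and i = i and k = k and \<mu> = "monom_at P i 0"] vars_lookup_deriv_gpoly[where P = P and i = i' and k = k' and \<mu> = "monom_at P i 0"] that
    by (auto simp: gslots_def)
  show "dgp P i k = dgp P i' k' \<Longrightarrow> i = i' \<and> k = k'"
    using * by (metis le_antisym)
qed

lemma lvars_deriv_laurent: "lvars (deriv_laurent f) \<subseteq> lvars f \<union> dnext ` lvars f"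
proof -
  let ?L = "laurent_over UNIV (lvars f \<union> dnext ` lvars f)"
  have S: "subring_set UNIV" by (simp add: subring_set_def)
  have "deriv_laurent f = (\<Sum>m\<in>keys f. single m (deriv_poly (lookup f m)) + single 0 (lookup f m) * mono_deriv m)"
    by (rule deriv_laurent_alt) auto
  also have "\<dots> \<in> ?L"
  proof (intro laurent_over_sum[OF S] laurent_over_add[OF S])
    fix m assume m: "m \<in> keys f"
    have km: "keys m \<subseteq> lvars f" using m by (auto simp: lvars_def)
    then show "single m (deriv_poly (lookup f m)) \<in> ?L" by (intro laurent_over_single) auto
    have "mono_deriv m \<in> ?L"
      unfolding mono_deriv_def
    proof (intro laurent_over_sum[OF S] laurent_over_single)
      fix v assume v: "v \<in> keys m"
      have "keys (m - single v 1 + single (dnext v) 1) \<subseteq> insert (dnext v) (keys m)"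
        using v by (auto simp: in_keys_iff lookup_add lookup_minus lookup_single when_def split: if_splits)
      then show "keys (m - single v 1 + single (dnext v) 1) \<subseteq> lvars f \<union> dnext ` lvars f"
        using km v by auto
    qed simp
    then show "single 0 (lookup f m) * mono_deriv m \<in> ?L"
      by (intro laurent_over_mult[OF S] laurent_over_single) auto
  qed
  finally show ?thesis by (simp add: laurent_over_def)
qed

lemma lvars_dgp: "(j, q) \<in> lvars (dgp P i k) \<Longrightarrow> \<exists>q0\<in>occ j (gpoly P i). q0 \<le> q \<and> q \<le> q0 + k"
proof (induct k arbitrary: q)
  case 0
  then show ?case by (auto simp: occ_def)
next
  case (Suc k)
  then have "(j, q) \<in> lvars (deriv_laurent (dgp P i k))" by simp
  then consider "(j, q) \<in> lvars (dgp P i k)" | q' where "(j, q') \<in> lvars (dgp P i k)" "q = Suc q'"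
    using lvars_deriv_laurent by fastforce
  then show ?case
  proof cases
    case 1
    then show ?thesis using Suc.hyps[of q] by (auto intro: le_SucI)
  next
    case 2
    then show ?thesis using Suc.hyps[of q'] by (auto intro: le_SucI)
  qed
qed

lemma finite_occ: "finite (occ j f)"
proof -
  have "finite (lvars f)" by (simp add: lvars_def)
  moreover have "occ j f = (\<lambda>k. (j, k)) -` lvars f" by (auto simp: occ_def)
  ultimately show ?thesis by (simp add: finite_vimageI inj_on_def)
qed

context gsys
begin

lemma dgp_vars:
  assumes "i \<in> N" "(j, q) \<in> lvars (dgp P i k)"
  shows "j \<in> {1..dim_n P - 1}" "gam P j \<le> q" "Fin (int q) \<le> ord_u P i j + Fin (int k)"
proof -
  have "dgp P i k \<in> ring_DU P" using deriv_iter_ring_DU[OF gpoly_ring_DU[OF assms(1)]] .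
  then show "j \<in> {1..dim_n P - 1}" using assms(2) by (auto simp: ring_DU_def laurent_over_def)
  obtain q0 where q0: "q0 \<in> occ j (gpoly P i)" "q0 \<le> q" "q \<le> q0 + k" using lvars_dgp[OF assms(2)] by blast
  have "gam P j \<le> q0"
    unfolding gam_def by (rule Min_le) (use q0 assms(1) finite_occ in auto)
  then show "gam P j \<le> q" using q0 by simp
  have "q0 \<le> Max (occ j (gpoly P i))" using q0 finite_occ by (intro Max_ge) auto
  moreover have "ord_u P i j = Fin (int (Max (occ j (gpoly P i))))" using q0 by (auto simp: ord_u_def)
  ultimately show "Fin (int q) \<le> ord_u P i j + Fin (int k)" using q0 by simp
qed

lemma dgp_vars_upto:
  assumes "i \<in> N" "Fin (int k) \<le> \<tau> i" "(j, q) \<in> lvars (dgp P i k)"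
  shows "(j, q) \<in> vars_upto P \<tau>"
proof -
  have "Fin (int q) \<le> ord_u P i j + \<tau> i"
    using dgp_vars(3)[OF assms(1,3)] add_left_mono[OF assms(2), of "ord_u P i j"] by (rule order_trans)
  also have "\<dots> \<le> Max ((\<lambda>i. ord_u P i j + \<tau> i) ` N)"
    using assms(1) by (intro Max_ge) auto
  finally show ?thesis using dgp_vars[OF assms(1,3)] by (simp add: vars_upto_def)
qed

lemma dgp_ps_vars:
  assumes "i \<in> N" "Fin (int k) \<le> Jac P i - Fin (int (gam_sum P))" "(j, q) \<in> lvars (dgp P i k)"
  shows "(j, q) \<in> ps_vars P"
proof -
  have "Fin (int (k + gam_sum P)) \<le> Jac P i"
    using assms(2) by (cases "Jac P i") auto
  then have "ord_u P i j + Fin (int (k + gam_sum P)) \<le> ord_u P i j + Jac P i" by (rule add_left_mono)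
  also have "\<dots> \<le> Max ((\<lambda>i. ord_u P i j + Jac P i) ` N)"
    using assms(1) by (intro Max_ge) auto
  finally have M: "ord_u P i j + Fin (int (k + gam_sum P)) \<le> Max ((\<lambda>i. ord_u P i j + Jac P i) ` N)" .
  have "Fin (int q) \<le> Max ((\<lambda>i. ord_u P i j + Jac P i) ` N) - Fin (int (gam_sum P))"
    using dgp_vars(3)[OF assms(1,3)] M
    by (cases "ord_u P i j"; cases "Max ((\<lambda>i. ord_u P i j + Jac P i) ` N)") auto
  then show ?thesis using dgp_vars[OF assms(1,3)] by (simp add: ps_vars_def)
qed

end

section \<open>Labels of the prolonged system and supports of its polynomials\<close>

locale labelled = gsys P for P +
  fixes B :: "'d::finite labelling" and T :: "nat \<Rightarrow> 'd expo"
  assumes lab: "valid_labelling P B" and dist: "distinguished P B T"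
begin

definition level :: "nat \<Rightarrow> nat \<Rightarrow> bool"
  where "level i k \<longleftrightarrow> i \<in> N \<and> Fin (int k) \<le> Jac P i - Fin (int (gam_sum P))"

text \<open>Labels are addressed by pairs: with \<open>hh_inj\<close> and \<open>hh_surj\<close>
  this is a bijection from the pairs satisfying \<open>level\<close> onto
  \<open>{1..size_L P}\<close>.\<close>

definition hh :: "nat \<Rightarrow> nat \<Rightarrow> nat"
  where "hh i k = lam B (dgp P i k)"

lemma ps_eq: "ps P = {dgp P i k | i k. level i k}"
  by (auto simp: ps_def level_def)

lemma rho_hh: "level i k \<Longrightarrow> rho P B (hh i k) = dgp P i k"
  unfolding rho_def hh_def
  by (rule inv_into_f_f) (use lab in \<open>auto simp: valid_labelling_def bij_betw_def ps_eq\<close>)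

lemma hh_inj: "level i k \<Longrightarrow> level i' k' \<Longrightarrow> hh i k = hh i' k' \<longleftrightarrow> i = i' \<and> k = k'"
  using rho_hh[of i k] rho_hh[of i' k'] dgp_inj[where P = P and i = i and k = k and i' = i' and k' = k'] by auto

lemma hh_range: "level i k \<Longrightarrow> hh i k \<in> {1..size_L P}"
  using lab bij_betwE[of "lam B" "ps P"] unfolding valid_labelling_def hh_def ps_eq by blast

lemma hh_surj: "h \<in> {1..size_L P} \<Longrightarrow> \<exists>i k. level i k \<and> h = hh i k"
  using lab bij_betw_imp_surj_on[of "lam B" "ps P"] unfolding valid_labelling_def hh_def ps_eq by blast

lemma inj_ups: "inj (ups B)" and range_ups: "range (ups B) = ps_vars P"
  using lab by (auto simp: valid_labelling_def bij_betw_def)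

lemma lookup_ups_mono: "lookup (ups_mono B \<alpha>) (ups B y) = lookup \<alpha> y"
proof -
  have "lookup (ups_mono B \<alpha>) (ups B y) = (\<Sum>x\<in>keys \<alpha>. if x = y then lookup \<alpha> x else 0)"
    unfolding ups_mono_def lookup_sum_poly
    by (rule sum.cong) (auto simp: lookup_single when_def inj_eq[OF inj_ups])
  then show ?thesis by (auto simp: in_keys_iff)
qed

lemma lookup_ups_mono_0: "v \<notin> range (ups B) \<Longrightarrow> lookup (ups_mono B \<alpha>) v = 0"
  unfolding ups_mono_def lookup_sum_poly by (intro sum.neutral) (auto simp: lookup_single when_def)

lemma inj_ups_mono: "ups_mono B \<alpha> = ups_mono B \<beta> \<longleftrightarrow> \<alpha> = \<beta>"
  by (metis lookup_ups_mono poly_mapping_eqI)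

lemma ups_mono_diff: "ups_mono B (\<alpha> - \<beta>) = ups_mono B \<alpha> - ups_mono B \<beta>"
proof (rule poly_mapping_eqI)
  fix v
  show "lookup (ups_mono B (\<alpha> - \<beta>)) v = lookup (ups_mono B \<alpha> - ups_mono B \<beta>) v"
    by (cases "v \<in> range (ups B)") (auto simp: lookup_minus lookup_ups_mono lookup_ups_mono_0)
qed

lemma keys_ups_mono: "ups B ` keys \<alpha> = keys (ups_mono B \<alpha>)"
proof (rule Set.set_eqI)
  fix v
  show "v \<in> ups B ` keys \<alpha> \<longleftrightarrow> v \<in> keys (ups_mono B \<alpha>)"
    by (cases "v \<in> range (ups B)") (auto simp: in_keys_iff lookup_ups_mono lookup_ups_mono_0 inj_image_mem_iff[OF inj_ups])
qed

lemma ups_mono_surj: "keys m \<subseteq> ps_vars P \<Longrightarrow> \<exists>\<alpha>. ups_mono B \<alpha> = m"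
proof -
  assume m: "keys m \<subseteq> ps_vars P"
  let ?\<alpha> = "\<Sum>y\<in>UNIV. single y (lookup m (ups B y))"
  have l: "lookup ?\<alpha> y = lookup m (ups B y)" for y
    unfolding lookup_sum_poly by (simp add: lookup_single when_def)
  have "ups_mono B ?\<alpha> = m"
  proof (rule poly_mapping_eqI)
    fix v
    show "lookup (ups_mono B ?\<alpha>) v = lookup m v"
    proof (cases "v \<in> range (ups B)")
      case True
      then obtain y where "v = ups B y" by blast
      then show ?thesis by (simp only: lookup_ups_mono l)
    next
      case False
      then have "v \<notin> keys m" using m range_ups by blast
      then show ?thesis using lookup_ups_mono_0[OF False] by (simp only: in_keys_iff not_not)
    qed
  qed
  then show ?thesis by blast
qed

lemma supp_hh: "level i k \<Longrightarrow> \<alpha> \<in> supp P B (hh i k) \<longleftrightarrow> ups_mono B \<alpha> \<in> keys (dgp P i k)"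
  by (simp add: supp_def rho_hh in_keys_iff)

text \<open>The order bounds place all variables of these polynomials in \<open>ps_vars P\<close>,
  the range of \<open>ups B\<close>, so no term is lost in the algebraic system.\<close>

lemma ups_mono_supp: "level i k \<Longrightarrow> ups_mono B ` supp P B (hh i k) = keys (dgp P i k)"
proof
  assume l: "level i k"
  show "ups_mono B ` supp P B (hh i k) \<subseteq> keys (dgp P i k)" using supp_hh[OF l] by auto
  show "keys (dgp P i k) \<subseteq> ups_mono B ` supp P B (hh i k)"
  proof
    fix m assume m: "m \<in> keys (dgp P i k)"
    then have "keys m \<subseteq> ps_vars P"
      using dgp_ps_vars[of i k] l by (force simp: level_def lvars_def)
    then obtain \<alpha> where "ups_mono B \<alpha> = m" using ups_mono_surj by blast
    then show "m \<in> ups_mono B ` supp P B (hh i k)" using supp_hh[OF l] m by blast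
  qed
qed

lemma finite_supp: "h \<in> {1..size_L P} \<Longrightarrow> finite (supp P B h)"
proof -
  assume "h \<in> {1..size_L P}"
  then obtain i k where l: "level i k" "h = hh i k" using hh_surj by blast
  have "finite (ups_mono B ` supp P B h)" using ups_mono_supp[OF l(1)] l(2) by simp
  then show ?thesis by (rule finite_imageD) (simp add: inj_on_def inj_ups_mono)
qed

lemma Xi_var: "Xi P B (var (h, \<alpha>)) = lookup (rho P B h) (ups_mono B \<alpha>)"
  by (simp add: Xi_def peval_var[OF rhom_cst])

lemma T_supp: "h \<in> {1..size_L P} \<Longrightarrow> T h \<in> supp P B h"
  using dist by (auto simp: distinguished_def)

text \<open>\<open>distinguished\<close> prescribes the specialized coefficient, and by
  \<open>top_var_iff\<close> only one monomial carries it. In particular \<open>T (hh i k)\<close>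
  does not depend on \<open>k\<close>.\<close>

lemma ups_mono_T: "level i k \<Longrightarrow> ups_mono B (T (hh i k)) = monom_at P i 0"
proof -
  assume l: "level i k"
  have "Xi P B (var (hh i k, T (hh i k))) = var ((i, 0), k)"
    using dist hh_range[OF l] rho_hh[OF l] l by (auto simp: distinguished_def level_def)
  then have "lookup (dgp P i k) (ups_mono B (T (hh i k))) = var ((i, 0), k)" by (simp add: Xi_var rho_hh[OF l])
  then show ?thesis using top_var_iff[where P = P and i = i and k = k and \<mu> = "ups_mono B (T (hh i k))"] by simp
qed

lemma T_eq: "level i k \<Longrightarrow> level i k' \<Longrightarrow> T (hh i k) = T (hh i k')"
  using ups_mono_T inj_ups_mono by metis

lemma supp_mono: "level i k \<Longrightarrow> level i k' \<Longrightarrow> k \<le> k' \<Longrightarrow> supp P B (hh i k) \<subseteq> supp P B (hh i k')"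
  using lookup_deriv_gpoly_mono[where P = P and i = i and k = k and k' = k'] by (auto simp: supp_hh in_keys_iff)

lemma level_down: "level i k \<Longrightarrow> k' \<le> k \<Longrightarrow> level i k'"
proof -
  assume l: "level i k" "k' \<le> k"
  then have "Fin (int k') \<le> Fin (int k)" by simp
  then show ?thesis using l order_trans unfolding level_def by blast
qed

lemma admissible_level: "admissible P \<tau> \<Longrightarrow> i \<in> N \<Longrightarrow> Fin (int k) \<le> \<tau> i \<Longrightarrow> level i k"
  unfolding admissible_def level_def by (metis order_trans)

lemma PS_levels: "lam B ` PS P \<tau> = {hh i k | i k. i \<in> N \<and> Fin (int k) \<le> \<tau> i}"
  by (auto simp: PS_def hh_def)

lemma Xi_ring_D:
  assumes "p \<in> poly_over (ags_coeffs P B)"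
  shows "Xi P B p \<in> ring_D P"
  unfolding Xi_def
proof (rule peval_closed)
  fix x assume "x \<in> vars p"
  then obtain h \<alpha> where x: "x = (h, \<alpha>)" "h \<in> {1..size_L P}"
    using assms by (auto simp: poly_over_def ags_coeffs_def)
  then obtain i k where l: "level i k" "h = hh i k" using hh_surj by blast
  have "dgp P i k \<in> ring_DU P" using deriv_iter_ring_DU[OF gpoly_ring_DU] l by (simp add: level_def)
  then show "(case x of (h, \<alpha>) \<Rightarrow> lookup (rho P B h) (ups_mono B \<alpha>)) \<in> ring_D P"
    by (simp add: x l rho_hh[OF l(1)] ring_DU_def laurent_over_iff ring_D_def)
qed (auto simp: ring_D_def poly_over_add poly_over_mult)

text \<open>The \<open>LEAST\<close> in \<open>tau_of\<close> is attained: in component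
  \<open>i\<close> the least tuple has the largest order whose coefficients occur in
  \<open>Q\<close>, or \<open>Minf\<close> if there is none.\<close>

lemma tau_of_admissible:
  assumes Q: "Q \<in> poly_over (ags_coeffs P B)"
  shows "admissible P (tau_of P B Q) \<and> Q \<in> poly_over (coeffs_tau P B (tau_of P B Q))"
proof -
  define K where "K i = {k. level i k \<and> (\<exists>\<alpha>. (hh i k, \<alpha>) \<in> vars Q)}" for i
  define \<tau> where "\<tau> i = (if K i = {} then Minf else Fin (int (Max (K i))))" for i
  have finK: "finite (K i)" for i
  proof (rule finite_imageD)
    have "hh i k \<in> fst ` vars Q" if "k \<in> K i" for k
      using that by (auto simp: K_def intro: rev_image_eqI)
    then have "hh i ` K i \<subseteq> fst ` vars Q" by (rule image_subsetI)
    then show "finite (hh i ` K i)" by (rule finite_subset) simp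
    show "inj_on (hh i) (K i)" by (auto simp: inj_on_def K_def hh_inj)
  qed
  have Kmem: "Max (K i) \<in> K i" if "K i \<noteq> {}" for i using finK that by (rule Max_in)
  have adm: "admissible P \<tau>"
    unfolding admissible_def
  proof
    fix i
    have "K i = {}" if "i \<notin> N" using that by (auto simp: K_def level_def)
    moreover have "level i (Max (K i))" if "K i \<noteq> {}" using Kmem[OF that] by (simp add: K_def)
    ultimately show "if i \<in> N then (\<tau> i = Minf \<or> (\<exists>k. \<tau> i = Fin (int k))) \<and> \<tau> i \<le> Jac P i - Fin (int (gam_sum P)) else \<tau> i = Minf"
      by (auto simp: \<tau>_def level_def)
  qed
  have Q\<tau>: "Q \<in> poly_over (coeffs_tau P B \<tau>)"
    unfolding poly_over_def mem_Collect_eq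
  proof
    fix x assume x: "x \<in> vars Q"
    obtain h \<alpha> where h: "x = (h, \<alpha>)" "h \<in> {1..size_L P}" "\<alpha> \<in> supp P B h"
      using Q x by (auto simp: poly_over_def ags_coeffs_def)
    obtain i k where l: "level i k" "h = hh i k" using hh_surj[OF h(2)] by blast
    then have "k \<in> K i" using h x by (auto simp: K_def)
    then have "Fin (int k) \<le> \<tau> i" using finK by (auto simp: \<tau>_def)
    then have "h \<in> lam B ` PS P \<tau>" using l by (auto simp: PS_levels level_def)
    then show "x \<in> coeffs_tau P B \<tau>" using h by (simp add: coeffs_tau_def)
  qed
  have "tau_of P B Q = \<tau>"
    unfolding tau_of_def
  proof (rule Least_equality)
    fix \<tau>' assume \<tau>': "admissible P \<tau>' \<and> Q \<in> poly_over (coeffs_tau P B \<tau>')"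
    show "\<tau> \<le> \<tau>'"
    proof (rule le_funI)
      fix i
      show "\<tau> i \<le> \<tau>' i"
      proof (cases "K i = {}")
        case False
        then obtain \<alpha> where l: "level i (Max (K i))" "(hh i (Max (K i)), \<alpha>) \<in> vars Q" using Kmem by (auto simp: K_def)
        then have "hh i (Max (K i)) \<in> lam B ` PS P \<tau>'"
          using \<tau>' by (auto simp: poly_over_def coeffs_tau_def)
        then obtain i' k' where *: "hh i (Max (K i)) = hh i' k'" "i' \<in> N" "Fin (int k') \<le> \<tau>' i'" by (auto simp: PS_levels)
        then have "i' = i" "k' = Max (K i)"
          using hh_inj[OF l(1) admissible_level[OF conjunct1[OF \<tau>'] *(2,3)]] by auto
        then show ?thesis using * False by (simp add: \<tau>_def)
      qed (simp add: \<tau>_def)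
    qed
  qed (use adm Q\<tau> in blast)
  then show ?thesis using adm Q\<tau> by simp
qed

end

section \<open>The codimension hypothesis\<close>

lemma primeideal_kernel:
  fixes c :: "'x \<Rightarrow> 'f::field_char_0"
  shows "primeideal {p\<in>poly_over V. peval of_rat c p = 0} (ring_on (poly_over V))"
proof (rule primeidealI)
  note [simp] = peval_add[OF rhom_of_rat] peval_mult[OF rhom_of_rat] rhom_1[OF rhom_peval[OF rhom_of_rat]]
  show "ideal {p\<in>poly_over V. peval of_rat c p = 0} (ring_on (poly_over V))"
    unfolding ideal_ring_on_iff[OF subring_set_poly_over] by (auto intro: poly_over_add poly_over_mult)
  show "cring (ring_on (poly_over V))" by (rule cring_ring_on[OF subring_set_poly_over])
  show "carrier (ring_on (poly_over V)) \<noteq> {p\<in>poly_over V. peval of_rat c p = 0}"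
    by (auto simp: set_eq_iff intro!: exI[of _ 1])
qed (auto simp: peval_mult[OF rhom_of_rat])

text \<open>A nonempty set of extended naturals contains its infimum, and an empty one would give
  \<open>\<infinity>\<close>.\<close>

lemma ideal_codim_attained:
  assumes "ideal_codim K I \<noteq> \<infinity>"
  shows "\<exists>\<pp>. primeideal \<pp> K \<and> I \<subseteq> \<pp> \<and> prime_height K \<pp> = ideal_codim K I"
proof -
  let ?S = "{prime_height K \<pp> | \<pp>. primeideal \<pp> K \<and> I \<subseteq> \<pp>}"
  have "?S \<noteq> {}"
  proof
    assume "?S = {}"
    then have "ideal_codim K I = Inf {}" unfolding ideal_codim_def by (rule arg_cong)
    then show False using assms by (simp add: Inf_enat_def)
  qed
  then have "Inf ?S \<in> ?S"
    unfolding Inf_enat_def by (auto intro: LeastI)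
  then show ?thesis by (auto simp: ideal_codim_def)
qed

lemma prime_height_ge_2:
  assumes "primeideal I0 K" "primeideal I1 K" "primeideal I2 K" "I0 \<subset> I1" "I1 \<subset> I2"
  shows "prime_height K I2 \<ge> 2"
proof -
  let ?c = "\<lambda>i::nat. if i = 0 then I0 else if i = 1 then I1 else I2"
  have "(\<forall>i\<le>2. primeideal (?c i) K) \<and> (\<forall>i<2. ?c i \<subset> ?c (Suc i)) \<and> ?c 2 = I2"
    using assms by (auto simp: less_2_cases_iff)
  then have "enat 2 \<in> {enat k | k. \<exists>c. (\<forall>i\<le>k. primeideal (c i) K) \<and> (\<forall>i<k. c i \<subset> c (Suc i)) \<and> c k = I2}"
    unfolding mem_Collect_eq by (intro exI[of _ 2] conjI[OF refl] exI[of _ ?c])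
  then have "enat 2 \<le> prime_height K I2"
    unfolding prime_height_def by (rule Sup_upper)
  then show ?thesis by (simp add: numeral_eq_enat)
qed

text \<open>The generic values of the coefficients \<open>\<aa>\<close>, of the indeterminates \<open>c\<close> and of the \<open>u\<close>. Only the \<open>\<aa>\<close> in
  \<open>non_leading\<close> take their generic value at the point \<open>pt\<close>; the others serve as free parameters.\<close>

locale generic_values = labelled P B T
  for P and B :: "'d::finite labelling" and T +
  fixes gg :: "((nat \<times> nat) \<times> nat) + ((nat \<times> 'd expo) + (nat \<times> nat)) \<Rightarrow> 'f::field_char_0"
  assumes gg: "indep UNIV gg"
begin

abbreviation "av x \<equiv> gg (Inl x)"
abbreviation "cv s \<equiv> gg (Inr (Inl s))"
abbreviation "uv v \<equiv> gg (Inr (Inr v))"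

lemma gg_der: "\<exists>D. is_der D \<and> (\<forall>z. D (gg z) = (if z = y then 1 else 0))"
  using indep_dual_derivation[OF gg, of y] by simp

lemma generic_av: "indep (Inl ` (non_leading \<times> UNIV) \<union> range Inr) (case_sum av uv)"
proof -
  have "indep UNIV (gg \<circ> case_sum Inl (Inr \<circ> Inr))"
    by (rule indep_reindex[OF indep_mono[OF gg]]) (auto simp: inj_def split: sum.splits)
  also have "gg \<circ> case_sum Inl (Inr \<circ> Inr) = case_sum av uv"
    by (auto simp: fun_eq_iff split: sum.splits)
  finally show ?thesis by (rule indep_mono) simp
qed

sublocale generic_point P av uv
  by unfold_locales (rule generic_av)

section \<open>Values of the substitution \<open>eps\<close> at generic arguments\<close>

definition mn :: "nat \<Rightarrow> 'd expo \<Rightarrow> 'f"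
  where "mn h \<alpha> = lmon uv (ups_mono B (\<alpha> - T h))"

definition eps_value :: "(nat \<times> 'd expo \<Rightarrow> 'f) \<Rightarrow> nat \<Rightarrow> 'f"
  where "eps_value c h = - (\<Sum>\<alpha>\<in>supp P B h - {T h}. c (h, \<alpha>) * mn h \<alpha>)"

abbreviation "ep \<equiv> eps_value cv"

text \<open>The argument \<open>c\<close> is kept general: besides \<open>cv\<close>, it is later a
  mixture that agrees with the generic zero on the levels of \<open>R\<close>.\<close>

definition eps_slots :: "(nat \<times> 'd expo \<Rightarrow> 'f) \<Rightarrow> nat \<times> 'd expo \<Rightarrow> 'f"
  where "eps_slots c = (\<lambda>(h, \<alpha>). if \<alpha> = T h then eps_value c h else c (h, \<alpha>))"

abbreviation "ceps \<equiv> eps_slots cv"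

definition yv :: "'d \<Rightarrow> 'f"
  where "yv y = uv (ups B y)"

lemma lmon_ups_mono: "lmon uv (ups_mono B \<alpha>) = lmon yv \<alpha>"
proof -
  have "lmon uv (ups_mono B \<alpha>) = (\<Prod>v\<in>ups B ` keys \<alpha>. uv v powi lookup (ups_mono B \<alpha>) v)"
    by (simp add: lmon_def keys_ups_mono)
  also have "\<dots> = lmon yv \<alpha>"
    by (subst prod.reindex) (auto simp: lmon_def yv_def lookup_ups_mono intro: inj_on_subset[OF inj_ups])
  finally show ?thesis .
qed

definition non_dist :: "(nat \<times> 'd expo) set"
  where "non_dist = {(h, \<alpha>). \<alpha> \<noteq> T h}"

lemma generic_cv: "indep (Inl ` non_dist \<union> range Inr) (case_sum cv yv)"
proof -
  have "indep UNIV (gg \<circ> case_sum (Inr \<circ> Inl) (Inr \<circ> Inr \<circ> ups B))"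
    by (rule indep_reindex[OF indep_mono[OF gg]]) (use inj_ups in \<open>auto simp: inj_def split: sum.splits\<close>)
  also have "gg \<circ> case_sum (Inr \<circ> Inl) (Inr \<circ> Inr \<circ> ups B) = case_sum cv yv"
    by (auto simp: fun_eq_iff yv_def split: sum.splits)
  finally show ?thesis by (rule indep_mono) simp
qed

lemma yv_neq_0: "yv y \<noteq> 0"
  using u_neq_0 by (simp add: yv_def)

lemma rhom_lev_yv: "rhom (leval yv (peval (of_rat :: rat \<Rightarrow> 'f) g))"
  by (rule rhom_leval[OF rhom_ev yv_neq_0])

lemma leval_subst_eps: "leval yv (peval of_rat c) (subst_eps P B T p) = peval of_rat (eps_slots c) p"
proof -
  have "leval yv (peval of_rat c) (eps P B T h) = eps_value c h" for h
    by (simp add: eps_def rhom_uminus[OF rhom_lev_yv] leval_sum[OF rhom_ev] leval_single[OF rhom_ev] peval_var[OF rhom_of_rat]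
      eps_value_def mn_def lmon_ups_mono)
  then show ?thesis
    unfolding subst_eps_def peval_hom[OF rhom_lev_yv]
    by (intro arg_cong2[where f = "\<lambda>\<phi> g. peval \<phi> g p"])
      (auto simp: eps_slots_def leval_cst[OF rhom_ev] peval_cst[OF rhom_of_rat] peval_var[OF rhom_of_rat] fun_eq_iff)
qed

lemma subst_eps_non_dist: "subst_eps P B T p \<in> laurent_over (poly_over non_dist) UNIV"
proof -
  have S: "subring_set (laurent_over (poly_over non_dist) (UNIV :: 'd set))"
    by (intro subring_set_laurent_over subring_set_poly_over)
  have c: "cst q \<in> laurent_over (poly_over non_dist) (UNIV :: 'd set)" if "q \<in> poly_over non_dist" for q
    unfolding cst_def by (rule laurent_over_single[OF that]) auto
  have "eps P B T h \<in> laurent_over (poly_over non_dist) UNIV" for h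
    unfolding eps_def
    by (intro laurent_over_uminus laurent_over_sum laurent_over_single subring_set_poly_over)
      (auto simp: poly_over_var non_dist_def)
  then show ?thesis
    unfolding subst_eps_def
    by (intro peval_closed) (use subring_setD[OF S] c in \<open>auto simp: poly_over_var non_dist_def\<close>)
qed

lemma peval_ceps_iff: "peval of_rat ceps p = 0 \<longleftrightarrow> subst_eps P B T p = 0"
  using leval_generic_eq_0[OF generic_cv subst_eps_non_dist, of p] leval_subst_eps[of cv p] by auto

text \<open>\<open>P\<^sub>h\<close> divided by its distinguished monomial is
  \<open>c\<^sub>h\<close> minus \<open>eps\<close>, so modulo the ideal a polynomial is congruent
  to its substitution, which is zero here.\<close>

lemma kernel_subset_elim:
  assumes \<tau>: "admissible P \<tau>" and p: "p \<in> poly_over (coeffs_tau P B \<tau>)" "peval of_rat ceps p = 0"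
  shows "p \<in> elim_ideal P B \<tau>"
proof -
  let ?A = "laurent_over (poly_over (coeffs_tau P B \<tau>)) (ups B -` vars_upto P \<tau>)"
  let ?I = "ideal_S_tau P B \<tau>"
  note SP = subring_set_poly_over[of "coeffs_tau P B \<tau>"]
  have S: "subring_set ?A" by (rule subring_set_laurent_over[OF SP])
  have cA: "cst q \<in> ?A" if "q \<in> poly_over (coeffs_tau P B \<tau>)" for q
    unfolding cst_def by (rule laurent_over_single[OF that]) auto
  have kA: "keys \<alpha> \<subseteq> ups B -` vars_upto P \<tau>" if h: "h \<in> lam B ` PS P \<tau>" "\<alpha> \<in> supp P B h" for h \<alpha>
  proof -
    obtain i k where l: "h = hh i k" "i \<in> N" "Fin (int k) \<le> \<tau> i" using h(1) PS_levels by auto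
    then have "ups_mono B \<alpha> \<in> keys (dgp P i k)"
      using h(2) supp_hh admissible_level[OF \<tau>] by blast
    then have "keys (ups_mono B \<alpha>) \<subseteq> vars_upto P \<tau>"
      using dgp_vars_upto[of i k \<tau>] l by (force simp: lvars_def)
    then show ?thesis using keys_ups_mono by blast
  qed
  have hL: "h \<in> {1..size_L P}" if "h \<in> lam B ` PS P \<tau>" for h
    using that hh_range admissible_level[OF \<tau>] by (auto simp: PS_levels)
  have slot: "var (h, \<alpha>) \<in> poly_over (coeffs_tau P B \<tau>)" if "h \<in> lam B ` PS P \<tau>" "\<alpha> \<in> supp P B h" for h \<alpha>
    using that by (simp add: poly_over_var coeffs_tau_def)
  have ags: "ags_poly P B h \<in> ?A" if "h \<in> lam B ` PS P \<tau>" for h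
    unfolding ags_poly_def using that kA slot by (intro laurent_over_sum[OF SP] laurent_over_single)
  interpret cring "ring_on ?A" by (rule cring_ring_on[OF S])
  have I: "ideal ?I (ring_on ?A)"
    unfolding ideal_S_tau_def by (rule genideal_ideal) (use ags in auto)
  have gen: "ags_poly P B h \<in> ?I" if "h \<in> lam B ` PS P \<tau>" for h
    unfolding ideal_S_tau_def using genideal_self[of "ags_poly P B ` lam B ` PS P \<tau>"] ags that by auto
  note I' = I[unfolded ideal_ring_on_iff[OF S]]
  let ?\<sigma> = "\<lambda>(h, \<alpha>). if \<alpha> = T h then eps P B T h else cst (var (h, \<alpha>))"
  have kAT: "keys (\<alpha> - T h) \<subseteq> ups B -` vars_upto P \<tau>" if "h \<in> lam B ` PS P \<tau>" "\<alpha> \<in> supp P B h" for h \<alpha>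
    using keys_monom_diff[of \<alpha> "T h"] kA[OF that] kA[OF that(1) T_supp[OF hL[OF that(1)]]] by blast
  have eps_A: "eps P B T h \<in> ?A" if "h \<in> lam B ` PS P \<tau>" for h
    unfolding eps_def using that kAT slot
    by (intro laurent_over_uminus[OF SP] laurent_over_sum[OF SP] laurent_over_single) auto
  have "cst p - peval (\<lambda>c. cst (cst c)) ?\<sigma> p \<in> ?I"
  proof (rule cst_minus_peval[where A = ?A, OF _ _ _ _ _ _ p(1)])
    fix x assume "x \<in> coeffs_tau P B \<tau>"
    then obtain h \<alpha> where x: "x = (h, \<alpha>)" "h \<in> lam B ` PS P \<tau>" "\<alpha> \<in> supp P B h" by (auto simp: coeffs_tau_def)
    show "?\<sigma> x \<in> ?A" using x eps_A cA slot by auto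
    show "cst (var x) - ?\<sigma> x \<in> ?I"
    proof (cases "\<alpha> = T h")
      case True
      have "supp P B h = insert (T h) (supp P B h - {T h})" using x(3) True by auto
      then have "ags_poly P B h = single (T h) (var (h, T h)) + (\<Sum>\<alpha>\<in>supp P B h - {T h}. single \<alpha> (var (h, \<alpha>)))"
        unfolding ags_poly_def using finite_supp[OF hL[OF x(2)]] by (metis (no_types, lifting) Diff_iff finite_Diff insertI1 sum.insert)
      then have "ags_poly P B h * single (- T h) 1 = cst (var x) - eps P B T h"
        by (simp add: True x(1) eps_def distrib_right mult_single sum_distrib_right cst_def)
      moreover have "single (- T h) 1 \<in> ?A"
        using kA[OF x(2) T_supp[OF hL[OF x(2)]]] by (intro laurent_over_single) auto
      ultimately have "cst (var x) - eps P B T h \<in> ?I" using I' gen[OF x(2)] by metis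
      then show ?thesis using True x by simp
    next
      case False
      then show ?thesis using x I' by simp
    qed
  qed (use cA I' in auto)
  moreover have "peval (\<lambda>c. cst (cst c)) ?\<sigma> p = 0"
    using peval_ceps_iff p(2) by (simp add: subst_eps_def)
  ultimately show ?thesis using p(1) by (simp add: elim_ideal_def)
qed

lemma ep_der:
  assumes D: "is_der D" "\<And>s. s \<in> non_dist \<Longrightarrow> fst s = h \<Longrightarrow> snd s \<in> supp P B h \<Longrightarrow> D (cv s) = 0"
    "\<And>\<alpha>. \<alpha> \<in> supp P B h \<Longrightarrow> D (mn h \<alpha>) = 0"
  shows "D (ep h) = 0"
  unfolding eps_value_def der_uminus[OF D(1)] der_sum[OF D(1)]
  by (simp, intro sum.neutral) (auto simp: der_mult[OF D(1)] D(3) intro!: D(2) simp: non_dist_def)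

lemma mn_der: "is_der D \<Longrightarrow> (\<And>v. D (uv v) = 0) \<Longrightarrow> D (mn h \<alpha>) = 0"
  unfolding mn_def by (rule der_lmon_0[OF _ u_neq_0]) auto

text \<open>If no distinguished slot could be freed, an element of the kernel of least total degree
  would not involve any distinguished slot.\<close>

lemma codim_one_independent:
  assumes \<tau>: "admissible P \<tau>" and ne: "lam B ` PS P \<tau> \<noteq> {}"
    and codim: "ideal_codim (ring_on (poly_over (coeffs_tau P B \<tau>))) (elim_ideal P B \<tau>) = 1"
  shows "\<exists>h\<in>lam B ` PS P \<tau>. indep (coeffs_tau P B \<tau> - {(h, T h)}) ceps"
proof -
  let ?V = "coeffs_tau P B \<tau>" and ?S = "lam B ` PS P \<tau>"
  let ?ker = "\<lambda>c :: nat \<times> 'd expo \<Rightarrow> 'f. {p\<in>poly_over ?V. peval of_rat c p = 0}"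
  let ?K = "ring_on (poly_over ?V)"
  \<comment> \<open>Any index serves: \<open>av t\<close> is independent of everything that enters
    \<open>ceps\<close> and supplies a free value for one slot.\<close>
  define t :: "(nat \<times> nat) \<times> nat" where "t = ((0, 0), 0)"
  obtain \<pp> where \<pp>: "primeideal \<pp> ?K" "elim_ideal P B \<tau> \<subseteq> \<pp>" "prime_height ?K \<pp> = 1"
    using ideal_codim_attained[of ?K "elim_ideal P B \<tau>"] codim by auto
  let ?c = "\<lambda>h. ceps((h, T h) := av t)"
  obtain D where D: "is_der D" "\<And>z. D (gg z) = (if z = Inl t then 1 else 0)" using gg_der by blast
  have Dep: "D (ep h) = 0" for h
    by (rule ep_der[OF D(1)]) (auto intro!: mn_der[OF D(1)] simp: D(2))
  have Dc: "D (?c h z) = (if z = (h, T h) then 1 else 0)" for h z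
    using Dep D(2) by (cases z) (auto simp: eps_slots_def)
  \<comment> \<open>A relation that holds with the free value in a slot holds for every value there,
    in particular for the special one.\<close>
  have sub: "?ker (?c h) \<subseteq> ?ker ceps" for h
  proof
    fix p assume "p \<in> ?ker (?c h)"
    then have p: "p \<in> poly_over ?V" "peval of_rat (?c h) p = 0" by auto
    have "peval of_rat ceps p = 0"
    proof (rule peval_dual_ders[of "{(h, T h)}" p ?V "?c h"])
      fix x assume "x \<in> {(h, T h)}"
      then show "\<exists>D. is_der D \<and> D (?c h x) = 1 \<and> (\<forall>z\<in>?V. z \<noteq> x \<longrightarrow> D (?c h z) = 0)"
        using D(1) Dc by (intro exI[of _ D]) (simp del: fun_upd_apply)
    qed (use p in auto)
    then show "p \<in> ?ker ceps" using p by simp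
  qed
  have ker_p: "?ker ceps \<subseteq> \<pp>" using kernel_subset_elim[OF \<tau>] \<pp>(2) by auto
  have ind: "indep ?V (\<lambda>s. cv s)"
    using indep_mono[OF indep_reindex[OF indep_mono[OF gg], of "Inr \<circ> Inl" UNIV]] by (auto simp: comp_def inj_def)
  then have zero: "?ker cv = {0}" by (auto simp: indep_def)
  have z_in: "0 \<in> ?ker c" for c by simp
  \<comment> \<open>If freeing the slot shrinks the kernel, but not to zero, then zero, the new
    kernel and \<open>\<pp>\<close> form a chain of primes of length two, against height
    one.\<close>
  have ker0: "indep ?V (?c h)" if "?ker (?c h) \<noteq> ?ker ceps" for h
  proof (rule ccontr)
    assume "\<not> indep ?V (?c h)"
    then have "?ker (?c h) \<noteq> {0}" by (auto simp: indep_def)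
    then have "?ker cv \<subset> ?ker (?c h)" unfolding zero using z_in by blast
    moreover have "?ker (?c h) \<subset> \<pp>" using that sub ker_p by blast
    ultimately have "2 \<le> prime_height ?K \<pp>"
      using prime_height_ge_2[OF primeideal_kernel[of ?V cv] primeideal_kernel[of ?V "?c h"] \<pp>(1)] by blast
    then show False using \<pp>(3) by (simp add: one_enat_def numeral_eq_enat)
  qed
  show ?thesis
  proof (cases "\<exists>h\<in>?S. indep ?V (?c h)")
    case True
    then obtain h where h: "h \<in> ?S" "indep ?V (?c h)" by blast
    have "indep (?V - {(h, T h)}) ceps"
      unfolding indep_def
    proof (intro ballI impI)
      fix p assume p: "p \<in> poly_over (?V - {(h, T h)})" "peval of_rat ceps p = 0"
      have "peval of_rat (?c h) p = peval of_rat ceps p"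
        by (rule peval_cong) (use p in \<open>auto simp: poly_over_def\<close>)
      then show "p = 0" using p h(2) poly_over_mono[of "?V - {(h, T h)}" ?V] by (auto simp: indep_def)
    qed
    then show ?thesis using h by blast
  next
    case False
    then have eq: "?ker (?c h) = ?ker ceps" if "h \<in> ?S" for h using ker0 that by blast
    have "?ker ceps = {0}"
    proof (rule ccontr)
      assume "?ker ceps \<noteq> {0}"
      then have "\<exists>g. g \<in> ?ker ceps \<and> g \<noteq> 0" using z_in by blast
      then obtain g where g: "g \<in> ?ker ceps" "g \<noteq> 0" "\<And>g'. g' \<in> ?ker ceps \<Longrightarrow> g' \<noteq> 0 \<Longrightarrow> tdeg g \<le> tdeg g'"
        using ex_has_least_nat[of "\<lambda>g. g \<in> ?ker ceps \<and> g \<noteq> 0" _ tdeg] by blast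
      have free: "(h, T h) \<notin> vars g" if h: "h \<in> ?S" for h
      proof -
        have gc: "peval of_rat (?c h) g = 0" using g(1) eq[OF h] by blast
        have "D (peval of_rat (?c h) g) = peval of_rat (?c h) (pdiff (h, T h) g) * D (?c h (h, T h))"
          by (rule der_peval_1[OF D(1)]) (simp add: Dc del: fun_upd_apply)
        then have "peval of_rat (?c h) (pdiff (h, T h) g) = 0"
          using gc Dc[of h "(h, T h)"] der_0[OF D(1)] by simp
        then have "pdiff (h, T h) g \<in> ?ker (?c h)" using g(1) by (auto intro: pdiff_poly_over)
        then have "pdiff (h, T h) g = 0"
          using eq[OF h] g(3)[of "pdiff (h, T h) g"] tdeg_pdiff[of "(h, T h)" g] by fastforce
        then show ?thesis using pdiff_eq_0_iff by metis
      qed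
      have "peval of_rat cv g = peval of_rat ceps g"
        by (rule peval_cong) (use free g(1) in \<open>fastforce simp: eps_slots_def poly_over_def coeffs_tau_def\<close>)
      then have "g = 0" using g(1) ind by (auto simp: indep_def)
      then show False using g(2) by blast
    qed
    then have "indep ?V ceps" by (auto simp: indep_def)
    then show ?thesis using ne indep_mono by blast
  qed
qed

end

section \<open>The specialization\<close>

lemma indep_image:
  assumes "indep S (x \<circ> f)"
  shows "indep (f ` S) x"
  unfolding indep_def
proof (intro ballI impI)
  fix p assume p: "p \<in> poly_over (f ` S)" "peval of_rat x p = 0"
  let ?q = "peval cst (\<lambda>y. var (inv_into S f y)) p"
  have "peval of_rat (x \<circ> f) ?q = peval of_rat (\<lambda>y. (x \<circ> f) (inv_into S f y)) p"
    by (simp add: peval_hom[OF rhom_peval[OF rhom_of_rat]] peval_cst[OF rhom_of_rat] peval_var[OF rhom_of_rat])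
  also have "\<dots> = peval of_rat x p"
    by (rule peval_cong) (use p in \<open>auto simp: poly_over_def f_inv_into_f\<close>)
  finally have "peval of_rat (x \<circ> f) ?q = 0" using p(2) by simp
  moreover have "?q \<in> poly_over S"
    by (rule peval_closed) (use p in \<open>auto simp: poly_over_add poly_over_mult poly_over_var poly_over_def[of "f ` S"] intro: inv_into_into\<close>)
  ultimately have "?q = 0" using assms indepD by blast
  then have "peval cst (\<lambda>z. var (f z)) ?q = 0" by simp
  then have "peval cst (\<lambda>y. var (f (inv_into S f y))) p = 0"
    by (simp add: peval_hom[OF rhom_peval[OF rhom_cst]] peval_cst[OF rhom_cst] peval_var[OF rhom_cst])
  moreover have "peval cst (\<lambda>y. var (f (inv_into S f y))) p = peval cst var p"
    by (rule peval_cong) (use p in \<open>auto simp: poly_over_def f_inv_into_f\<close>)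
  ultimately show "p = 0" by (simp add: peval_id)
qed

lemma is_der_linear:
  fixes E :: "'i \<Rightarrow> 'f::comm_ring_1 \<Rightarrow> 'f"
  assumes "\<And>i. i \<in> A \<Longrightarrow> is_der (E i)"
  shows "is_der (\<lambda>x. \<Sum>i\<in>A. e i * E i x)"
  unfolding is_der_def
proof (intro conjI allI)
  fix a b
  show "(\<Sum>i\<in>A. e i * E i (a + b)) = (\<Sum>i\<in>A. e i * E i a) + (\<Sum>i\<in>A. e i * E i b)"
    using assms by (simp add: der_add distrib_left sum.distrib cong: sum.cong)
  show "(\<Sum>i\<in>A. e i * E i (a * b)) = a * (\<Sum>i\<in>A. e i * E i b) + (\<Sum>i\<in>A. e i * E i a) * b"
    unfolding sum_distrib_left sum_distrib_right sum.distrib[symmetric]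
    by (rule sum.cong) (use assms in \<open>auto simp: der_mult algebra_simps\<close>)
qed

text \<open>There are more dual derivations than conditions, so linear algebra gives a combination \<open>E\<close>.\<close>

lemma indep_derivation_killing:
  fixes x :: "'x \<Rightarrow> 'f::field_char_0"
  assumes ind: "indep S x" and W: "finite W" "f ` W \<subseteq> S" "inj_on f W" and C: "finite C" "card C < card W"
  shows "\<exists>E e. is_der E \<and> (\<exists>w\<in>W. e w \<noteq> 0) \<and> (\<forall>w\<in>W. E (x (f w)) = e w)
    \<and> (\<forall>j\<in>S - f ` W. E (x j) = 0) \<and> (\<forall>c\<in>C. E c = 0)"
proof -
  have "\<forall>w\<in>W. \<exists>D. is_der D \<and> (\<forall>j\<in>S. D (x j) = (if j = f w then 1 else 0))"
    using indep_dual_derivation[OF ind] W(2) by blast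
  then obtain D where D: "\<And>w. w \<in> W \<Longrightarrow> is_der (D w)" "\<And>w j. w \<in> W \<Longrightarrow> j \<in> S \<Longrightarrow> D w (x j) = (if j = f w then 1 else 0)"
    by metis
  obtain e where e: "\<exists>w\<in>W. e w \<noteq> 0" "\<forall>c\<in>C. (\<Sum>w\<in>W. e w * D w c) = 0"
    using linear_dependence[OF C(1) W(1) C(2), of D] by blast
  let ?E = "\<lambda>y. \<Sum>w\<in>W. e w * D w y"
  have "?E (x (f w)) = e w" if w: "w \<in> W" for w
  proof -
    have "?E (x (f w)) = (\<Sum>v\<in>W. if v = w then e w else 0)"
      by (rule sum.cong) (use w W D(2) in \<open>auto simp: inj_on_eq_iff[OF W(3)]\<close>)
    then show ?thesis using w W(1) by simp
  qed
  moreover have "?E (x j) = 0" if j: "j \<in> S - f ` W" for j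
    by (rule sum.neutral) (use j D(2) in auto)
  ultimately show ?thesis
    using is_der_linear[of W D e] D(1) e by (intro exI[of _ ?E] exI[of _ e]) blast
qed

locale specialization = generic_values P B T gg
  for P and B :: "'d::finite labelling" and T
    and gg :: "((nat \<times> nat) \<times> nat) + ((nat \<times> 'd expo) + (nat \<times> nat)) \<Rightarrow> 'f::field_char_0" +
  fixes R :: coeff_poly
  assumes res_R: "is_diff_resultant P R"
begin

sublocale resultant_point P av uv R
  by unfold_locales (rule res_R)

section \<open>Values of the coefficients at the generic zero\<close>

definition val :: "nat \<times> 'd expo \<Rightarrow> 'f"
  where "val = (\<lambda>(h, \<alpha>). peval of_rat pt (lookup (rho P B h) (ups_mono B \<alpha>)))"

definition res_levels :: "nat set"
  where "res_levels = {hh i k | i k. level i k \<and> ((i, 0), k) \<in> R_slots}"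

lemma val_hh: "level i k \<Longrightarrow> val (hh i k, \<alpha>) = peval of_rat pt (lookup (dgp P i k) (ups_mono B \<alpha>))"
  by (simp add: val_def rho_hh)

lemma hh_res_levels: "level i k \<Longrightarrow> hh i k \<in> res_levels \<longleftrightarrow> ((i, 0), k) \<in> R_slots"
  using hh_inj by (auto simp: res_levels_def)

lemma mn_T: "mn h (T h) = 1"
proof -
  have "ups_mono B (0 :: 'd expo) = 0" by (simp add: ups_mono_def)
  then show ?thesis by (simp add: mn_def)
qed

text \<open>The derivative vanishes at the generic zero; after division by the distinguished
  monomial, its coefficients satisfy the equation that defines \<open>eps\<close>.\<close>

lemma val_relation:
  assumes l: "level i k"
  shows "(\<Sum>\<alpha>\<in>supp P B (hh i k). val (hh i k, \<alpha>) * mn (hh i k) \<alpha>) = 0"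
proof -
  have "0 = leval uv (peval of_rat pt) (dgp P i k)" by (simp add: leval_gpoly_pt)
  also have "\<dots> = (\<Sum>m\<in>ups_mono B ` supp P B (hh i k). peval of_rat pt (lookup (dgp P i k) m) * lmon uv m)"
    by (simp add: leval_def ups_mono_supp[OF l])
  also have "\<dots> = (\<Sum>\<alpha>\<in>supp P B (hh i k). val (hh i k, \<alpha>) * lmon uv (ups_mono B \<alpha>))"
    by (subst sum.reindex) (auto simp: inj_on_def inj_ups_mono val_hh[OF l])
  also have "\<dots> = lmon uv (ups_mono B (T (hh i k))) * (\<Sum>\<alpha>\<in>supp P B (hh i k). val (hh i k, \<alpha>) * mn (hh i k) \<alpha>)"
    unfolding sum_distrib_left
    by (rule sum.cong) (simp_all add: mn_def ups_mono_diff lmon_diff[OF u_neq_0] lmon_neq_0[OF u_neq_0])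
  finally show ?thesis using lmon_neq_0[of uv "ups_mono B (T (hh i k))", OF u_neq_0] by simp
qed

lemma der_pt:
  assumes D: "is_der D" "\<And>x. x \<in> non_leading \<times> UNIV \<Longrightarrow> D (av x) = 0" "\<And>v. D (uv v) = 0"
  shows "D (pt x) = 0"
proof -
  have "D (peval of_rat av (lookup (solve P x) m)) = 0" for m
    by (rule der_peval_0[OF D(1)], rule D(2))
      (use solve_non_leading[of x] in \<open>auto simp: laurent_over_iff poly_over_def\<close>)
  then show ?thesis
    by (simp add: pt_def leval_def der_sum[OF D(1)] der_mult[OF D(1)] der_lmon_0[OF D(1) u_neq_0 D(3)])
qed

lemma gslots_level:
  assumes l: "level i k" and x: "x \<in> vars (lookup (dgp P i k) \<mu>)"
  shows "x \<in> non_leading \<times> UNIV \<and> x \<in> indets_A P \<times> UNIV \<or> (\<exists>j\<le>k. x = ((i, 0), j)) \<and> x \<in> indets_A P \<times> UNIV"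
  using vars_lookup_deriv_gpoly x l by (fastforce simp: gslots_def non_leading_def indets_A_def level_def)

text \<open>Differentiate \<open>R = 0\<close> at the generic zero and divide by the separant. One
  coordinate of \<open>R\<close> thus comes for free, which saves the decisive condition in the
  count of \<open>rigid_hit\<close>.\<close>

lemma der_R_top:
  assumes E: "is_der E" and s: "((i, 0), s) \<in> vars R" "\<And>m. m > s \<Longrightarrow> ((i, 0), m) \<notin> vars R"
    and z: "\<And>x. x \<in> vars R \<Longrightarrow> x \<noteq> ((i, 0), s) \<Longrightarrow> E (pt x) = 0"
  shows "E (pt ((i, 0), s)) = 0"
proof -
  have "E (peval of_rat pt R) = peval of_rat pt (pdiff ((i, 0), s) R) * E (pt ((i, 0), s))"
    by (rule der_peval_1[OF E z])
  then show ?thesis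
    using peval_pt_R der_0[OF E] separant_neq_0[OF s] by simp
qed

lemma vars_R: "x \<in> vars R \<Longrightarrow> x \<in> non_leading \<times> UNIV \<union> R_slots"
  by (cases x) (auto simp: non_leading_def R_slots_def)

lemma vars_R_indets: "x \<in> vars R \<Longrightarrow> x \<in> indets_A P \<times> UNIV"
  using R_ring_D by (auto simp: ring_D_def poly_over_def)

lemma der_val:
  assumes E: "is_der E" "\<And>x. x \<in> non_leading \<times> UNIV \<inter> indets_A P \<times> UNIV \<union> R_slots \<Longrightarrow> E (pt x) = 0"
    and h: "h \<in> res_levels"
  shows "E (val (h, \<alpha>)) = 0"
proof -
  obtain i k where l: "level i k" "h = hh i k" "((i, 0), k) \<in> R_slots" using h by (auto simp: res_levels_def)
  show ?thesis
    unfolding l(2) val_hh[OF l(1)]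
  proof (rule der_peval_0[OF E(1)])
    fix x assume x: "x \<in> vars (lookup (dgp P i k) (ups_mono B \<alpha>))"
    have "((i, 0), j) \<in> R_slots" if "j \<le> k" for j
      using l(3) that by (auto simp: R_slots_def intro: le_trans)
    then show "E (pt x) = 0" using gslots_level[OF l(1) x] E(2)[of x] by blast
  qed
qed

text \<open>Here the differential side suffices: by Ritt reduction with \<open>\<aa>\<close> of index \<open>i0\<close> ranked highest, the values
  of all coefficients except those of \<open>i0\<close> of order at least \<open>s\<close> are independent, so there are
  derivations dual to the levels in \<open>I\<close>.\<close>

lemma rigid_missing:
  assumes I: "finite I" "I \<subseteq> {1..size_L P}" "I \<inter> res_levels = {}" "h0 \<in> I"
    and i0: "((i0, 0), s) \<in> vars R" "\<And>m. m > s \<Longrightarrow> ((i0, 0), m) \<notin> vars R" "\<And>k. level i0 k \<Longrightarrow> hh i0 k \<notin> I"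
  shows "\<exists>E. is_der E \<and> (\<forall>s. E (cv s) = 0) \<and> (\<forall>h\<in>res_levels. \<forall>\<alpha>. E (val (h, \<alpha>)) = 0)
    \<and> (\<forall>h\<in>I - {h0}. E (ep h) = 0) \<and> (\<exists>h\<in>I. \<exists>\<alpha>\<in>supp P B h. E (mn h \<alpha>) \<noteq> 0)"
proof -
  define X where "X = indets_A P \<times> UNIV - {((i0, 0), m) | m. m \<ge> s}"
  define x where "x = case_sum pt cv"
  have "indep X pt"
    unfolding indep_def
  proof (intro ballI impI)
    fix p assume p: "p \<in> poly_over X" "peval of_rat pt p = 0"
    show "p = 0"
      by (rule vanishing_below_R[OF i0(1,2) _ p(2)]) (use p(1) in \<open>auto simp: ring_D_def poly_over_def X_def\<close>)
  qed
  then have indX: "indep (Inl ` X) x" by (intro indep_image) (simp add: x_def comp_def)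
  \<comment> \<open>The \<open>c\<close> do not enter \<open>pt\<close>, so they can be adjoined by
    means of their own derivations.\<close>
  have ind: "indep (Inl ` X \<union> range Inr) x"
  proof (rule indep_extend[OF indX])
    fix j :: "(nat \<times> nat) \<times> nat + nat \<times> 'd expo" assume "j \<in> range Inr"
    then obtain t where t: "j = Inr t" by blast
    obtain D where D: "is_der D" "\<And>z. D (gg z) = (if z = Inr (Inl t) then 1 else 0)"
      using gg_der[of "Inr (Inl t)"] by blast
    have "D (pt v) = 0" for v by (rule der_pt[OF D(1)]) (simp_all add: D(2))
    then show "\<exists>D. is_der D \<and> D (x j) \<noteq> 0 \<and> (\<forall>i\<in>Inl ` X \<union> range Inr. i \<noteq> j \<longrightarrow> D (x i) = 0)"
      using D by (intro exI[of _ D]) (auto simp: t x_def split: if_splits)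
  qed
  have "\<forall>h\<in>I. \<exists>p. level (fst p) (snd p) \<and> h = hh (fst p) (snd p)"
  proof
    fix h assume "h \<in> I"
    then obtain i k where "level i k" "h = hh i k" using hh_surj I(2) by blast
    then show "\<exists>p. level (fst p) (snd p) \<and> h = hh (fst p) (snd p)" by (intro exI[of _ "(i, k)"]) simp
  qed
  then obtain lv where lv: "\<And>h. h \<in> I \<Longrightarrow> level (fst (lv h)) (snd (lv h)) \<and> h = hh (fst (lv h)) (snd (lv h))"
    by metis
  let ?f = "\<lambda>h. Inl ((fst (lv h), 0), snd (lv h)) :: (nat \<times> nat) \<times> nat + nat \<times> 'd expo"
  have not_i0: "fst (lv h) \<noteq> i0" if "h \<in> I" for h using lv[OF that] i0(3) that by metis
  have fX: "?f ` I \<subseteq> Inl ` X \<union> range Inr"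
    using lv not_i0 by (auto simp: X_def indets_A_def level_def)
  have inj: "inj_on ?f I"
    by (rule inj_onI) (use lv in \<open>auto simp: prod_eq_iff, metis\<close>)
  have fin: "finite (ep ` (I - {h0}))" using I by simp
  \<comment> \<open>One condition for each element of \<open>I\<close> except \<open>h0\<close>,
    against one derivation for each element of \<open>I\<close>.\<close>
  have cards: "card (ep ` (I - {h0})) < card I"
    using le_less_trans[OF card_image_le card_Diff1_less[OF I(1,4)]] I(1) by simp
  obtain E e where E: "is_der E" "\<exists>w\<in>I. e w \<noteq> 0" "\<forall>w\<in>I. E (x (?f w)) = e w"
    "\<forall>j\<in>Inl ` X \<union> range Inr - ?f ` I. E (x j) = 0" "\<forall>c\<in>ep ` (I - {h0}). E c = 0"
    using indep_derivation_killing[OF ind I(1) fX inj fin cards] by (elim exE conjE) (rule that; assumption)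
  have Ecv: "E (cv t) = 0" for t
    using E(4)[rule_format, of "Inr t"] by (auto simp: x_def)
  have EX: "E (pt v) = 0" if "v \<in> X" "\<And>h. h \<in> I \<Longrightarrow> v \<noteq> ((fst (lv h), 0), snd (lv h))" for v
    using E(4)[rule_format, of "Inl v"] that by (auto simp: x_def)
  have ER: "E (pt v) = 0" if v: "v \<in> non_leading \<times> UNIV \<inter> indets_A P \<times> UNIV \<union> R_slots" for v
  proof -
    have *: "E (pt v) = 0" if v: "v \<in> non_leading \<times> UNIV \<inter> indets_A P \<times> UNIV \<union> R_slots" "v \<noteq> ((i0, 0), s)" for v
    proof (rule EX)
      have "v \<in> indets_A P \<times> UNIV" using v vars_R_indets by (auto simp: R_slots_def)
      moreover have "v \<noteq> ((i0, 0), m)" if "m \<ge> s" for m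
      proof
        assume vm: "v = ((i0, 0), m)"
        then have "((i0, 0), m) \<in> R_slots" using v by (auto simp: non_leading_def)
        then obtain s' where "m \<le> s'" "((i0, 0), s') \<in> vars R" by (auto simp: R_slots_def)
        then have "m \<le> s" using i0(2)[of s'] by (cases "s' \<le> s") auto
        then show False using v(2) vm that by simp
      qed
      ultimately show "v \<in> X" by (auto simp: X_def)
      show "v \<noteq> ((fst (lv h), 0), snd (lv h))" if h: "h \<in> I" for h
      proof
        assume "v = ((fst (lv h), 0), snd (lv h))"
        then have "((fst (lv h), 0), snd (lv h)) \<in> R_slots" using v by (auto simp: non_leading_def)
        then have "h \<in> res_levels" using lv[OF h] by (auto simp: res_levels_def)
        then show False using h I(3) by blast
      qed
    qed
    \<comment> \<open>This coordinate lies outside \<open>X\<close>, where independence says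
      nothing; the separant supplies it.\<close>
    have "E (pt ((i0, 0), s)) = 0"
      by (rule der_R_top[OF E(1) i0(1,2)]) (use * vars_R vars_R_indets in blast)+
    then show ?thesis using *[OF v] by (cases "v = ((i0, 0), s)") auto
  qed
  have "\<exists>h\<in>I. \<exists>\<alpha>\<in>supp P B h. E (mn h \<alpha>) \<noteq> 0"
  proof (rule ccontr)
    assume "\<not> ?thesis"
    then have mono: "E (mn h \<alpha>) = 0" if "h \<in> I" "\<alpha> \<in> supp P B h" for h \<alpha> using that by blast
    \<comment> \<open>If the monomials of all levels in \<open>I\<close> were killed,
      differentiating the relation of a level would isolate its top coordinate, the lower ones being
      killed by induction. So all coordinates attached to \<open>I\<close> would be killed, against
      the choice of \<open>e\<close>.\<close>
    have top: "level i k \<Longrightarrow> hh i k \<in> I \<Longrightarrow> E (pt ((i, 0), k)) = 0" for i k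
    proof (induct k rule: less_induct)
      case (less k)
      let ?h = "hh i k" and ?x = "((i, 0), k)"
      have ne: "i \<noteq> i0" using less.prems i0(3) by blast
      have below: "E (pt y) = 0" if y: "y \<in> vars (lookup (dgp P i k) \<mu>)" "y \<noteq> ?x" for y \<mu>
      proof -
        have "y \<in> non_leading \<times> UNIV \<inter> indets_A P \<times> UNIV \<or> (\<exists>j<k. y = ((i, 0), j) \<and> y \<in> indets_A P \<times> UNIV)"
          using gslots_level[OF less.prems(1) y(1)] y(2) le_neq_implies_less by blast
        then consider "y \<in> non_leading \<times> UNIV \<inter> indets_A P \<times> UNIV" | j where "j < k" "y = ((i, 0), j)" "y \<in> indets_A P \<times> UNIV"
          by blast
        then show ?thesis
        proof cases
          case 1
          then show ?thesis using ER by blast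
        next
          case 2
          have lj: "level i j" using level_down[OF less.prems(1)] 2(1) by simp
          show ?thesis
          proof (cases "hh i j \<in> I")
            case True
            then show ?thesis using less.hyps[OF 2(1) lj] 2(2) by simp
          next
            case False
            show ?thesis
            proof (rule EX)
              show "y \<in> X" using 2 ne by (auto simp: X_def)
              show "y \<noteq> ((fst (lv h), 0), snd (lv h))" if h: "h \<in> I" for h
                using lv[OF h] False h 2(2) by auto
            qed
          qed
        qed
      qed
      have Eval: "E (val (?h, \<alpha>)) = (if \<alpha> = T ?h then E (pt ?x) else 0)" for \<alpha>
      proof -
        have "E (val (?h, \<alpha>)) = peval of_rat pt (pdiff ?x (lookup (dgp P i k) (ups_mono B \<alpha>))) * E (pt ?x)"
          unfolding val_hh[OF less.prems(1)] by (rule der_peval_1[OF E(1) below])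
        also have "pdiff ?x (lookup (dgp P i k) (ups_mono B \<alpha>)) = cst (if \<alpha> = T ?h then 1 else 0)"
          by (simp add: pdiff_lookup_deriv_gpoly[OF gslots_top] gcoeff_top ups_mono_T[OF less.prems(1), symmetric] inj_ups_mono)
        finally show ?thesis by (simp add: peval_cst[OF rhom_of_rat] split: if_splits)
      qed
      have h: "?h \<in> {1..size_L P}" using hh_range less.prems by blast
      have "0 = E (\<Sum>\<alpha>\<in>supp P B ?h. val (?h, \<alpha>) * mn ?h \<alpha>)"
        using val_relation[OF less.prems(1)] der_0[OF E(1)] by simp
      also have "\<dots> = (\<Sum>\<alpha>\<in>supp P B ?h. if \<alpha> = T ?h then E (pt ?x) * mn ?h (T ?h) else 0)"
        unfolding der_sum[OF E(1)]
        by (rule sum.cong) (auto simp: der_mult[OF E(1)] Eval mono[OF less.prems(2)])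
      also have "\<dots> = E (pt ?x)"
        using T_supp[OF h] finite_supp[OF h] by (simp add: mn_T)
      finally show ?case by simp
    qed
    obtain w where w: "w \<in> I" "e w \<noteq> 0" using E(2) by blast
    have "E (x (?f w)) = 0"
      using top[of "fst (lv w)" "snd (lv w)"] lv[OF w(1)] w(1) by (simp add: x_def)
    then show False using E(3) w by simp
  qed
  then show ?thesis
    using E(1,5) Ecv der_val[OF E(1) ER] by (intro exI[of _ E]) auto
qed

end

context specialization
begin

text \<open>Here the levels of \<open>R\<close> lie in \<open>S\<close> and the codimension hypothesis provides the derivations. Since the
  supports grow with the order, killing the monomials of the levels in \<open>I\<close> kills those of the levels of \<open>R\<close>.\<close>

lemma rigid_hit:
  assumes \<tau>: "admissible P \<tau>" and S: "S = lam B ` PS P \<tau>"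
    and h1: "indep (coeffs_tau P B \<tau> - {(h1, T h1)}) ceps"
    and I: "I \<subseteq> S - res_levels" "h0 \<in> I"
    and hit: "\<And>i s. ((i, 0), s) \<in> vars R \<Longrightarrow> \<exists>k. level i k \<and> hh i k \<in> I"
  shows "\<exists>E. is_der E \<and> (\<forall>h\<in>S. \<forall>\<alpha>\<in>supp P B h. \<alpha> \<noteq> T h \<longrightarrow> E (cv (h, \<alpha>)) = 0)
    \<and> (\<forall>h\<in>res_levels. \<forall>\<alpha>. E (val (h, \<alpha>)) = 0) \<and> (\<forall>h\<in>I - {h0}. E (ep h) = 0)
    \<and> (E (ep h0) \<noteq> 0 \<or> (\<exists>h\<in>I. \<exists>\<alpha>\<in>supp P B h. E (mn h \<alpha>) \<noteq> 0))"
proof -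
  let ?V = "coeffs_tau P B \<tau>"
  have V: "?V = (SIGMA h : S. supp P B h)" by (simp add: coeffs_tau_def S)
  have SL: "S \<subseteq> {1..size_L P}"
    using hh_range admissible_level[OF \<tau>] by (auto simp: S PS_levels)
  have S_iff: "hh i k \<in> S \<longleftrightarrow> Fin (int k) \<le> \<tau> i" if l: "level i k" for i k
  proof
    assume "hh i k \<in> S"
    then obtain i' k' where *: "hh i k = hh i' k'" "i' \<in> N" "Fin (int k') \<le> \<tau> i'" by (auto simp: S PS_levels)
    then show "Fin (int k) \<le> \<tau> i" using hh_inj[OF l admissible_level[OF \<tau> *(2,3)]] by simp
  next
    assume "Fin (int k) \<le> \<tau> i"
    then show "hh i k \<in> S" using l by (auto simp: S PS_levels level_def)
  qed
  \<comment> \<open>\<open>I\<close> avoids the levels of \<open>R\<close>, so a label of index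
    \<open>i\<close> in \<open>I\<close> has order above that of \<open>R\<close> in
    \<open>(i, 0)\<close>.\<close>
  have hit': "\<exists>k'. level i k' \<and> hh i k' \<in> I \<and> k \<le> k'" if k: "((i, 0), k) \<in> R_slots" for i k
  proof -
    obtain s where s: "((i, 0), s) \<in> vars R" "\<And>m. ((i, 0), m) \<in> R_slots \<longleftrightarrow> m \<le> s"
      by (rule R_leading_max[OF k], rule that)
    obtain k' where k': "level i k'" "hh i k' \<in> I" using hit[OF s(1)] by blast
    then have "((i, 0), k') \<notin> R_slots" using I(1) hh_res_levels by blast
    then have "k \<le> k'" using s(2)[of k'] s(2)[of k] k by simp
    then show ?thesis using k' by blast
  qed
  have slot_level: "level i k \<and> hh i k \<in> res_levels" if k: "((i, 0), k) \<in> R_slots" for i k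
  proof -
    obtain k' where "level i k'" "k \<le> k'" using hit'[OF k] by blast
    then have "level i k" by (rule level_down)
    then show ?thesis using k hh_res_levels by blast
  qed
  have JS: "res_levels \<subseteq> S"
  proof
    fix j assume "j \<in> res_levels"
    then obtain i k where j: "level i k" "((i, 0), k) \<in> R_slots" "j = hh i k" by (auto simp: res_levels_def)
    obtain k' where k': "level i k'" "hh i k' \<in> I" "k \<le> k'" using hit'[OF j(2)] by blast
    have "Fin (int k) \<le> Fin (int k')" using k'(3) by simp
    also have "Fin (int k') \<le> \<tau> i" using S_iff[OF k'(1)] k'(2) I(1) by blast
    finally show "j \<in> S" using S_iff[OF j(1)] j(3) by blast
  qed
  have fin: "finite S" "finite res_levels" "finite I"
    using SL JS I finite_subset[of _ "{1..size_L P}"] by (auto dest: finite_subset)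
  obtain i0 s where i0: "((i0, 0), s) \<in> vars R" "\<And>m. m > s \<Longrightarrow> ((i0, 0), m) \<notin> vars R"
    "((i0, 0), s) \<in> R_slots"
    using R_leading_exists R_leading_max by (metis (mono_tags, lifting) R_slots_def le_refl mem_Collect_eq)
  define x where "x = case_sum av ceps"
  have ind1: "indep (Inr ` (?V - {(h1, T h1)})) x"
    using h1 by (intro indep_image) (simp add: x_def comp_def)
  \<comment> \<open>The coefficients in \<open>non_leading\<close> join the family so that every
    combination of the chosen derivations kills them; they need no conditions in
    \<open>C\<close>.\<close>
  have ind: "indep (Inr ` (?V - {(h1, T h1)}) \<union> Inl ` (non_leading \<times> UNIV)) x"
  proof (rule indep_extend[OF ind1])
    fix j :: "(nat \<times> nat) \<times> nat + nat \<times> 'd expo" assume "j \<in> Inl ` (non_leading \<times> UNIV)"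
    then obtain t where t: "j = Inl t" by blast
    obtain D where D: "is_der D" "\<And>z. D (gg z) = (if z = Inl t then 1 else 0)"
      using gg_der[of "Inl t"] by blast
    have "D (ep h) = 0" for h
      by (rule ep_der[OF D(1)]) (auto intro!: mn_der[OF D(1)] simp: D(2))
    then have "D (ceps z) = 0" for z by (cases z) (simp add: eps_slots_def D(2))
    then show "\<exists>D. is_der D \<and> D (x j) \<noteq> 0
      \<and> (\<forall>i\<in>Inr ` (?V - {(h1, T h1)}) \<union> Inl ` (non_leading \<times> UNIV). i \<noteq> j \<longrightarrow> D (x i) = 0)"
      using D by (intro exI[of _ D]) (auto simp: t x_def split: if_splits)
  qed
  let ?W = "res_levels \<union> I - {h1}"
  let ?f = "\<lambda>h. Inr (h, T h) :: (nat \<times> nat) \<times> nat + nat \<times> 'd expo"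
  have fW: "?f ` ?W \<subseteq> Inr ` (?V - {(h1, T h1)}) \<union> Inl ` (non_leading \<times> UNIV)"
  proof (rule image_subsetI)
    fix h assume "h \<in> ?W"
    then have "h \<in> S" "h \<noteq> h1" using JS I by auto
    then have "(h, T h) \<in> ?V - {(h1, T h1)}" using T_supp SL by (auto simp: V)
    then show "?f h \<in> Inr ` (?V - {(h1, T h1)}) \<union> Inl ` (non_leading \<times> UNIV)" by blast
  qed
  \<comment> \<open>The count: \<open>?W\<close> loses at most the slot of \<open>h1\<close>, while
    \<open>C\<close> omits both the coordinate \<open>(i0, s)\<close> and the label
    \<open>h0\<close>. So derivations outnumber conditions, and the omitted coordinate is recovered
    by \<open>der_R_top\<close>.\<close>
  define C where "C = (\<lambda>(i, k). pt ((i, 0), k)) ` {(i, k). ((i, 0), k) \<in> R_slots \<and> (i, k) \<noteq> (i0, s)} \<union> ep ` (I - {h0})"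
  have C: "finite C" "card C < card ?W"
  proof -
    let ?J = "{(i, k). ((i, 0), k) \<in> R_slots}"
    have bij: "bij_betw (\<lambda>(i, k). hh i k) ?J res_levels"
      unfolding bij_betw_def inj_on_def
      using slot_level by (fastforce simp: res_levels_def hh_inj)
    then have J: "finite ?J" "card ?J = card res_levels"
      using fin(2) by (auto simp: bij_betw_finite bij_betw_same_card)
    have eq: "{(i, k). ((i, 0), k) \<in> R_slots \<and> (i, k) \<noteq> (i0, s)} = ?J - {(i0, s)}" by auto
    show "finite C" unfolding C_def eq using J fin by simp
    have "card C \<le> card ((\<lambda>(i, k). pt ((i, 0), k)) ` (?J - {(i0, s)})) + card (ep ` (I - {h0}))"
      unfolding C_def eq by (rule card_Un_le)
    also have "\<dots> \<le> card (?J - {(i0, s)}) + card (I - {h0})"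
      using J fin by (intro add_mono card_image_le) auto
    also have "\<dots> = (card res_levels - 1) + (card I - 1)"
      using J i0(3) I(2) by simp
    also have "\<dots> < card (res_levels \<union> I) - 1"
    proof -
      have "card (res_levels \<union> I) = card res_levels + card I"
        using fin I(1) by (intro card_Un_disjoint) auto
      moreover have "card res_levels > 0" "card I > 0"
        using J i0(3) I(2) fin by (auto simp: card_gt_0_iff simp flip: J(2))
      ultimately show ?thesis by linarith
    qed
    also have "\<dots> \<le> card ?W"
      using fin card_Diff_singleton_if[of "res_levels \<union> I" h1] by auto
    finally show "card C < card ?W" .
  qed
  have finW: "finite ?W" and injW: "inj_on ?f ?W" using fin by (auto simp: inj_on_def)
  obtain E e where E: "is_der E" "\<exists>w\<in>?W. e w \<noteq> 0" "\<forall>w\<in>?W. E (x (?f w)) = e w"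
    "\<forall>j\<in>Inr ` (?V - {(h1, T h1)}) \<union> Inl ` (non_leading \<times> UNIV) - ?f ` ?W. E (x j) = 0" "\<forall>c\<in>C. E c = 0"
    using indep_derivation_killing[OF ind finW fW injW C] by (elim exE conjE) (rule that; assumption)
  have Ecv: "E (cv (h, \<alpha>)) = 0" if "h \<in> S" "\<alpha> \<in> supp P B h" "\<alpha> \<noteq> T h" for h \<alpha>
    using E(4)[rule_format, of "Inr (h, \<alpha>)"] that by (auto simp: x_def V eps_slots_def)
  have Eav: "E (pt v) = 0" if "v \<in> non_leading \<times> UNIV" for v
    using E(4)[rule_format, of "Inl v"] that pt_non_leading[of v] by (auto simp: x_def)
  have Eslot: "E (pt v) = 0" if v: "v \<in> R_slots" "v \<noteq> ((i0, 0), s)" for v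
  proof -
    obtain i k where "v = ((i, 0), k)" using v by (auto simp: R_slots_def)
    then have "pt v \<in> C" using v by (force simp: C_def)
    then show ?thesis using E(5) by blast
  qed
  have "E (pt ((i0, 0), s)) = 0"
    by (rule der_R_top[OF E(1) i0(1,2)]) (use Eav Eslot vars_R in blast)+
  then have ER: "E (pt v) = 0" if "v \<in> non_leading \<times> UNIV \<inter> indets_A P \<times> UNIV \<union> R_slots" for v
    using Eav Eslot that by blast
  have "E (ep h0) \<noteq> 0 \<or> (\<exists>h\<in>I. \<exists>\<alpha>\<in>supp P B h. E (mn h \<alpha>) \<noteq> 0)"
  proof (rule ccontr)
    assume "\<not> ?thesis"
    then have 0: "E (ep h0) = 0" "\<And>h \<alpha>. h \<in> I \<Longrightarrow> \<alpha> \<in> supp P B h \<Longrightarrow> E (mn h \<alpha>) = 0" by blast+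
    \<comment> \<open>A level of \<open>R\<close> shares its distinguished monomial with a higher
      level in \<open>I\<close>, so its \<open>mn\<close> are among those already killed. Then every
      \<open>ep\<close> in \<open>?W\<close> is killed, against the choice of
      \<open>e\<close>.\<close>
    have "E (ep h) = 0" if h: "h \<in> res_levels \<union> I" for h
    proof (cases "h \<in> I")
      case True
      then show ?thesis using 0(1) E(5) by (cases "h = h0") (auto simp: C_def)
    next
      case False
      then obtain i k where j: "level i k" "((i, 0), k) \<in> R_slots" "h = hh i k" using h by (auto simp: res_levels_def)
      obtain k' where k': "level i k'" "hh i k' \<in> I" "k \<le> k'" using hit'[OF j(2)] by blast
      have hS: "h \<in> S" using h False JS by blast
      show ?thesis
      proof (rule ep_der[OF E(1)])
        show "E (cv t) = 0" if "t \<in> non_dist" "fst t = h" "snd t \<in> supp P B h" for t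
          using Ecv[OF hS that(3)] that by (cases t) (auto simp: non_dist_def)
        show "E (mn h \<alpha>) = 0" if \<alpha>: "\<alpha> \<in> supp P B h" for \<alpha>
        proof -
          have "\<alpha> \<in> supp P B (hh i k')" using \<alpha> supp_mono[OF j(1) k'(1,3)] j(3) by blast
          moreover have "mn h \<alpha> = mn (hh i k') \<alpha>" using T_eq[OF j(1) k'(1)] by (simp add: mn_def j(3))
          ultimately show ?thesis using 0(2)[OF k'(2)] by simp
        qed
      qed
    qed
    moreover obtain w where w: "w \<in> ?W" "e w \<noteq> 0" using E(2) by blast
    moreover have "E (ep w) = e w" using E(3) w(1) by (simp add: x_def eps_slots_def)
    ultimately show False by auto
  qed
  then show ?thesis
    using E(1) Ecv der_val[OF E(1) ER] E(5) by (intro exI[of _ E]) (auto simp: C_def)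
qed

lemma R_dvd_Xi:
  assumes \<tau>: "admissible P \<tau>"
    and codim: "ideal_codim (ring_on (poly_over (coeffs_tau P B \<tau>))) (elim_ideal P B \<tau>) = 1"
    and Q: "Q \<in> poly_over (coeffs_tau P B \<tau>)" "subst_eps P B T Q = 0" "lam B ` PS P \<tau> \<noteq> {}"
  shows "Xi P B Q \<in> ring_D P \<and> R dvd Xi P B Q"
proof -
  define S where "S = lam B ` PS P \<tau>"
  have V: "coeffs_tau P B \<tau> = (SIGMA h : S. supp P B h)" by (simp add: coeffs_tau_def S_def)
  have SL: "S \<subseteq> {1..size_L P}"
    using hh_range admissible_level[OF \<tau>] by (auto simp: S_def PS_levels)
  have finS: "finite S" using SL finite_subset by blast
  obtain h1 where h1: "indep (coeffs_tau P B \<tau> - {(h1, T h1)}) ceps"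
    using codim_one_independent[OF \<tau> Q(3) codim] by blast
  \<comment> \<open>The \<open>c\<close> enter neither the generic zero nor the monomials, so each
    has a derivation that moves it alone.\<close>
  have dual: "\<exists>D. is_der D \<and> (\<forall>s. D (cv s) = (if s = t then 1 else 0)) \<and> (\<forall>h \<beta>. D (mn h \<beta>) = 0) \<and> (\<forall>h \<beta>. D (val (h, \<beta>)) = 0)" for t
  proof -
    obtain D where D: "is_der D" "\<And>z. D (gg z) = (if z = Inr (Inl t) then 1 else 0)" using gg_der by blast
    have "D (pt x) = 0" for x by (rule der_pt[OF D(1)]) (simp_all add: D(2))
    then have "D (val (h, \<beta>)) = 0" for h \<beta> by (auto simp: val_def intro: der_peval_0[OF D(1)])
    moreover have "D (mn h \<beta>) = 0" for h \<beta> by (rule mn_der[OF D(1)]) (simp add: D(2))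
    ultimately show ?thesis using D by (intro exI[of _ D]) simp
  qed
  let ?slot = "\<lambda>w (h, \<alpha>). if h \<in> res_levels then val (h, \<alpha>) else if \<alpha> = T h then w h else cv (h, \<alpha>)"
  have slots: "peval of_rat (?slot w') Q = 0" if w': "\<And>h. h \<notin> S - res_levels \<Longrightarrow> w' h = ep h" for w'
  proof (rule slots_free[where mn = mn and val = val and J = res_levels and G = cv and A = "supp P B" and T = T
        and S = S and I = "S - res_levels" and w = ep])
    show "finite S" by (rule finS)
    show "finite (supp P B h)" if "h \<in> S" for h using finite_supp SL that by blast
    show "T h \<in> supp P B h" if "h \<in> S" for h using T_supp SL that by blast
    show "mn h (T h) = 1" for h by (rule mn_T)
    show "Q \<in> poly_over (SIGMA h : S. supp P B h)" using Q(1) V by simp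
    show "ep h = - (\<Sum>\<alpha>\<in>supp P B h - {T h}. cv (h, \<alpha>) * mn h \<alpha>)" for h by (simp add: eps_value_def)
    show "w' h = ep h" if "h \<notin> S - res_levels" for h by (rule w'[OF that])
    \<comment> \<open>By \<open>val_relation\<close> the values on the levels of \<open>R\<close>
      already satisfy the equation of \<open>eps\<close>, so this is the hypothesis on
      \<open>Q\<close> evaluated at the mixture \<open>?c\<close>.\<close>
    show "peval of_rat (?slot ep) Q = 0"
    proof -
      let ?c = "\<lambda>(h, \<alpha>). if h \<in> res_levels then val (h, \<alpha>) else cv (h, \<alpha>)"
      have "peval of_rat (eps_slots ?c) Q = 0"
        unfolding leval_subst_eps[symmetric] Q(2) by simp
      moreover have "peval of_rat (eps_slots ?c) Q = peval of_rat (?slot ep) Q"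
      proof (rule peval_cong)
        fix x assume "x \<in> vars Q"
        obtain h \<alpha> where x: "x = (h, \<alpha>)" by (cases x)
        have "eps_value ?c h = val (h, T h)" if h: "h \<in> res_levels"
        proof -
          obtain i k where l: "level i k" "h = hh i k" using h by (auto simp: res_levels_def)
          have hL: "h \<in> {1..size_L P}" using hh_range l by blast
          have "0 = val (h, T h) * mn h (T h) + (\<Sum>\<alpha>\<in>supp P B h - {T h}. val (h, \<alpha>) * mn h \<alpha>)"
            using val_relation[OF l(1)] sum.remove[OF finite_supp[OF hL] T_supp[OF hL], of "\<lambda>\<alpha>. val (h, \<alpha>) * mn h \<alpha>"] l(2)
            by simp
          then have "val (h, T h) = - (\<Sum>\<alpha>\<in>supp P B h - {T h}. val (h, \<alpha>) * mn h \<alpha>)"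
            unfolding mn_T eq_neg_iff_add_eq_0 by simp
          then show ?thesis using h by (simp add: eps_value_def)
        qed
        then show "eps_slots ?c x = ?slot ep x" by (auto simp: x eps_slots_def eps_value_def)
      qed
      ultimately show ?thesis by simp
    qed
    show "\<exists>D. is_der D \<and> D (cv (h, \<alpha>)) = 1
        \<and> (\<forall>h'\<in>S. \<forall>\<beta>\<in>supp P B h'. \<beta> \<noteq> T h' \<longrightarrow> (h', \<beta>) \<noteq> (h, \<alpha>) \<longrightarrow> D (cv (h', \<beta>)) = 0)
        \<and> (\<forall>h'\<in>S. \<forall>\<beta>\<in>supp P B h'. D (mn h' \<beta>) = 0)
        \<and> (\<forall>h'\<in>S \<inter> res_levels. \<forall>\<beta>\<in>supp P B h'. D (val (h', \<beta>)) = 0)" for h \<alpha>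
      using dual[of "(h, \<alpha>)"] by (elim exE) (intro exI, auto)
    show "\<exists>E. is_der E \<and> (\<forall>h\<in>S. \<forall>\<alpha>\<in>supp P B h. \<alpha> \<noteq> T h \<longrightarrow> E (cv (h, \<alpha>)) = 0)
        \<and> (\<forall>h\<in>S \<inter> res_levels. \<forall>\<alpha>\<in>supp P B h. E (val (h, \<alpha>)) = 0)
        \<and> (\<forall>h\<in>I - {h0}. E (- (\<Sum>\<alpha>\<in>supp P B h - {T h}. cv (h, \<alpha>) * mn h \<alpha>)) = 0)
        \<and> (E (- (\<Sum>\<alpha>\<in>supp P B h0 - {T h0}. cv (h0, \<alpha>) * mn h0 \<alpha>)) \<noteq> 0
            \<or> (\<exists>h\<in>I. \<exists>\<alpha>\<in>supp P B h. E (mn h \<alpha>) \<noteq> 0))"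
      if I: "I \<subseteq> S - res_levels" "h0 \<in> I" for I h0
    proof (cases "\<forall>i s. ((i, 0), s) \<in> vars R \<longrightarrow> (\<exists>k. level i k \<and> hh i k \<in> I)")
      case True
      then show ?thesis
        using rigid_hit[OF \<tau> S_def h1 I] unfolding eps_value_def by blast
    next
      case False
      then obtain i s0 where i: "((i, 0), s0) \<in> vars R" "\<And>k. level i k \<Longrightarrow> hh i k \<notin> I" by blast
      then have "((i, 0), s0) \<in> R_slots" by (auto simp: R_slots_def)
      then obtain s where s: "((i, 0), s) \<in> vars R" "\<And>m. m > s \<Longrightarrow> ((i, 0), m) \<notin> vars R"
        using R_leading_max by metis
      have I': "finite I" "I \<subseteq> {1..size_L P}" "I \<inter> res_levels = {}"
        using I SL finS finite_subset by blast+
      show ?thesis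
        using rigid_missing[OF I' I(2) s i(2)] unfolding eps_value_def by blast
    qed
  qed auto
  \<comment> \<open>Off \<open>non_leading\<close> and \<open>R_slots\<close> the point takes
    generic values \<open>av\<close> that do not enter \<open>pt\<close>, which makes these
    coordinates free.\<close>
  define b where "b x = (if x \<in> non_leading \<times> UNIV \<union> R_slots then pt x else av x)" for x
  define z where "z = (\<lambda>(h, \<alpha>). peval of_rat b (lookup (rho P B h) (ups_mono B \<alpha>)))"
  have z_val: "z (h, \<alpha>) = val (h, \<alpha>)" if h: "h \<in> res_levels" for h \<alpha>
  proof -
    obtain i k where l: "level i k" "h = hh i k" "((i, 0), k) \<in> R_slots" using h by (auto simp: res_levels_def)
    have "((i, 0), j) \<in> R_slots" if "j \<le> k" for j
      using l(3) that by (auto simp: R_slots_def intro: le_trans)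
    then have "b x = pt x" if "x \<in> vars (lookup (dgp P i k) (ups_mono B \<alpha>))" for x
      using gslots_level[OF l(1) that] by (auto simp: b_def)
    then show ?thesis
      unfolding z_def val_def prod.case l(2) rho_hh[OF l(1)] by (rule peval_cong)
  qed
  have "peval of_rat z Q = 0"
  \<comment> \<open>The distinguished slots are held at rationals while the others move from
    \<open>cv\<close> to \<open>z\<close>: the values \<open>ep\<close> depend on \<open>cv\<close>,
    so the dual derivations would not kill them.\<close>
  proof (rule peval_all_rat_set[of "(\<lambda>h. (h, T h)) ` (S - res_levels)" z])
    fix r :: "nat \<times> 'd expo \<Rightarrow> rat"
    let ?w = "\<lambda>h. if h \<in> S - res_levels then of_rat (r (h, T h)) else ep h"
    let ?zr = "\<lambda>x. if x \<in> (\<lambda>h. (h, T h)) ` (S - res_levels) then of_rat (r x) else z x"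
    let ?Y = "(SIGMA h : S - res_levels. supp P B h - {T h})"
    have "peval of_rat (\<lambda>x. if x \<in> ?Y then z x else ?slot ?w x) Q = 0"
    proof (rule peval_dual_ders[of ?Y Q "coeffs_tau P B \<tau>" "?slot ?w"])
      show "finite ?Y" using finS finite_supp SL by (intro finite_SigmaI) auto
      show "Q \<in> poly_over (coeffs_tau P B \<tau>)" by (rule Q(1))
      show "peval of_rat (?slot ?w) Q = 0" by (rule slots) auto
      fix x assume x: "x \<in> ?Y"
      obtain D where D: "is_der D" "\<And>s. D (cv s) = (if s = x then 1 else 0)" "\<And>h \<beta>. D (val (h, \<beta>)) = 0"
        using dual[of x] by blast
      have "D (?slot ?w y) = (if y = x then 1 else 0)" if "y \<in> coeffs_tau P B \<tau>" for y
        using x that D by (cases y) (auto simp: V der_of_rat[OF D(1)])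
      moreover have "x \<in> coeffs_tau P B \<tau>" using x by (auto simp: V)
      ultimately show "\<exists>D. is_der D \<and> D (?slot ?w x) = 1 \<and> (\<forall>y\<in>coeffs_tau P B \<tau>. y \<noteq> x \<longrightarrow> D (?slot ?w y) = 0)"
        using D(1) by (intro exI[of _ D]) simp
    qed auto
    moreover have "peval of_rat (\<lambda>x. if x \<in> ?Y then z x else ?slot ?w x) Q = peval of_rat ?zr Q"
    proof (rule peval_cong)
      fix x assume "x \<in> vars Q"
      then have "x \<in> (SIGMA h : S. supp P B h)" using Q(1) V by (auto simp: poly_over_def)
      then show "(if x \<in> ?Y then z x else ?slot ?w x) = ?zr x"
        by (cases x) (auto simp: z_val)
    qed
    ultimately show "peval of_rat ?zr Q = 0" by simp
  qed (use finS in auto)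
  then have 0: "peval of_rat b (Xi P B Q) = 0"
    unfolding Xi_def peval_hom[OF rhom_ev] by (simp add: z_def peval_cst[OF rhom_of_rat] case_prod_beta')
  have QL: "Q \<in> poly_over (ags_coeffs P B)"
    using Q(1) SL V poly_over_mono[of "SIGMA h : S. supp P B h" "ags_coeffs P B"] by (auto simp: ags_coeffs_def)
  have XiD: "Xi P B Q \<in> ring_D P" by (rule Xi_ring_D[OF QL])
  have "R dvd Xi P B Q"
  proof (rule R_dvd_free[OF _ _ XiD 0])
    fix x assume x: "x \<notin> non_leading \<times> UNIV \<union> R_slots"
    obtain D where D: "is_der D" "\<And>z. D (gg z) = (if z = Inl x then 1 else 0)" using gg_der by blast
    have "D (pt y) = 0" for y by (rule der_pt[OF D(1)]) (use x in \<open>auto simp: D(2)\<close>)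
    then show "\<exists>D. is_der D \<and> D (b x) = 1 \<and> (\<forall>z. z \<noteq> x \<longrightarrow> D (b z) = 0)"
      using x D by (intro exI[of _ D]) (auto simp: b_def)
  qed (simp add: b_def)
  then show ?thesis using XiD by blast
qed

end

theorem corollary6p12:
  fixes P :: gsystem and B :: "'d::{finite,linorder} labelling" and T :: "nat \<Rightarrow> 'd expo"
    and l :: nat and X :: "'d ce_choice" and R :: coeff_poly
  assumes "generic_system P"
    and "diff_essential P"
    and "super_essential P"
    and "valid_labelling P B"
    and "distinguished P B T"
    and "l \<in> {1..size_L P}"
    and "valid_choice P B X l"
    and "sylv_det P B X \<noteq> 0"
    and "\<exists>Q\<in>factors_Q P B X T.
           ideal_codim (ring_on (poly_over (coeffs_tau P B (tau_of P B Q)))) (elim_ideal P B (tau_of P B Q)) = 1"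
    and "Xi P B (sylv_det P B X) \<noteq> 0"
    and "is_diff_resultant P R"
  shows "\<exists>E\<in>ring_D P. Xi P B (sylv_det P B X) = E * R"
proof -
  let ?D = "sylv_det P B X"
  obtain Q where Q: "Q \<in> factors_Q P B X T"
    and codim: "ideal_codim (ring_on (poly_over (coeffs_tau P B (tau_of P B Q)))) (elim_ideal P B (tau_of P B Q)) = 1"
    using assms(9) by blast
  have Qp: "Q \<in> poly_over (ags_coeffs P B)" "Q \<noteq> 0" "subst_eps P B T Q = 0"
    using Q by (auto simp: factors_Q_def Let_def ring_irreducible_def)
  obtain C where C: "C \<in> poly_over (ags_coeffs P B)" "?D = Q * C"
    using Q by (auto simp: factors_Q_def Let_def factor_def)
  \<comment> \<open>Exponent vectors are embedded by \<open>lookup\<close> into the functions on the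
    finite type \<open>'d\<close>, which form a countable type.\<close>
  obtain g :: "((nat \<times> nat) \<times> nat) + ((nat \<times> ('d \<Rightarrow> int)) + (nat \<times> nat)) \<Rightarrow> gfield" where g: "indep UNIV g"
    using gfield_generic by blast
  define gg where "gg = g \<circ> map_sum id (map_sum (map_prod id lookup) id)"
  have "indep UNIV gg"
    unfolding gg_def
  proof (rule indep_reindex[OF indep_mono[OF g subset_UNIV]])
    have "inj (lookup :: 'd expo \<Rightarrow> 'd \<Rightarrow> int)" by (rule injI) (simp add: poly_mapping_eqI)
    then show "inj (map_sum id (map_sum (map_prod id (lookup :: 'd expo \<Rightarrow> 'd \<Rightarrow> int)) id))"
      by (intro sum.inj_map prod.inj_map) auto
  qed
  then interpret specialization P B T gg R
    using assms by unfold_locales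
  let ?\<tau> = "tau_of P B Q"
  have \<tau>: "admissible P ?\<tau>" "Q \<in> poly_over (coeffs_tau P B ?\<tau>)" using tau_of_admissible[OF Qp(1)] by auto
  \<comment> \<open>A nonzero constant does not vanish under the substitution of \<open>eps\<close>;
    so the subsystem of \<open>Q\<close> is nonempty.\<close>
  have "vars Q \<noteq> {}"
  proof
    assume "vars Q = {}"
    then obtain c where c: "Q = cst c" using qpoly_vars_empty by blast
    then have "peval of_rat ceps Q = of_rat c" by (simp add: peval_cst[OF rhom_of_rat])
    then show False using c Qp(2,3) peval_ceps_iff[of Q] by simp
  qed
  then have "lam B ` PS P ?\<tau> \<noteq> {}" using \<tau>(2) by (auto simp: poly_over_def coeffs_tau_def)
  then have XQ: "Xi P B Q \<in> ring_D P" "R dvd Xi P B Q"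
    using R_dvd_Xi[OF \<tau>(1) codim \<tau>(2) Qp(3)] by auto
  obtain E where E: "Xi P B Q = R * E" using XQ(2) by (elim dvdE)
  have D: "Xi P B ?D = R * (E * Xi P B C)"
    unfolding C(2) by (simp add: Xi_def peval_mult[OF rhom_cst] flip: E[unfolded Xi_def] mult.assoc)
  have "Xi P B C \<in> ring_D P"
    by (rule Xi_ring_D[OF C(1)])
  then have "Xi P B ?D \<in> ring_D P"
    unfolding C(2) using XQ(1) by (simp add: Xi_def peval_mult[OF rhom_cst] ring_D_def poly_over_mult)
  \<comment> \<open>As the product is not zero, its cofactor can only contain variables of
    \<open>ring_D P\<close>.\<close>
  then have "E * Xi P B C \<in> ring_D P"
    using dvd_poly_over(2)[OF D] assms(10) by (simp add: ring_D_def)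
  then show ?thesis using D by (intro bexI[of _ "E * Xi P B C"]) (simp_all add: mult.commute)
qed

end
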